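(* Let $\mu\in\mathcal{M}_{\mathbb{T}}^\times$ and $t>1$. With $\mu^{\boxtimes t}$, $u$, $R_t$, $V_t^+$ and $h_t$ as defined in the context, let $$S_t=\{\overline{h_t(e^{i\theta})}:\theta\in V_t^+\}.$$ Then the following statements hold. (1) The measure $(\mu^{\boxtimes t})^{\mathrm{ac}}$ is concentrated on the closure of $S_t$. (2) The density of $(\mu^{\boxtimes t})^{\mathrm{ac}}$ is analytic on the set $S_t$ and is given by $$\frac{d\mu^{\boxtimes t}}{d\zeta}\left(\overline{h_t(e^{i\theta})}\right)=\frac{1}{2\pi}\,\frac{1-l_t^2(\theta)}{1-2l_t(\theta)\cos\alpha(\theta)+l_t^2(\theta)},\qquad\theta\in V_t^+,$$ where $l_t(\theta)=R_t(\theta)^{\frac{t}{t-1}}$ and $\alpha(\theta)=\theta-\Im u(R_t(\theta)e^{i\theta})$. (3) The number of connected components of $\mathrm{supp}\,(\mu^{\boxtimes t})^{\mathrm{ac}}$ is a decreasing function of $t\in(1,\infty)$.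
   Context: $\mathbb{D}$ is the open unit disc, $\mathbb{T}$ the unit circle. For a Borel probability measure $\mu$ on $\mathbb{T}$ and $z\in\mathbb{D}$: $\psi_\mu(z)=\int\frac{zs}{1-zs}\,d\mu(s)$, $\eta_\mu=\psi_\mu/(1+\psi_\mu)$. $\mathcal{M}_{\mathbb{T}}^\times$ is the set of Borel probability measures on $\mathbb{T}$ with nonzero first moment $\eta_\mu'(0)=\int\zeta\,d\mu(\zeta)$ and such that $\eta_\mu$ does not vanish on $\mathbb{D}\setminus\{0\}$. For $\mu\in\mathcal{M}_{\mathbb{T}}^\times$ there is an analytic $u:\mathbb{D}\to\mathbb{C}$ with $\Re u\ge0$ and $\eta_\mu(z)=z\exp[-u(z)]$; it is fixed throughout, and $$u(z)=i\alpha_0+\int_{\mathbb{T}}\frac{\zeta+z}{\zeta-z}\,d\rho(\zeta),\quad z\in\mathbb{D},$$ where $-\alpha_0=\arg\eta_\mu'(0)\in[-\pi,\pi]$ and $\rho$ is a finite positive Borel measure on $\mathbb{T}$ with $\rho(\mathbb{T})=-\log|\eta_\mu'(0)|$. For $t>1$ let $\Phi_t(z)=z\exp[(t-1)u(z)]$, $z\in\mathbb{D}$, and $\Omega_t=\{z\in\mathbb{D}:|\Phi_t(z)|<1\}$. There is a continuous $\omega_t:\overline{\mathbb{D}}\to\overline{\mathbb{D}}$, analytic on $\mathbb{D}$, with $\omega_t(0)=0$, $\omega_t(\mathbb D)\subset\mathbb D$ and $\Phi_t(\omega_t(z))=z$ for $z\in\mathbb{D}$. The measure $\mu^{\boxtimes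 t}\in\mathcal{M}_{\mathbb{T}}^\times$ is the unique probability measure on $\mathbb{T}$ with $\eta_{\mu^{\boxtimes t}}(z)=\eta_\mu(\omega_t(z))$, $z\in\mathbb{D}$. For $\theta\in[-\pi,\pi]$ (with $\pm\pi$ identified) and $r\in(0,1)$ let $$T(r,\theta)=\frac{r^2-1}{\log r}\,\frac{1}{1-2r\cos\theta+r^2},\qquad g(\theta)=\int_{-\pi}^{\pi}\frac{d\rho(e^{i\phi})}{1-\cos(\theta-\phi)}\in[0,+\infty],$$ $$R_t(\theta)=\sup\left\{r\in(0,1):\int_{-\pi}^{\pi}T(r,\theta-\phi)\,d\rho(e^{i\phi})<\frac1{t-1}\right\},\qquad V_t^+=\left\{\theta\in[-\pi,\pi]:g(\theta)>\frac1{t-1}\right\}.$$ Here $\int_{-\pi}^{\pi}f(e^{i\phi})\,d\rho(e^{i\phi})$ means $\int_{\mathbb{T}}f\,d\rho$. One has $\partial\Omega_t=\{R_t(\theta)e^{i\theta}:\theta\in[-\pi,\pi]\}$, the functions $u$ and $\Phi_t$ extend continuously to $\overline{\Omega}_t$, and $h_t(e^{i\theta})=\Phi_t(R_t(\theta)e^{i\theta})$ is a homeomorphism of $\mathbb{T}$. $\nu^{\mathrm{ac}}$ is the absolutely continuous part of $\nu$ with respect to arc length measure $d\zeta$ on $\mathbb{T}$ (total mass $2\pi$), densities are with respect to $d\zeta$, and $\mathrm{supp}$ is the closed support. "Decreasing" is meant in the weak sense (non-increasing), and the number of components may be infinite. *)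

theory Defs
  imports "HOL-Probability.Probability"
begin

section \<open>Measures on the unit circle\<close>

text \<open>A Borel measure on the circle \<open>sphere 0 1\<close> is a measure \<open>M\<close> with
  \<open>sets M = sets circle_borel\<close>; its underlying space is then the circle itself.\<close>

definition circle_borel :: "complex measure" where
  "circle_borel = restrict_space borel (sphere 0 1)"

definition arc_length :: "complex measure" where
  "arc_length = distr (restrict_space lborel {-pi<..pi}) circle_borel cis"

definition closed_support :: "'a::topological_space measure \<Rightarrow> 'a set" where
  "closed_support M =
     {x \<in> space M. \<forall>U. open U \<longrightarrow> x \<in> U \<longrightarrow> emeasure M (U \<inter> space M) \<noteq> 0}"

text \<open>Lebesgue decomposition: \<open>K\<close> is the absolutely continuous part of \<open>M\<close> with respect to \<open>L\<close>.\<close>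

definition is_ac_part :: "'a measure \<Rightarrow> 'a measure \<Rightarrow> 'a measure \<Rightarrow> bool" where
  "is_ac_part L M K \<longleftrightarrow>
     sets K = sets M \<and> absolutely_continuous L K \<and>
     (\<exists>S. sets S = sets M \<and>
          (\<exists>N \<in> null_sets L. emeasure S (space M - N) = 0) \<and>
          (\<forall>A \<in> sets M. emeasure M A = emeasure K A + emeasure S A))"

definition ac_part :: "'a measure \<Rightarrow> 'a measure \<Rightarrow> 'a measure" where
  "ac_part L M = (THE K. is_ac_part L M K)"

lemma is_ac_part_emeasure:
  assumes "sets L = sets M" "is_ac_part L M K"
  shows "\<exists>N \<in> null_sets L. \<forall>N' \<in> null_sets L. N \<subseteq> N' \<longrightarrow>
    (\<forall>A \<in> sets M. emeasure K A = emeasure M (A - N'))"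
proof -
  obtain S N where K: "sets K = sets M" "absolutely_continuous L K" and S: "sets S = sets M"
    and N: "N \<in> null_sets L" "emeasure S (space M - N) = 0"
    and eq: "\<And>A. A \<in> sets M \<Longrightarrow> emeasure M A = emeasure K A + emeasure S A"
    using assms(2) unfolding is_ac_part_def by blast
  have "emeasure K A = emeasure M (A - N')"
    if N': "N' \<in> null_sets L" "N \<subseteq> N'" and A: "A \<in> sets M" for N' A
  proof -
    have sN: "N \<in> sets M" "N' \<in> sets M" using N(1) N'(1) assms(1) by auto
    have "A - N' \<subseteq> space M - N" using N'(2) sets.sets_into_space[OF A] by auto
    then have "emeasure S (A - N') \<le> emeasure S (space M - N)"
      by (rule emeasure_mono) (use S sN in auto)
    then have "emeasure S (A - N') = 0" using N(2) by simp
    moreover have "emeasure K (A - N') = emeasure K A"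
      by (rule emeasure_Diff_null_set)
         (use K N'(1) A in \<open>auto simp: absolutely_continuous_def\<close>)
    ultimately show ?thesis using eq[of "A - N'"] A sN by auto
  qed
  with N(1) show ?thesis by blast
qed

lemma ex1_ac_part:
  assumes "finite_measure M" "sets L = sets M"
  shows "\<exists>!K. is_ac_part L M K"
proof (rule ex_ex1I)
  interpret finite_measure M by fact
  have "null_sets L \<noteq> {}" by blast
  then obtain f where f: "range f \<subseteq> emeasure M ` null_sets L"
      "(SUP N\<in>null_sets L. emeasure M N) = (SUP i::nat. f i)"
    using ennreal_Sup_countable_SUP[of "emeasure M ` null_sets L"] by auto
  then have "\<forall>i. \<exists>N. N \<in> null_sets L \<and> f i = emeasure M N" by fast
  then obtain F where F: "\<And>i. F i \<in> null_sets L" "\<And>i. f i = emeasure M (F i)" by metis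
  define N where "N = (\<Union>i. F i)"
  have N: "N \<in> null_sets L" unfolding N_def using F(1) by blast
  then have sN: "N \<in> sets M" using assms(2) by auto
  have max: "emeasure M B \<le> emeasure M N" if "B \<in> null_sets L" for B
  proof -
    have "emeasure M B \<le> (SUP i. f i)" unfolding f(2)[symmetric] using that by (rule SUP_upper)
    also have "\<dots> \<le> emeasure M N"
      unfolding F(2) by (rule SUP_least) (use sN in \<open>auto simp: N_def intro!: emeasure_mono\<close>)
    finally show ?thesis .
  qed
  define K where "K = density M (indicator (space M - N))"
  define S where "S = density M (indicator N)"
  have eK: "emeasure K A = emeasure M (A - N)" if "A \<in> sets M" for A
  proof -
    have "emeasure K A = emeasure M ((space M - N) \<inter> A)"
      unfolding K_def using that sN
      by (subst emeasure_density) (auto simp: indicator_inter_arith[symmetric])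
    also have "(space M - N) \<inter> A = A - N" using sets.sets_into_space[OF that] by auto
    finally show ?thesis .
  qed
  have eS: "emeasure S A = emeasure M (N \<inter> A)" if "A \<in> sets M" for A
    unfolding S_def using that sN
    by (subst emeasure_density) (auto simp: indicator_inter_arith[symmetric])
  have "absolutely_continuous L K"
    unfolding absolutely_continuous_def
  proof
    fix A assume A: "A \<in> null_sets L"
    then have sA: "A \<in> sets M" using assms(2) by auto
    have "emeasure M N + emeasure M (A - N) = emeasure M (N \<union> (A - N))"
      by (rule plus_emeasure) (use sA sN in auto)
    also have "\<dots> \<le> emeasure M N + 0" using max[of "N \<union> A"] A N by auto
    finally have "emeasure M (A - N) = 0"
      by (simp add: ennreal_add_left_cancel_le emeasure_eq_measure)
    then show "A \<in> null_sets K" using eK[OF sA] sA by (auto simp: null_sets_def K_def)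
  qed
  moreover have "emeasure M A = emeasure K A + emeasure S A" if "A \<in> sets M" for A
  proof -
    have "emeasure M (A - N) + emeasure M (N \<inter> A) = emeasure M ((A - N) \<union> (N \<inter> A))"
      by (rule plus_emeasure) (use that sN in auto)
    also have "(A - N) \<union> (N \<inter> A) = A" by auto
    finally show ?thesis using eK[OF that] eS[OF that] by simp
  qed
  moreover have "emeasure S (space M - N) = 0"
  proof -
    have "N \<inter> (space M - N) = {}" by auto
    then show ?thesis using eS[of "space M - N"] sN by auto
  qed
  moreover have "sets K = sets M" "sets S = sets M" by (auto simp: K_def S_def)
  ultimately show "\<exists>K. is_ac_part L M K"
    unfolding is_ac_part_def using N by blast
next
  fix K K' assume K: "is_ac_part L M K" "is_ac_part L M K'"
  obtain N1 where N1: "N1 \<in> null_sets L" "\<And>N'. N' \<in> null_sets L \<Longrightarrow> N1 \<subseteq> N' \<Longrightarrow>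
      (\<forall>A \<in> sets M. emeasure K A = emeasure M (A - N'))"
    using is_ac_part_emeasure[OF assms(2) K(1)] by blast
  obtain N2 where N2: "N2 \<in> null_sets L" "\<And>N'. N' \<in> null_sets L \<Longrightarrow> N2 \<subseteq> N' \<Longrightarrow>
      (\<forall>A \<in> sets M. emeasure K' A = emeasure M (A - N'))"
    using is_ac_part_emeasure[OF assms(2) K(2)] by blast
  have N: "N1 \<union> N2 \<in> null_sets L" using N1(1) N2(1) by auto
  show "K = K'"
  proof (rule measure_eqI)
    show "sets K = sets K'" using K by (auto simp: is_ac_part_def)
    fix A assume "A \<in> sets K"
    then have "A \<in> sets M" using K by (auto simp: is_ac_part_def)
    then show "emeasure K A = emeasure K' A" using N1(2)[OF N] N2(2)[OF N] by auto
  qed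
qed


section \<open>The eta-transform and the multiplicative convolution powers\<close>

definition psi :: "complex measure \<Rightarrow> complex \<Rightarrow> complex" where
  "psi \<mu> z = (\<integral>s. z * s / (1 - z * s) \<partial>\<mu>)"

definition eta :: "complex measure \<Rightarrow> complex \<Rightarrow> complex" where
  "eta \<mu> z = psi \<mu> z / (1 + psi \<mu> z)"

definition MT :: "complex measure set" where
  "MT = {\<mu>. prob_space \<mu> \<and> sets \<mu> = sets circle_borel \<and> (\<integral>\<zeta>. \<zeta> \<partial>\<mu>) \<noteq> 0 \<and>
             (\<forall>z \<in> ball 0 1 - {0}. eta \<mu> z \<noteq> 0)}"

text \<open>The data \<open>u\<close>, \<open>\<alpha>\<^sub>0\<close>, \<open>\<rho>\<close> attached to \<open>\<mu>\<close>. They are determined by \<open>\<mu>\<close> except that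
  \<open>\<alpha>\<^sub>0\<close> may be either of \<open>\<plusminus>\<pi>\<close> when \<open>\<eta>'(0) < 0\<close>. The penultimate clause says that
  \<open>-\<alpha>\<^sub>0\<close> is an argument of \<open>\<eta>'(0)\<close>.\<close>

definition herglotz_data ::
  "complex measure \<Rightarrow> (complex \<Rightarrow> complex) \<Rightarrow> real \<Rightarrow> complex measure \<Rightarrow> bool" where
  "herglotz_data \<mu> u \<alpha>\<^sub>0 \<rho> \<longleftrightarrow>
     u analytic_on ball 0 1 \<and>
     (\<forall>z \<in> ball 0 1. Re (u z) \<ge> 0) \<and>
     (\<forall>z \<in> ball 0 1. eta \<mu> z = z * exp (- u z)) \<and>
     finite_measure \<rho> \<and> sets \<rho> = sets circle_borel \<and>
     (\<forall>z \<in> ball 0 1. u z = \<i> * of_real \<alpha>\<^sub>0 + (\<integral>\<zeta>. (\<zeta> + z) / (\<zeta> - z) \<partial>\<rho>)) \<and>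
     \<alpha>\<^sub>0 \<in> {-pi..pi} \<and>
     deriv (eta \<mu>) 0 = of_real (norm (deriv (eta \<mu>) 0)) * cis (- \<alpha>\<^sub>0) \<and>
     measure \<rho> (space \<rho>) = - ln (norm (deriv (eta \<mu>) 0))"

definition Phi :: "(complex \<Rightarrow> complex) \<Rightarrow> real \<Rightarrow> complex \<Rightarrow> complex" where
  "Phi u t z = z * exp (of_real (t - 1) * u z)"

definition Omega :: "(complex \<Rightarrow> complex) \<Rightarrow> real \<Rightarrow> complex set" where
  "Omega u t = {z \<in> ball 0 1. norm (Phi u t z) < 1}"

definition subordination ::
  "(complex \<Rightarrow> complex) \<Rightarrow> real \<Rightarrow> (complex \<Rightarrow> complex) \<Rightarrow> bool" where
  "subordination u t \<omega> \<longleftrightarrow>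
     continuous_on (cball 0 1) \<omega> \<and> \<omega> ` cball 0 1 \<subseteq> cball 0 1 \<and>
     \<omega> analytic_on ball 0 1 \<and> \<omega> 0 = 0 \<and> \<omega> ` ball 0 1 \<subseteq> ball 0 1 \<and>
     (\<forall>z \<in> ball 0 1. Phi u t (\<omega> z) = z)"

text \<open>\<open>\<nu>\<close> is the power of \<open>\<mu>\<close> with subordination function \<open>\<omega>\<close>; a probability measure on the
  circle is determined by its eta-transform on the disc, so there is at most one such \<open>\<nu>\<close>.\<close>

definition free_mult_power ::
  "complex measure \<Rightarrow> (complex \<Rightarrow> complex) \<Rightarrow> complex measure \<Rightarrow> bool" where
  "free_mult_power \<mu> \<omega> \<nu> \<longleftrightarrow> \<nu> \<in> MT \<and> (\<forall>z \<in> ball 0 1. eta \<nu> z = eta \<mu> (\<omega> z))"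


section \<open>The boundary of \<open>\<Omega>\<^sub>t\<close>\<close>

definition T_kernel :: "real \<Rightarrow> real \<Rightarrow> real" where
  "T_kernel r \<theta> = (r\<^sup>2 - 1) / ln r * (1 / (1 - 2 * r * cos \<theta> + r\<^sup>2))"

text \<open>The integrand is \<open>\<infinity>\<close> at \<open>\<zeta> = cis \<theta>\<close>, because \<open>1 / 0 = \<infinity>\<close> in \<^typ>\<open>ennreal\<close>.\<close>

definition g_fun :: "complex measure \<Rightarrow> real \<Rightarrow> ennreal" where
  "g_fun \<rho> \<theta> = (\<integral>\<^sup>+\<zeta>. 1 / ennreal (1 - cos (\<theta> - Arg \<zeta>)) \<partial>\<rho>)"

definition R_fun :: "complex measure \<Rightarrow> real \<Rightarrow> real \<Rightarrow> real" where
  "R_fun \<rho> t \<theta> =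
     Sup {r \<in> {0<..<1}. (\<integral>\<zeta>. T_kernel r (\<theta> - Arg \<zeta>) \<partial>\<rho>) < 1 / (t - 1)}"

definition V_plus :: "complex measure \<Rightarrow> real \<Rightarrow> real set" where
  "V_plus \<rho> t = {\<theta> \<in> {-pi..pi}. g_fun \<rho> \<theta> > ennreal (1 / (t - 1))}"

text \<open>Continuous extension to \<open>closure \<Omega>\<close> of a function \<open>f\<close> that is continuous on the open unit
  disc, where \<open>\<Omega> \<subseteq> ball 0 1\<close>: only the points of \<open>closure \<Omega>\<close> on the circle need a limit.\<close>

definition ext_closure :: "complex set \<Rightarrow> (complex \<Rightarrow> complex) \<Rightarrow> complex \<Rightarrow> complex" where
  "ext_closure \<Omega> f w = (if w \<in> ball 0 1 then f w else Lim (at w within \<Omega>) f)"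

text \<open>\<open>h_fun u \<rho> t \<theta>\<close> is \<open>h\<^sub>t(e\<^sup>i\<^sup>\<theta>)\<close>.\<close>

definition h_fun :: "(complex \<Rightarrow> complex) \<Rightarrow> complex measure \<Rightarrow> real \<Rightarrow> real \<Rightarrow> complex" where
  "h_fun u \<rho> t \<theta> = ext_closure (Omega u t) (Phi u t) (of_real (R_fun \<rho> t \<theta>) * cis \<theta>)"

definition S_set :: "(complex \<Rightarrow> complex) \<Rightarrow> complex measure \<Rightarrow> real \<Rightarrow> complex set" where
  "S_set u \<rho> t = (\<lambda>\<theta>. cnj (h_fun u \<rho> t \<theta>)) ` V_plus \<rho> t"

definition l_fun :: "complex measure \<Rightarrow> real \<Rightarrow> real \<Rightarrow> real" where
  "l_fun \<rho> t \<theta> = R_fun \<rho> t \<theta> powr (t / (t - 1))"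

definition alpha_fun :: "(complex \<Rightarrow> complex) \<Rightarrow> complex measure \<Rightarrow> real \<Rightarrow> real \<Rightarrow> real" where
  "alpha_fun u \<rho> t \<theta> =
     \<theta> - Im (ext_closure (Omega u t) u (of_real (R_fun \<rho> t \<theta>) * cis \<theta>))"


section \<open>Analyticity on the circle and counting components\<close>

text \<open>Real analyticity of a function on the circle, in the arc length coordinate.\<close>

definition circle_analytic_on :: "(complex \<Rightarrow> real) \<Rightarrow> complex set \<Rightarrow> bool" where
  "circle_analytic_on p S \<longleftrightarrow>
     (\<forall>x. cis x \<in> S \<longrightarrow>
        (\<exists>\<epsilon>>0. \<exists>a. \<forall>y. \<bar>y - x\<bar> < \<epsilon> \<longrightarrow> (\<lambda>n. a n * (y - x) ^ n) sums p (cis y)))"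

definition num_components :: "'a::topological_space set \<Rightarrow> enat" where
  "num_components S = (if finite (components S) then enat (card (components S)) else \<infinity>)"

end

theory Submission
  imports Defs "HOL-Complex_Analysis.Complex_Analysis"
begin

text \<open>
  Writing \<open>w = r e\<^sup>i\<^sup>\<theta>\<close>, one has \<open>ln \<bar>\<Phi>\<^sub>t(w)\<bar> = ln r + (t - 1) Re u(w)\<close> with
  \<open>Re u(w) = (1 - r\<^sup>2) \<integral> \<bar>\<zeta> - w\<bar>\<^sup>-\<^sup>2 d\<rho>\<close>. On the set where this is nonpositive the integral is bounded
  and \<open>(t - 1) \<bar>w u'(w)\<bar> < 1\<close>. Hence \<open>\<Omega>\<^sub>t\<close> is starlike with radial function \<open>R\<^sub>t\<close>, \<open>\<Phi>\<^sub>t\<close> is locally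
  injective on \<open>\<partial>\<Omega>\<^sub>t \<inter> \<D>\<close>, and \<open>u\<close> is Lipschitz on \<open>\<Omega>\<^sub>t\<close>. The last fact extends \<open>u \<circ> \<omega>\<^sub>t\<close>, and
  therefore \<open>\<eta> = \<eta>\<^sub>\<mu> \<circ> \<omega>\<^sub>t\<close>, continuously to the closed disc, and makes \<open>\<omega>\<^sub>t\<close> injective there.

  The Poisson integral of the reflected power measure is \<open>(1 - \<bar>\<eta>\<bar>\<^sup>2) / \<bar>1 - \<eta>\<bar>\<^sup>2\<close>, which is continuous up
  to the circle off the closed set \<open>{\<eta> = 1}\<close>. This set is null because \<open>ln \<bar>1 - \<eta>\<bar>\<close> is harmonic. So
  the boundary values are the density, and they vanish unless \<open>\<bar>\<omega>\<^sub>t\<bar> < 1\<close>, which describes \<open>S\<^sub>t\<close>.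

  For \<open>s < t\<close>, an arc of \<open>V\<^sub>t\<^sup>+\<close> that does not meet \<open>V\<^sub>s\<^sup>+\<close> carries no \<open>\<rho>\<close>-mass, since \<open>g\<close> is bounded on
  it. But then \<open>g\<close> is convex there and at most \<open>1 / (t - 1)\<close> at the end points, a contradiction. So every
  arc of \<open>V\<^sub>t\<^sup>+\<close> meets \<open>V\<^sub>s\<^sup>+\<close>, and closing up cannot create components.
\<close>


subsection \<open>Counting components\<close>

text \<open>The bound on \<open>w u'(w)\<close> rests on two facts: \<open>u'\<close> is at most
  twice the integral of \<open>\<bar>\<zeta> - w\<bar>\<^sup>-\<^sup>2\<close> against \<rho>, and
  \<open>2 r (- ln r) < 1 - r\<^sup>2\<close>. The parameter t cancels between them. The Lipschitz
  estimate compares two values of the Herglotz kernel directly, so no path inside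
  \<open>Omega\<close> is needed.

  The obstacle is that u need not extend continuously to the whole circle. Boundary values are
  therefore taken only along \<omega>, and \<open>h_fun\<close> and \<open>alpha_fun\<close> are
  evaluated only over \<open>V_plus\<close>, where \<open>R_fun\<close> is below 1 and the extension
  is an ordinary value inside the disc.

  The direction of \<omega> on the circle is a homeomorphism. The support is a closure, in which
  neighbouring arcs may merge, so counting the arcs of \<open>V_plus\<close> would not suffice; the
  closures for two parameters are compared through a continuous map.\<close>

lemma num_components_le_by_image:
  fixes f :: "'a::topological_space \<Rightarrow> 'b::topological_space"
  assumes "closed Y" "continuous_on X f" "f ` X \<subseteq> Y" "W \<subseteq> Y" "Y \<subseteq> closure W"
    and link: "\<And>w. w \<in> W \<Longrightarrow> \<exists>K. connected K \<and> K \<subseteq> Y \<and> w \<in> K \<and> K \<inter> f ` X \<noteq> {}"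
  shows "num_components Y \<le> num_components X"
proof (cases "finite (components X)")
  case True
  \<comment> \<open>The component of Y that receives the image of C. That image is connected, so the
    choice of the representative does not matter; this is \<open>comp\<close>.\<close>
  define D where "D C = connected_component_set Y (f (SOME x. x \<in> C))" for C
  have comp: "f x \<in> D (connected_component_set X x)" if "x \<in> X" for x
  proof -
    let ?C = "connected_component_set X x"
    have "x \<in> ?C" using that by auto
    then have rep: "(SOME x. x \<in> ?C) \<in> ?C" by (rule someI)
    have "connected (f ` ?C)"
      by (intro connected_continuous_image continuous_on_subset[OF assms(2)]
          connected_component_subset connected_connected_component)
    moreover have "f ` ?C \<subseteq> Y"
      using assms(3) connected_component_subset[of X x] by blast
    ultimately have "connected_component Y (f (SOME x. x \<in> ?C)) (f x)"
      using rep \<open>x \<in> ?C\<close> by (intro connected_componentI[of "f ` ?C"]) blast+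
    then show ?thesis by (simp add: D_def)
  qed
  have "W \<subseteq> \<Union> (D ` components X)"
  proof
    fix w assume "w \<in> W"
    then obtain K x where K: "connected K" "K \<subseteq> Y" "w \<in> K" "x \<in> X" "f x \<in> K"
      using link by blast
    have "w \<in> connected_component_set Y (f x)"
      using K by (auto simp: connected_component_def)
    then have "w \<in> D (connected_component_set X x)"
      using connected_component_eq[OF comp[OF K(4), unfolded D_def]] unfolding D_def by simp
    then show "w \<in> \<Union> (D ` components X)"
      using K(4) by (auto simp: components_def)
  qed
  \<comment> \<open>Components of a closed set are closed, and only finitely many occur here. The
    union is then a closed set containing W, hence all of Y.\<close>
  moreover have "closed (\<Union> (D ` components X))"
    using True assms(1) by (auto simp: D_def intro!: closed_Union closed_connected_component)
  ultimately have YD: "Y \<subseteq> \<Union> (D ` components X)"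
    using assms(5) closure_minimal by blast
  have "components Y \<subseteq> D ` components X"
  proof
    fix B assume "B \<in> components Y"
    then obtain y where y: "y \<in> Y" "B = connected_component_set Y y"
      by (auto simp: components_def)
    then obtain C where "C \<in> components X" "y \<in> D C"
      using YD by blast
    then show "B \<in> D ` components X"
      using y connected_component_eq[of y Y] unfolding D_def by auto
  qed
  then have "finite (components Y)" "card (components Y) \<le> card (components X)"
    using True by (auto intro: finite_subset surj_card_le)
  then show ?thesis using True by (simp add: num_components_def)
qed (simp add: num_components_def)

subsection \<open>Elementary inequalities and kernels on the circle\<close>

text \<open>\<open>F\<close> vanishes at 1 and has derivative \<open>2 * (ln x - x + 1)\<close>,
  which is negative on the interval. The strictness is what later keeps the derivative of
  \<open>Phi\<close> away from zero.\<close>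

lemma ln_less_half_diff:
  fixes r :: real
  assumes "0 < r" "r < 1"
  shows "2 * r * (- ln r) < 1 - r\<^sup>2"
proof -
  define F where "F x = 1 - x\<^sup>2 + 2 * x * ln x" for x :: real
  have "F r > F 1"
  proof (rule DERIV_neg_imp_decreasing_open[OF assms(2)])
    fix x assume x: "r < x" "x < 1"
    have "ln x < x - 1" using x assms ln_le_minus_one[of x] ln_eq_minus_one[of x] by fastforce
    moreover have "(F has_real_derivative (- 2 * x + 2 * ln x + 2)) (at x)"
      unfolding F_def using x assms by (auto intro!: derivative_eq_intros)
    ultimately show "\<exists>y. (F has_real_derivative y) (at x) \<and> y < 0" by (intro exI conjI) auto
  next
    show "continuous_on {r..1} F" unfolding F_def using assms by (auto intro!: continuous_intros)
  qed
  then show ?thesis by (simp add: F_def)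
qed

text \<open>The difference of the two sides vanishes at 1 and has derivative
  \<open>- (1 - x)\<^sup>2 / (x * (1 + x)\<^sup>2)\<close>. It bounds the factor
  \<open>(1 - r\<^sup>2) / (- ln r)\<close> of \<open>T_kernel\<close> from above.\<close>

lemma ln_le_diff_div_sum:
  fixes r :: real
  assumes "0 < r" "r < 1"
  shows "2 * (1 - r) / (1 + r) \<le> - ln r"
proof -
  define F where "F x = - ln x - 2 * (1 - x) / (1 + x)" for x :: real
  have "F r \<ge> F 1"
  proof (rule DERIV_nonpos_imp_nonincreasing[of r 1 F])
    fix x assume x: "r \<le> x" "x \<le> 1"
    have "(F has_real_derivative (- 1 / x + 4 / (1 + x)\<^sup>2)) (at x)"
      unfolding F_def using x assms
      by (auto intro!: derivative_eq_intros simp: field_simps power2_eq_square)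
    moreover have "- 1 / x + 4 / (1 + x)\<^sup>2 = - ((1 - x)\<^sup>2 / (x * (1 + x)\<^sup>2))"
      using x assms by (simp add: divide_simps power2_eq_square add_eq_0_iff) algebra
    moreover have "(1 - x)\<^sup>2 / (x * (1 + x)\<^sup>2) \<ge> 0" using x assms by simp
    ultimately show "\<exists>y. (F has_real_derivative y) (at x) \<and> y \<le> 0" by fastforce
  qed (use assms in auto)
  then show ?thesis by (simp add: F_def)
qed

text \<open>The second derivative is \<open>(2 + cos y) / (1 - cos y)\<^sup>2\<close>. The poles at
  both ends force the open interval, so the convexity of the kernel of g can be used only along an
  arc that avoids the point \<zeta>.\<close>

lemma convex_on_inverse_one_minus_cos:
  "convex_on {0<..<2*pi} (\<lambda>y. 1 / (1 - cos y))"
proof (rule f''_ge0_imp_convex[where f' = "\<lambda>y. - sin y / (1 - cos y)\<^sup>2"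
      and f'' = "\<lambda>y. (2 + cos y) / (1 - cos y)\<^sup>2"])
  fix y :: real assume y: "y \<in> {0<..<2*pi}"
  have n: "1 - cos y \<noteq> 0"
  proof
    assume "1 - cos y = 0"
    then have "sin (y / 2) = 0" using cos_double_sin[of "y / 2"] by simp
    moreover have "sin (y / 2) > 0" using y by (intro sin_gt_zero) auto
    ultimately show False by simp
  qed
  show "((\<lambda>y. 1 / (1 - cos y)) has_real_derivative - sin y / (1 - cos y)\<^sup>2) (at y)"
    using n by (auto intro!: derivative_eq_intros simp: power2_eq_square)
  have "((\<lambda>y. (1 - cos y)\<^sup>2) has_real_derivative 2 * (1 - cos y) * sin y) (at y)"
    by (auto intro!: derivative_eq_intros)
  from DERIV_divide[OF DERIV_minus[OF DERIV_sin] this]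
  have "((\<lambda>y. - sin y / (1 - cos y)\<^sup>2) has_real_derivative
     (- cos y * (1 - cos y)\<^sup>2 - - sin y * (2 * (1 - cos y) * sin y)) / ((1 - cos y)\<^sup>2 * (1 - cos y)\<^sup>2)) (at y)"
    using n by simp
  also have "(- cos y * (1 - cos y)\<^sup>2 - - sin y * (2 * (1 - cos y) * sin y))
      = (2 + cos y) * (1 - cos y)\<^sup>2"
    using sin_cos_squared_add[of y] by algebra
  also have "\<dots> / ((1 - cos y)\<^sup>2 * (1 - cos y)\<^sup>2) = (2 + cos y) / (1 - cos y)\<^sup>2"
    using n by (simp add: divide_simps)
  finally show "((\<lambda>y. - sin y / (1 - cos y)\<^sup>2) has_real_derivative (2 + cos y) / (1 - cos y)\<^sup>2) (at y)" .
  have "2 + cos y \<ge> 0" using cos_ge_minus_one[of y] by linarith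
  then show "(2 + cos y) / (1 - cos y)\<^sup>2 \<ge> 0" by simp
qed simp

lemma norm_circle_diff_square:
  assumes "norm \<zeta> = 1" "norm w = 1"
  shows "(norm (\<zeta> - of_real r * w))\<^sup>2 = 1 - 2 * r * Re (w * cnj \<zeta>) + r\<^sup>2"
proof -
  have "(norm (\<zeta> - of_real r * w))\<^sup>2 =
     (norm \<zeta>)\<^sup>2 - 2 * r * Re (w * cnj \<zeta>) + r\<^sup>2 * (norm w)\<^sup>2"
    unfolding cmod_power2 by (simp add: power2_eq_square algebra_simps)
  then show ?thesis using assms by simp
qed

lemma cis_Arg_circle:
  assumes "norm \<zeta> = 1"
  shows "cis (Arg \<zeta>) = \<zeta>"
proof -
  have "\<zeta> \<noteq> 0" using assms by auto
  then show ?thesis using assms by (simp add: cis_Arg sgn_eq)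
qed

text \<open>Replaces \<open>Arg\<close>, which jumps at -1, by an expression continuous in \<zeta>
  and visibly periodic in \<theta>.\<close>

lemma cos_diff_Arg:
  assumes "norm \<zeta> = 1"
  shows "cos (\<theta> - Arg \<zeta>) = Re (cis \<theta> * cnj \<zeta>)"
proof -
  have "cis (\<theta> - Arg \<zeta>) = cis \<theta> * cnj (cis (Arg \<zeta>))" by (simp add: cis_cnj cis_mult)
  also have "\<dots> = cis \<theta> * cnj \<zeta>" by (simp only: cis_Arg_circle[OF assms])
  finally have "cis \<theta> * cnj \<zeta> = cis (\<theta> - Arg \<zeta>)" ..
  then show ?thesis by simp
qed

lemma Re_Herglotz_kernel:
  assumes "norm \<zeta> = 1" "norm w < 1"
  shows "Re ((\<zeta> + w) / (\<zeta> - w)) = (1 - (norm w)\<^sup>2) / (norm (\<zeta> - w))\<^sup>2"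
proof -
  have "(Re \<zeta>)\<^sup>2 + (Im \<zeta>)\<^sup>2 = 1" using assms(1) cmod_power2[of \<zeta>] by simp
  then have "Re (\<zeta> + w) * Re (\<zeta> - w) + Im (\<zeta> + w) * Im (\<zeta> - w) = 1 - (norm w)\<^sup>2"
    unfolding cmod_power2 by (simp add: power2_eq_square algebra_simps)
  then show ?thesis by (simp add: Re_divide cmod_power2)
qed

subsection \<open>Arc length and Poisson integrals\<close>

lemma space_circle_borel [simp]: "space circle_borel = sphere 0 1"
  by (simp add: circle_borel_def space_restrict_space)

lemma sets_arc_length [simp, measurable_cong]: "sets arc_length = sets circle_borel"
  by (simp add: arc_length_def)

lemma space_arc_length [simp]: "space arc_length = sphere 0 1"
  using sets_eq_imp_space_eq[OF sets_arc_length] by simp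

lemma sets_circle_borel_iff: "A \<in> sets circle_borel \<longleftrightarrow> A \<in> sets borel \<and> A \<subseteq> sphere 0 1"
  unfolding circle_borel_def by (subst sets_restrict_space_iff) auto

lemma borel_measurable_circle_borel:
  "f \<in> borel_measurable borel \<Longrightarrow> f \<in> borel_measurable circle_borel"
  unfolding circle_borel_def by (rule measurable_restrict_space1)

lemma cis_measurable_circle_borel:
  "cis \<in> measurable (restrict_space lborel A) circle_borel"
  unfolding circle_borel_def
  by (intro measurable_restrict_space2 measurable_restrict_space1)
     (auto intro!: borel_measurable_continuous_onI continuous_intros)

lemma emeasure_arc_length:
  assumes "A \<in> sets circle_borel"
  shows "emeasure arc_length A = emeasure lborel {x \<in> {-pi<..pi}. cis x \<in> A}"
proof -
  have "cis -` A \<inter> space (restrict_space lborel {-pi<..pi}) = {x \<in> {-pi<..pi}. cis x \<in> A}"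
    by (auto simp: space_restrict_space)
  moreover have "\<dots> \<in> sets (restrict_space lborel {-pi<..pi})"
    using measurable_sets[OF cis_measurable_circle_borel assms, of "{-pi<..pi}"] calculation by simp
  ultimately show ?thesis
    unfolding arc_length_def
    by (simp add: emeasure_distr[OF cis_measurable_circle_borel assms])
      (subst emeasure_restrict_space, auto)
qed

interpretation arc_length: finite_measure arc_length
proof
  have "emeasure arc_length (space arc_length) = emeasure lborel {x \<in> {-pi<..pi}. cis x \<in> sphere 0 1}"
    by (simp add: emeasure_arc_length sets_circle_borel_iff)
  also have "\<dots> \<le> emeasure lborel {-pi<..pi}" by (rule emeasure_mono) auto
  also have "\<dots> < \<infinity>" by (simp add: emeasure_lborel_Ioc)
  finally show "emeasure arc_length (space arc_length) \<noteq> \<infinity>" by simp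
qed

lemma measure_arc_length: "measure arc_length (sphere 0 1) = 2 * pi"
proof -
  have "{x. - pi < x \<and> x \<le> pi} = {-pi<..pi}" by auto
  then show ?thesis by (simp add: measure_def emeasure_arc_length sets_circle_borel_iff)
qed

lemma arc_length_pos:
  assumes "open U" "\<zeta> \<in> U" "norm \<zeta> = 1"
  shows "emeasure arc_length (U \<inter> sphere 0 1) > 0"
proof -
  define x where "x = Arg \<zeta>"
  have x: "-pi < x" "x \<le> pi" "cis x = \<zeta>"
    using Arg_bounded[of \<zeta>] cis_Arg_circle[OF assms(3)] by (auto simp: x_def)
  have "open (cis -` U)"
    by (intro open_vimage assms(1)) (auto intro!: continuous_intros)
  then obtain e where e: "e > 0" "\<And>y. \<bar>y - x\<bar> < e \<Longrightarrow> cis y \<in> U"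
    using assms(2) x(3) unfolding open_dist by (metis dist_real_def vimage_eq)
  \<comment> \<open>The interval is taken to the left of x: there is always room on that side, but
    none on the right when x is pi.\<close>
  define a where "a = max (-pi) (x - e)"
  have a: "a < x" using x e by (auto simp: a_def)
  have "0 < emeasure lborel {a<..<x}" using a by simp
  also have "\<dots> \<le> emeasure lborel {y \<in> {-pi<..pi}. cis y \<in> U \<inter> sphere 0 1}"
  proof (rule emeasure_mono)
    show "{a<..<x} \<subseteq> {y \<in> {-pi<..pi}. cis y \<in> U \<inter> sphere 0 1}"
      using x e(2) by (auto simp: a_def)
    have "cis -` U \<inter> {-pi<..pi} \<in> sets borel" using \<open>open (cis -` U)\<close> by auto
    also have "cis -` U \<inter> {-pi<..pi} = {y \<in> {-pi<..pi}. cis y \<in> U \<inter> sphere 0 1}" by auto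
    finally show "{y \<in> {-pi<..pi}. cis y \<in> U \<inter> sphere 0 1} \<in> sets lborel" by simp
  qed
  also have "\<dots> = emeasure arc_length (U \<inter> sphere 0 1)"
    using assms(1) by (subst emeasure_arc_length) (auto simp: sets_circle_borel_iff)
  finally show ?thesis .
qed

lemma integrable_finite_bounded:
  fixes f :: "'a \<Rightarrow> 'b::{banach, second_countable_topology}"
  assumes "finite_measure M" "f \<in> borel_measurable M" "\<And>x. x \<in> space M \<Longrightarrow> norm (f x) \<le> B"
  shows "integrable M f"
  using assms by (intro finite_measure.integrable_const_bound[where B = B]) auto

text \<open>The quotient \<open>(F z - F 0) / z\<close> has a removable singularity, hence a
  primitive H on the disc. Along the circle of radius r the derivative of H in the angle is \<i>
  times \<open>F - F 0\<close>, and H takes the same value at both ends of a full turn.\<close>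

lemma mean_value_circle:
  fixes F :: "complex \<Rightarrow> complex"
  assumes "F holomorphic_on ball 0 1" "0 \<le> r" "r < 1"
  shows "(\<integral>\<zeta>. F (of_real r * \<zeta>) \<partial>arc_length) = 2 * pi * F 0"
proof -
  define G where "G z = (if z = 0 then deriv F 0 else (F z - F 0) / z)" for z
  have "G holomorphic_on ball 0 1"
    unfolding G_def using pole_lemma_open[of F "ball 0 1" 0, unfolded diff_zero] assms(1) by simp
  then obtain H where H': "\<And>z. z \<in> ball 0 1 \<Longrightarrow> (H has_field_derivative G z) (at z within ball 0 1)"
    using holomorphic_convex_primitive'[of "ball 0 1" G] by auto
  have H: "(H has_field_derivative G z) (at z)" if "z \<in> ball 0 1" for z
    using H'[OF that] at_within_open[OF that open_ball] by simp
  have FG: "F z - F 0 = z * G z" for z by (simp add: G_def)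
  let ?f = "\<lambda>x. F (of_real r * cis x) - F 0"
  have "((\<lambda>x. H (of_real r * cis x)) has_vector_derivative \<i> * ?f x) (at x within {-pi..pi})" for x
  proof -
    have "(cis has_vector_derivative \<i> * cis x) (at x within {-pi..pi})"
      unfolding has_vector_derivative_def by (rule has_derivative_cis[OF has_derivative_ident])
    then have "((\<lambda>x. of_real r * cis x) has_vector_derivative (of_real r * (\<i> * cis x))) (at x within {-pi..pi})"
      by (rule has_vector_derivative_mult_right)
    moreover have "(H has_field_derivative G (of_real r * cis x))
        (at (of_real r * cis x) within (\<lambda>x. of_real r * cis x) ` {-pi..pi})"
      by (rule has_field_derivative_at_within[OF H]) (use assms in \<open>simp add: norm_mult\<close>)
    ultimately have "((H \<circ> (\<lambda>x. of_real r * cis x)) has_vector_derivative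
        of_real r * (\<i> * cis x) * G (of_real r * cis x)) (at x within {-pi..pi})"
      by (rule field_vector_diff_chain_within)
    moreover have "of_real r * (\<i> * cis x) * G (of_real r * cis x) = \<i> * ?f x"
      unfolding FG by (simp only: mult_ac)
    ultimately show ?thesis unfolding o_def by simp
  qed
  moreover have c: "continuous_on {-pi..pi} (\<lambda>x. \<i> * ?f x)"
    using assms by (intro continuous_intros continuous_on_compose2[OF holomorphic_on_imp_continuous_on[OF assms(1)]])
       (auto simp: norm_mult)
  ultimately have hb: "has_bochner_integral lborel (\<lambda>x. indicator {-pi..pi} x *\<^sub>R (\<i> * ?f x))
      (H (of_real r * cis pi) - H (of_real r * cis (-pi)))"
    by (intro has_bochner_integral_FTC_Icc) auto
  moreover have "cis (-pi) = cis pi" by (simp add: complex_eq_iff)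
  ultimately have "0 = (\<integral>x. indicator {-pi..pi} x *\<^sub>R (\<i> * ?f x) \<partial>lborel)"
    by (simp add: has_bochner_integral_integral_eq)
  \<comment> \<open>The fundamental theorem wants the closed interval, \<open>arc_length\<close> the
    half-open one; they differ by one null point.\<close>
  also have "(\<integral>x. indicator {-pi..pi} x *\<^sub>R (\<i> * ?f x) \<partial>lborel) = (\<integral>x. indicator {-pi<..pi} x *\<^sub>R (\<i> * ?f x) \<partial>lborel)"
  proof (rule integral_cong_AE)
    show "AE x in lborel. indicator {-pi..pi} x *\<^sub>R (\<i> * ?f x) = indicator {-pi<..pi} x *\<^sub>R (\<i> * ?f x)"
      using AE_lborel_singleton[of "-pi"] by eventually_elim (auto simp: indicator_def)
    have "(\<lambda>x. indicator {-pi..pi} x *\<^sub>R (\<i> * ?f x)) \<in> borel_measurable lborel"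
      by (rule borel_measurable_has_bochner_integral[OF hb])
    from borel_measurable_scaleR[OF _ this, of "indicator {-pi<..pi}"]
    have "(\<lambda>x. indicator {-pi<..pi} x *\<^sub>R (indicator {-pi..pi} x *\<^sub>R (\<i> * ?f x))) \<in> borel_measurable lborel"
      by simp
    moreover have "indicator {-pi<..pi} x *\<^sub>R (indicator {-pi..pi} x *\<^sub>R (\<i> * ?f x))
       = indicator {-pi<..pi} x *\<^sub>R (\<i> * ?f x)" for x :: real by (simp add: indicator_def)
    ultimately show "(\<lambda>x. indicator {-pi<..pi} x *\<^sub>R (\<i> * ?f x)) \<in> borel_measurable lborel"
      by (simp only:)
  qed (rule borel_measurable_has_bochner_integral[OF hb])
  also have "\<dots> = (\<integral>x. \<i> * ?f x \<partial>restrict_space lborel {-pi<..pi})"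
    by (rule integral_restrict_space[symmetric]) simp
  also have "\<dots> = (\<integral>\<zeta>. \<i> * (F (of_real r * \<zeta>) - F 0) \<partial>arc_length)"
  proof -
    have m: "(\<lambda>\<zeta>. \<i> * (F (of_real r * \<zeta>) - F 0)) \<in> borel_measurable circle_borel"
      unfolding circle_borel_def
      using assms by (intro borel_measurable_continuous_on_restrict continuous_intros
          continuous_on_compose2[OF holomorphic_on_imp_continuous_on[OF assms(1)]]) (auto simp: norm_mult)
    show ?thesis unfolding arc_length_def
      by (rule integral_distr[OF cis_measurable_circle_borel m, symmetric])
  qed
  finally have "0 = (\<integral>\<zeta>. \<i> * (F (of_real r * \<zeta>) - F 0) \<partial>arc_length)" .
  then have 0: "(\<integral>\<zeta>. F (of_real r * \<zeta>) - F 0 \<partial>arc_length) = 0"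
    unfolding integral_mult_right_zero by (metis complex_i_not_zero mult_eq_0_iff)
  have m: "(\<lambda>\<zeta>. F (of_real r * \<zeta>)) \<in> borel_measurable arc_length"
    unfolding arc_length_def circle_borel_def measurable_distr_eq1
    using assms by (intro borel_measurable_continuous_on_restrict continuous_intros
        continuous_on_compose2[OF holomorphic_on_imp_continuous_on[OF assms(1)]]) (auto simp: norm_mult)
  have "continuous_on (cball 0 r) F"
    using assms by (intro holomorphic_on_imp_continuous_on holomorphic_on_subset[OF assms(1)]) auto
  then obtain B where B: "\<And>z. z \<in> cball 0 r \<Longrightarrow> norm (F z) \<le> B"
    using continuous_on_compact_bound[OF compact_cball] by blast
  have "integrable arc_length (\<lambda>\<zeta>. F (of_real r * \<zeta>))"
  proof (rule integrable_finite_bounded[OF arc_length.finite_measure_axioms m])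
    fix \<zeta> assume "\<zeta> \<in> space arc_length"
    then have "of_real r * \<zeta> \<in> cball 0 r" using assms(2) by (simp add: norm_mult)
    then show "norm (F (of_real r * \<zeta>)) \<le> B" by (rule B)
  qed
  then have "(\<integral>\<zeta>. F (of_real r * \<zeta>) - F 0 \<partial>arc_length)
      = (\<integral>\<zeta>. F (of_real r * \<zeta>) \<partial>arc_length) - (\<integral>\<zeta>. F 0 \<partial>arc_length)"
    by (rule Bochner_Integration.integral_diff) simp
  with 0 have "(\<integral>\<zeta>. F (of_real r * \<zeta>) \<partial>arc_length) = measure arc_length (sphere 0 1) * F 0"
    by (simp add: scaleR_conv_of_real)
  then show ?thesis by (simp add: measure_arc_length)
qed

lemma poisson_kernel_measurable:
  fixes r :: real and \<zeta> :: complex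
  shows "(\<lambda>x. (1 - r\<^sup>2) / (norm (\<zeta> - of_real r * x))\<^sup>2) \<in> borel_measurable borel"
  by measurable

lemma poisson_kernel_bound:
  fixes r :: real and \<zeta> s :: complex
  assumes "norm \<zeta> = 1" "norm s = 1" "0 \<le> r" "r < 1"
  shows "0 \<le> (1 - r\<^sup>2) / (norm (\<zeta> - of_real r * s))\<^sup>2"
    and "(1 - r\<^sup>2) / (norm (\<zeta> - of_real r * s))\<^sup>2 \<le> 1 / (1 - r)\<^sup>2"
proof -
  have "1 - r \<le> norm (\<zeta> - of_real r * s)"
    using norm_triangle_ineq2[of \<zeta> "of_real r * s"] assms by (simp add: norm_mult)
  then have "(1 - r)\<^sup>2 \<le> (norm (\<zeta> - of_real r * s))\<^sup>2" using assms by (intro power_mono) auto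
  moreover have "0 \<le> 1 - r\<^sup>2" "1 - r\<^sup>2 \<le> 1" using assms by (auto simp: power_le_one)
  ultimately show "(1 - r\<^sup>2) / (norm (\<zeta> - of_real r * s))\<^sup>2 \<le> 1 / (1 - r)\<^sup>2"
    using assms by (intro frac_le) auto
  show "0 \<le> (1 - r\<^sup>2) / (norm (\<zeta> - of_real r * s))\<^sup>2" using \<open>0 \<le> 1 - r\<^sup>2\<close> by simp
qed

lemma poisson_kernel_integrable:
  assumes "norm \<zeta> = 1" "0 \<le> r" "r < 1"
  shows "integrable arc_length (\<lambda>s. (1 - r\<^sup>2) / (norm (\<zeta> - of_real r * s))\<^sup>2)"
proof (rule integrable_finite_bounded[OF arc_length.finite_measure_axioms])
  show "(\<lambda>s. (1 - r\<^sup>2) / (norm (\<zeta> - of_real r * s))\<^sup>2) \<in> borel_measurable arc_length"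
    using borel_measurable_circle_borel[OF poisson_kernel_measurable]
    by (simp add: measurable_cong_sets[OF sets_arc_length refl])
  fix s assume "s \<in> space arc_length"
  then have "norm s = 1" by simp
  from poisson_kernel_bound[OF assms(1) this assms(2,3)]
  show "norm ((1 - r\<^sup>2) / (norm (\<zeta> - of_real r * s))\<^sup>2) \<le> 1 / (1 - r)\<^sup>2"
    unfolding real_norm_def by (simp only: abs_of_nonneg)
qed

text \<open>Real part of the mean value property for \<open>(\<zeta> + z) / (\<zeta> - z)\<close>,
  whose value at 0 is 1.\<close>

lemma poisson_kernel_mass:
  assumes "norm \<zeta> = 1" "0 \<le> r" "r < 1"
  shows "(\<integral>s. (1 - r\<^sup>2) / (norm (\<zeta> - of_real r * s))\<^sup>2 \<partial>arc_length) = 2 * pi"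
proof -
  define F where "F z = (\<zeta> + z) / (\<zeta> - z)" for z
  have hol: "F holomorphic_on ball 0 1"
    unfolding F_def using assms by (auto intro!: holomorphic_intros)
  have m: "(\<lambda>s. F (of_real r * s)) \<in> borel_measurable arc_length"
    unfolding F_def
    by (simp add: measurable_cong_sets[OF sets_arc_length refl] borel_measurable_circle_borel)
  have "integrable arc_length (\<lambda>s. F (of_real r * s))"
  proof (rule integrable_finite_bounded[OF arc_length.finite_measure_axioms m])
    fix s assume "s \<in> space arc_length"
    then have s: "norm s = 1" by simp
    have "1 - r \<le> norm (\<zeta> - of_real r * s)"
      using norm_triangle_ineq2[of \<zeta> "of_real r * s"] assms s by (simp add: norm_mult)
    moreover have "norm (\<zeta> + of_real r * s) \<le> 2"
      using norm_triangle_ineq[of \<zeta> "of_real r * s"] assms s by (simp add: norm_mult)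
    ultimately show "norm (F (of_real r * s)) \<le> 2 / (1 - r)"
      unfolding F_def norm_divide using assms by (intro frac_le) auto
  qed
  then have "(\<integral>s. Re (F (of_real r * s)) \<partial>arc_length) = Re (\<integral>s. F (of_real r * s) \<partial>arc_length)"
    by (rule integral_Re)
  also have "\<dots> = 2 * pi"
    using assms(1) unfolding mean_value_circle[OF hol assms(2,3)] by (auto simp: F_def)
  also have "(\<integral>s. Re (F (of_real r * s)) \<partial>arc_length) =
      (\<integral>s. (1 - r\<^sup>2) / (norm (\<zeta> - of_real r * s))\<^sup>2 \<partial>arc_length)"
  proof (rule Bochner_Integration.integral_cong[OF refl])
    fix s assume "s \<in> space arc_length"
    then have "norm s = 1" by simp
    then show "Re (F (of_real r * s)) = (1 - r\<^sup>2) / (norm (\<zeta> - of_real r * s))\<^sup>2"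
      unfolding F_def using assms by (subst Re_Herglotz_kernel) (auto simp: norm_mult)
  qed
  finally show ?thesis .
qed

lemma continuous_circle_measurable:
  fixes f :: "complex \<Rightarrow> real"
  assumes "continuous_on (sphere 0 1) f"
  shows "f \<in> borel_measurable circle_borel"
  unfolding circle_borel_def using assms by (rule borel_measurable_continuous_on_restrict)

text \<open>The Poisson kernels form an approximate identity: near \<zeta> the continuity of f
  controls the integrand, and away from \<zeta> the kernel tends to 0 uniformly.\<close>

lemma poisson_approximation:
  fixes f :: "complex \<Rightarrow> real"
  assumes f: "continuous_on (sphere 0 1) f" and \<zeta>: "norm \<zeta> = 1"
    and X: "X \<longlonglongrightarrow> 1" "\<And>n. 0 \<le> X n" "\<And>n. X n < (1::real)"
  shows "(\<lambda>n. \<integral>s. f s * ((1 - (X n)\<^sup>2) / (norm (\<zeta> - of_real (X n) * s))\<^sup>2) \<partial>arc_length)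
           \<longlonglongrightarrow> 2 * pi * f \<zeta>"
proof -
  define P where "P n s = (1 - (X n)\<^sup>2) / (norm (\<zeta> - of_real (X n) * s))\<^sup>2" for n s
  obtain M where M: "M \<ge> 0" "\<And>s. s \<in> sphere 0 1 \<Longrightarrow> norm (f s) \<le> M"
    using continuous_on_compact_bound[OF compact_sphere f] by blast
  have fm: "f \<in> borel_measurable arc_length"
    using continuous_circle_measurable[OF f] by (simp add: measurable_cong_sets[OF sets_arc_length refl])
  have Pi: "integrable arc_length (P n)" for n
    unfolding P_def using \<zeta> X by (intro poisson_kernel_integrable)
  have P0: "P n s \<ge> 0" if "norm s = 1" for n s
    unfolding P_def using \<zeta> X that by (intro poisson_kernel_bound)
  have P_int: "(\<integral>s. P n s \<partial>arc_length) = 2 * pi" for n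
    unfolding P_def using \<zeta> X by (intro poisson_kernel_mass)
  have fPi: "integrable arc_length (\<lambda>s. f s * P n s)" for n
  proof (rule Bochner_Integration.integrable_bound)
    show "integrable arc_length (\<lambda>s. M * P n s)" using Pi by simp
    show "(\<lambda>s. f s * P n s) \<in> borel_measurable arc_length"
      using fm Pi by (intro borel_measurable_times) auto
    show "AE s in arc_length. norm (f s * P n s) \<le> norm (M * P n s)"
      using M by (intro AE_I2) (auto simp: abs_mult intro!: mult_right_mono)
  qed
  show ?thesis
    unfolding P_def[symmetric]
  proof (rule LIMSEQ_I)
    fix e :: real assume "e > 0"
    \<comment> \<open>Against the kernel mass \<open>2 * pi\<close> this contributes
      \<open>e / 2\<close>; the rest of e is left for the part far from \<zeta>.\<close>
    define e' where "e' = e / (4 * pi)"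
    have e': "e' > 0" using \<open>e > 0\<close> by (simp add: e'_def)
    obtain d where d: "d > 0" "\<And>s. s \<in> sphere 0 1 \<Longrightarrow> dist s \<zeta> < d \<Longrightarrow> dist (f s) (f \<zeta>) < e'"
      using f \<zeta> e' unfolding continuous_on_iff by (metis mem_sphere_0)
    have "(\<lambda>n. e' * (2 * pi) + 2 * M * ((1 - (X n)\<^sup>2) / (d/2)\<^sup>2) * (2 * pi)) \<longlonglongrightarrow>
        e' * (2 * pi) + 2 * M * ((1 - 1\<^sup>2) / (d/2)\<^sup>2) * (2 * pi)"
      by (intro tendsto_intros X) (use d in auto)
    moreover have "e' * (2 * pi) + 2 * M * ((1 - 1\<^sup>2) / (d/2)\<^sup>2) * (2 * pi) < e"
      using \<open>e > 0\<close> by (simp add: e'_def)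
    ultimately have ev1: "eventually (\<lambda>n. e' * (2 * pi) + 2 * M * ((1 - (X n)\<^sup>2) / (d/2)\<^sup>2) * (2 * pi) < e) sequentially"
      by (rule order_tendstoD(2))
    \<comment> \<open>Once the radius exceeds \<open>1 - d / 2\<close>, a point s at distance at
      least d from \<zeta> satisfies \<open>norm (\<zeta> - X n * s) \<ge> d / 2\<close>.\<close>
    have ev2: "eventually (\<lambda>n. X n > 1 - d / 2) sequentially"
      by (rule order_tendstoD(1)[OF X(1)]) (use d in auto)
    show "\<exists>no. \<forall>n\<ge>no. norm ((\<integral>s. f s * P n s \<partial>arc_length) - 2 * pi * f \<zeta>) < e"
      using eventually_conj[OF ev1 ev2] unfolding eventually_sequentially
    proof (elim exE, intro exI allI impI)
      fix N n :: nat
      assume *: "\<forall>n\<ge>N. e' * (2 * pi) + 2 * M * ((1 - (X n)\<^sup>2) / (d/2)\<^sup>2) * (2 * pi) < e \<and> 1 - d / 2 < X n"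
        and "n \<ge> N"
      then have n: "e' * (2 * pi) + 2 * M * ((1 - (X n)\<^sup>2) / (d/2)\<^sup>2) * (2 * pi) < e" "1 - d / 2 < X n" by auto
      have Xn: "0 \<le> 1 - (X n)\<^sup>2" using X(2,3)[of n] by (simp add: power_le_one)
      have pt: "\<bar>(f s - f \<zeta>) * P n s\<bar> \<le> e' * P n s + 2 * M * ((1 - (X n)\<^sup>2) / (d/2)\<^sup>2)"
        if s: "norm s = 1" for s
      proof (cases "dist s \<zeta> < d")
        case True
        then have "\<bar>f s - f \<zeta>\<bar> * P n s \<le> e' * P n s"
          using d(2)[of s] s P0[OF s] by (intro mult_right_mono) (auto simp: dist_real_def)
        moreover have "0 \<le> 2 * M * ((1 - (X n)\<^sup>2) / (d/2)\<^sup>2)" using M Xn by simp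
        ultimately show ?thesis using P0[OF s] by (simp add: abs_mult)
      next
        case False
        have "norm (\<zeta> - s) \<le> norm (\<zeta> - of_real (X n) * s) + norm (of_real (X n) * s - s)"
          using norm_triangle_ineq[of "\<zeta> - of_real (X n) * s" "of_real (X n) * s - s"] by simp
        also have "of_real (X n) * s - s = of_real (X n - 1) * s" by (simp add: algebra_simps)
        also have "norm \<dots> = 1 - X n" using X(3)[of n] s by (simp only: norm_mult norm_of_real) simp
        finally have "d / 2 \<le> norm (\<zeta> - of_real (X n) * s)"
          using False n(2) by (simp add: dist_norm norm_minus_commute)
        then have "(d/2)\<^sup>2 \<le> (norm (\<zeta> - of_real (X n) * s))\<^sup>2" using d by (intro power_mono) auto
        then have "P n s \<le> (1 - (X n)\<^sup>2) / (d/2)\<^sup>2"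
          unfolding P_def using Xn d by (intro frac_le) auto
        moreover have "\<bar>f s - f \<zeta>\<bar> \<le> 2 * M" using M(2)[of s] M(2)[of \<zeta>] s \<zeta> by auto
        ultimately have "\<bar>f s - f \<zeta>\<bar> * P n s \<le> 2 * M * ((1 - (X n)\<^sup>2) / (d/2)\<^sup>2)"
          using P0[OF s] M by (intro mult_mono) auto
        then show ?thesis using P0[OF s] e' by (simp add: abs_mult add_increasing)
      qed
      have "(\<integral>s. f s * P n s \<partial>arc_length) - 2 * pi * f \<zeta> = (\<integral>s. f s * P n s \<partial>arc_length) - (\<integral>s. f \<zeta> * P n s \<partial>arc_length)"
        by (simp add: P_int)
      also have "\<dots> = (\<integral>s. f s * P n s - f \<zeta> * P n s \<partial>arc_length)"
        using fPi Pi by (intro Bochner_Integration.integral_diff[symmetric]) auto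
      also have "\<bar>\<dots>\<bar> \<le> (\<integral>s. \<bar>f s * P n s - f \<zeta> * P n s\<bar> \<partial>arc_length)"
        by (rule integral_abs_bound)
      also have "\<dots> \<le> (\<integral>s. e' * P n s + 2 * M * ((1 - (X n)\<^sup>2) / (d/2)\<^sup>2) \<partial>arc_length)"
      proof (rule integral_mono)
        show "integrable arc_length (\<lambda>s. \<bar>f s * P n s - f \<zeta> * P n s\<bar>)" using fPi Pi by (intro integrable_abs Bochner_Integration.integrable_diff) auto
        show "integrable arc_length (\<lambda>s. e' * P n s + 2 * M * ((1 - (X n)\<^sup>2) / (d/2)\<^sup>2))"
          using Pi by auto
        show "\<bar>f s * P n s - f \<zeta> * P n s\<bar> \<le> e' * P n s + 2 * M * ((1 - (X n)\<^sup>2) / (d/2)\<^sup>2)"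
          if "s \<in> space arc_length" for s
          using pt[of s] that by (simp add: left_diff_distrib)
      qed
      also have "\<dots> = e' * (2 * pi) + 2 * M * ((1 - (X n)\<^sup>2) / (d/2)\<^sup>2) * measure arc_length (sphere 0 1)"
        using Pi by (simp add: P_int)
      also have "\<dots> = e' * (2 * pi) + 2 * M * ((1 - (X n)\<^sup>2) / (d/2)\<^sup>2) * (2 * pi)"
        by (simp add: measure_arc_length)
      finally show "norm ((\<integral>s. f s * P n s \<partial>arc_length) - 2 * pi * f \<zeta>) < e" using n by simp
    qed
  qed
qed

text \<open>Fubini moves the kernel from \<nu> onto f, where \<open>poisson_approximation\<close>
  gives the pointwise limit. The kernel mass supplies the dominating constant
  \<open>M * (2 * pi)\<close>.\<close>

lemma poisson_integral_weak_limit: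
  fixes f :: "complex \<Rightarrow> real"
  assumes N: "finite_measure \<nu>" "sets \<nu> = sets circle_borel"
    and f: "continuous_on (sphere 0 1) f"
    and X: "X \<longlonglongrightarrow> 1" "\<And>n. 0 \<le> X n" "\<And>n. X n < (1::real)"
  shows "(\<lambda>n. \<integral>s. f s * (\<integral>\<zeta>. (1 - (X n)\<^sup>2) / (norm (\<zeta> - of_real (X n) * s))\<^sup>2 \<partial>\<nu>) \<partial>arc_length)
           \<longlonglongrightarrow> 2 * pi * (\<integral>\<zeta>. f \<zeta> \<partial>\<nu>)"
proof -
  interpret N: finite_measure \<nu> by fact
  interpret pair_sigma_finite arc_length \<nu> ..
  interpret A: finite_measure "arc_length \<Otimes>\<^sub>M \<nu>"
    by (rule finite_measure_pair_measure) unfold_locales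
  note [measurable_cong] = N(2)
  have spN: "space \<nu> = sphere 0 1" using sets_eq_imp_space_eq[OF N(2)] by simp
  define P where "P n s \<zeta> = (1 - (X n)\<^sup>2) / (norm (\<zeta> - of_real (X n) * s))\<^sup>2" for n and s \<zeta> :: complex
  have Xn: "0 \<le> 1 - (X n)\<^sup>2" for n using X(2,3)[of n] by (simp add: power_le_one)
  have P0: "P n s \<zeta> \<ge> 0" for n s \<zeta> unfolding P_def using Xn by simp
  have PB: "P n s \<zeta> \<le> 1 / (1 - X n)\<^sup>2" if "norm s = 1" "norm \<zeta> = 1" for n s \<zeta>
    unfolding P_def using that X by (intro poisson_kernel_bound)
  obtain M where M: "M \<ge> 0" "\<And>s. s \<in> sphere 0 1 \<Longrightarrow> norm (f s) \<le> M"
    using continuous_on_compact_bound[OF compact_sphere f] by blast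
  have fm[measurable]: "f \<in> borel_measurable circle_borel"
    by (rule continuous_circle_measurable[OF f])
  have id: "(\<lambda>x. x) \<in> borel_measurable circle_borel"
    by (rule borel_measurable_circle_borel) simp
  have Pm: "(\<lambda>z. P n (fst z) (snd z)) \<in> borel_measurable (arc_length \<Otimes>\<^sub>M \<nu>)" for n
    unfolding P_def
    using measurable_compose[OF measurable_fst[of arc_length \<nu>] , of "\<lambda>x. x" borel]
      measurable_compose[OF measurable_snd[of arc_length \<nu>] , of "\<lambda>x. x" borel] id
    by (intro borel_measurable_divide borel_measurable_power borel_measurable_norm
        borel_measurable_diff borel_measurable_times borel_measurable_const)
       (simp_all add: measurable_cong_sets[OF sets_arc_length refl] measurable_cong_sets[OF N(2) refl])
  have fP: "integrable (arc_length \<Otimes>\<^sub>M \<nu>) (\<lambda>z. f (fst z) * P n (fst z) (snd z))" for n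
  proof (rule integrable_finite_bounded[OF A.finite_measure_axioms])
    show "(\<lambda>z. f (fst z) * P n (fst z) (snd z)) \<in> borel_measurable (arc_length \<Otimes>\<^sub>M \<nu>)"
      using Pm by measurable
    fix z assume "z \<in> space (arc_length \<Otimes>\<^sub>M \<nu>)"
    then have z: "norm (fst z) = 1" "norm (snd z) = 1" by (auto simp: space_pair_measure spN)
    show "norm (f (fst z) * P n (fst z) (snd z)) \<le> M * (1 / (1 - X n)\<^sup>2)"
      unfolding norm_mult using M(2)[of "fst z"] M(1) z P0[of n "fst z" "snd z"] PB[OF z, of n]
      by (intro mult_mono) auto
  qed
  have fub: "(\<integral>s. f s * (\<integral>\<zeta>. P n s \<zeta> \<partial>\<nu>) \<partial>arc_length) = (\<integral>\<zeta>. (\<integral>s. f s * P n s \<zeta> \<partial>arc_length) \<partial>\<nu>)" for n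
    using Fubini_integral[of "\<lambda>s \<zeta>. f s * P n s \<zeta>"] fP[of n] by (simp add: case_prod_beta')
  have "(\<lambda>n. \<integral>\<zeta>. (\<integral>s. f s * P n s \<zeta> \<partial>arc_length) \<partial>\<nu>) \<longlonglongrightarrow> (\<integral>\<zeta>. 2 * pi * f \<zeta> \<partial>\<nu>)"
  proof (rule integral_dominated_convergence[where w = "\<lambda>_. M * (2 * pi)"])
    show "(\<lambda>\<zeta>. \<integral>s. f s * P n s \<zeta> \<partial>arc_length) \<in> borel_measurable \<nu>" for n
      using integrable_snd[of "\<lambda>s \<zeta>. f s * P n s \<zeta>"] fP[of n] by (simp add: case_prod_beta')
    show "AE \<zeta> in \<nu>. (\<lambda>n. \<integral>s. f s * P n s \<zeta> \<partial>arc_length) \<longlonglongrightarrow> 2 * pi * f \<zeta>"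
      unfolding P_def using X f spN by (intro AE_I2 poisson_approximation) auto
    show "AE \<zeta> in \<nu>. norm (\<integral>s. f s * P n s \<zeta> \<partial>arc_length) \<le> M * (2 * pi)" for n
    proof (rule AE_I2)
      fix \<zeta> assume "\<zeta> \<in> space \<nu>"
      then have z: "norm \<zeta> = 1" by (simp add: spN)
      have Pi: "integrable arc_length (\<lambda>s. P n s \<zeta>)"
        unfolding P_def using z X by (intro poisson_kernel_integrable)
      have "norm (\<integral>s. f s * P n s \<zeta> \<partial>arc_length) \<le> (\<integral>s. M * P n s \<zeta> \<partial>arc_length)"
      proof (rule Bochner_Integration.integral_norm_bound_integral)
        show "integrable arc_length (\<lambda>s. M * P n s \<zeta>)" using Pi by simp
        show bd: "norm (f s * P n s \<zeta>) \<le> M * P n s \<zeta>" if "s \<in> space arc_length" for s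
          unfolding norm_mult using that M P0[of n s \<zeta>] by (intro mult_mono) auto
        show "integrable arc_length (\<lambda>s. f s * P n s \<zeta>)"
        proof (rule Bochner_Integration.integrable_bound)
          show "integrable arc_length (\<lambda>s. M * P n s \<zeta>)" using Pi by simp
          show "(\<lambda>s. f s * P n s \<zeta>) \<in> borel_measurable arc_length"
            using Pi by (intro borel_measurable_times) auto
          show "AE s in arc_length. norm (f s * P n s \<zeta>) \<le> norm (M * P n s \<zeta>)"
            using bd M P0 by (intro AE_I2) fastforce
        qed
      qed
      also have "\<dots> = M * (\<integral>s. P n s \<zeta> \<partial>arc_length)" by simp
      also have "(\<integral>s. P n s \<zeta> \<partial>arc_length) = 2 * pi"
        unfolding P_def by (rule poisson_kernel_mass[OF z X(2,3)])
      finally show "norm (\<integral>s. f s * P n s \<zeta> \<partial>arc_length) \<le> M * (2 * pi)" .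
    qed
  qed auto
  then show ?thesis unfolding fub[symmetric] unfolding P_def by simp
qed

lemma sets_circle_borel_eq_sigma:
  "sets circle_borel = sigma_sets (sphere 0 1) {G \<inter> sphere 0 1 | G. open G}"
proof -
  have "sets circle_borel = (\<inter>) (sphere 0 1) ` sigma_sets UNIV {S. open S}"
    unfolding circle_borel_def sets_restrict_space borel_def by simp
  also have "\<dots> = sigma_sets (sphere 0 1) ((\<inter>) (sphere 0 1) ` {S. open S})"
  proof (rule sigma_sets_Int)
    have "sphere 0 1 \<in> sets (borel :: complex measure)" by simp
    then show "(sphere 0 1 :: complex set) \<in> sigma_sets UNIV {S. open S}" by (simp add: borel_def)
  qed simp
  finally have "sets circle_borel = sigma_sets (sphere 0 1) ((\<inter>) (sphere 0 1) ` {S. open S})" .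
  moreover have "(\<lambda>G. sphere 0 1 \<inter> G) ` {S. open S} = {G \<inter> sphere 0 1 :: complex set | G. open G}" by auto
  ultimately show ?thesis by simp
qed

text \<open>For an open set disjoint from C, test functions supported away from C increase to its
  indicator. On each support the radial values of q are bounded, so the weak limit of the Poisson
  integrals can also be computed pointwise. Open sets generate the Borel sets. The set C is removed
  from \<nu> because q may blow up near it and \<nu> may have mass on it.\<close>

lemma poisson_integral_recovers_measure:
  fixes q :: "complex \<Rightarrow> real"
  assumes N: "finite_measure \<nu>" "sets \<nu> = sets circle_borel"
    and C: "closed C" "C \<subseteq> sphere 0 1"
    and q: "continuous_on (cball 0 1 - C) q" "\<And>s. norm s = 1 \<Longrightarrow> 0 \<le> q s" "\<And>s. s \<in> C \<Longrightarrow> q s = 0"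
    and h: "\<And>z. norm z < 1 \<Longrightarrow> (\<integral>\<zeta>. (1 - (norm z)\<^sup>2) / (norm (\<zeta> - z))\<^sup>2 \<partial>\<nu>) = q z"
    and B: "B \<in> sets circle_borel"
  shows "q \<in> borel_measurable circle_borel"
    and "emeasure \<nu> (B - C) = (\<integral>\<^sup>+s. ennreal (q s / (2 * pi)) * indicator B s \<partial>arc_length)"
proof -
  interpret N: finite_measure \<nu> by fact
  note [measurable_cong] = N(2)
  have spN: "space \<nu> = sphere 0 1" using sets_eq_imp_space_eq[OF N(2)] by simp
  have "(\<lambda>s. indicator (sphere 0 1 - C) s *\<^sub>R q s) \<in> borel_measurable borel"
    using C by (intro borel_measurable_continuous_on_indicator continuous_on_subset[OF q(1)]) auto
  then have "(\<lambda>s. indicator (sphere 0 1 - C) s *\<^sub>R q s) \<in> borel_measurable circle_borel"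
    by (rule borel_measurable_circle_borel)
  then show qm[measurable]: "q \<in> borel_measurable circle_borel"
    by (rule measurable_cong[THEN iffD1, rotated]) (use q(3) in \<open>auto simp: indicator_def\<close>)
  define X where "X n = 1 - 1 / (real n + 2)" for n
  have X: "X \<longlonglongrightarrow> 1" "\<And>n. 0 \<le> X n" "\<And>n. X n < 1"
    unfolding X_def by (real_asymp, auto simp: field_simps)
  have Xball: "norm (of_real (X n) * s) < 1" "of_real (X n) * s \<in> cball 0 1 - C" if "norm s = 1" for n and s :: complex
  proof -
    show 1: "norm (of_real (X n) * s) < 1" using that X(2,3)[of n] by (simp add: norm_mult)
    then show "of_real (X n) * s \<in> cball 0 1 - C" using C(2) by auto
  qed
  have key: "emeasure \<nu> (G \<inter> sphere 0 1) = (\<integral>\<^sup>+s. ennreal (q s / (2 * pi)) * indicator (G \<inter> sphere 0 1) s \<partial>arc_length)"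
    if G: "open G" "G \<inter> C = {}" for G
  proof -
    \<comment> \<open>Cutting with a ball that contains the circle keeps \<open>A\<close> nonempty
      even when G is the whole plane; the distance to an empty set would be 0.\<close>
    define A where "A = - (G \<inter> ball 0 2)"
    have "3 \<in> A" by (simp add: A_def)
    have "closed A" unfolding A_def using G by (intro closed_Compl open_Int) auto
    moreover have "C \<subseteq> A" unfolding A_def using G by blast
    ultimately have A: "closed A" "A \<noteq> {}" "C \<subseteq> A" using \<open>3 \<in> A\<close> by auto
    \<comment> \<open>A ramp that is 0 up to distance \<open>1 / k\<close> from \<open>A\<close> and
      1 from distance \<open>2 / k\<close> on, for positive k. It increases with k to the indicator
      of the complement of \<open>A\<close>.\<close>
    define f where "f k s = max 0 (min 1 (real k * infdist s A - 1))" for k s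
    have f01: "0 \<le> f k s" "f k s \<le> 1" for k s by (auto simp: f_def)
    have fcont: "continuous_on S (f k)" for k S unfolding f_def by (intro continuous_intros)
    have fm: "f k \<in> borel_measurable circle_borel" for k
      by (rule continuous_circle_measurable[OF fcont])
    have int: "(\<integral>\<^sup>+\<zeta>. ennreal (f k \<zeta>) \<partial>\<nu>) = (\<integral>\<^sup>+s. ennreal (f k s) * ennreal (q s / (2 * pi)) \<partial>arc_length)" for k
    proof -
      \<comment> \<open>On the circle \<open>f k\<close> vanishes outside \<open>K0\<close>, and
        \<open>K0\<close> misses C. The radii over \<open>K0\<close> then form a compact set
        avoiding C, on which q is bounded; this dominates all \<open>q (X n * s)\<close> at
        once.\<close>
      define K0 where "K0 = sphere 0 1 \<inter> {s. 1 \<le> real k * infdist s A}"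
      have "closed {s :: complex. 1 \<le> real k * infdist s A}"
        by (intro closed_Collect_le continuous_intros)
      then have "compact K0"
        unfolding K0_def by (rule compact_Int_closed[OF compact_sphere])
      then have cp: "compact ((\<lambda>(r, s). complex_of_real r * s) ` ({0..1} \<times> K0))"
        by (intro compact_continuous_image compact_Times)
           (auto simp: case_prod_unfold intro!: continuous_intros)
      have K0C: "s \<notin> C" if "s \<in> K0" for s
        using that A by (auto simp: K0_def)
      have sub: "(\<lambda>(r, s). complex_of_real r * s) ` ({0..1} \<times> K0) \<subseteq> cball 0 1 - C"
      proof
        fix z assume "z \<in> (\<lambda>(r, s). complex_of_real r * s) ` ({0..1} \<times> K0)"
        then obtain r s where rs: "r \<in> {0..1}" "s \<in> K0" and z: "z = complex_of_real r * s" by auto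
        then have s: "norm s = 1" by (simp add: K0_def)
        have "z \<in> cball 0 1" using rs s by (simp add: z norm_mult)
        moreover have "z \<notin> C"
        proof
          assume "z \<in> C"
          then have "norm z = 1" using C(2) by auto
          then have "r = 1" using rs s by (simp add: z norm_mult)
          then show False using \<open>z \<in> C\<close> K0C[OF rs(2)] by (simp add: z)
        qed
        ultimately show "z \<in> cball 0 1 - C" by blast
      qed
      obtain M where M: "M \<ge> 0"
        "\<And>z. z \<in> (\<lambda>(r, s). complex_of_real r * s) ` ({0..1} \<times> K0) \<Longrightarrow> norm (q z) \<le> M"
        using continuous_on_compact_bound[OF cp continuous_on_subset[OF q(1) sub]] by blast
      have Mq: "\<bar>f k s * q (of_real r * s)\<bar> \<le> M" if "norm s = 1" "r \<in> {0..1}" for r s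
      proof (cases "s \<in> K0")
        case True
        then have "\<bar>q (of_real r * s)\<bar> \<le> M" using M(2)[of "of_real r * s"] that by force
        then show ?thesis using f01[of k s] M(1) mult_mono[of "f k s" 1 "\<bar>q (of_real r * s)\<bar>" M]
          by (simp add: abs_mult)
      next
        case False
        then have "f k s = 0" using that by (auto simp: K0_def f_def)
        then show ?thesis using M(1) by simp
      qed
      have "(\<lambda>n. \<integral>s. f k s * q (of_real (X n) * s) \<partial>arc_length) \<longlonglongrightarrow> (\<integral>s. f k s * q s \<partial>arc_length)"
      proof (rule integral_dominated_convergence[where w = "\<lambda>_. M"])
        show "(\<lambda>s. f k s * q s) \<in> borel_measurable arc_length" using fm by measurable
        show "(\<lambda>s. f k s * q (of_real (X n) * s)) \<in> borel_measurable arc_length" for n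
        proof -
          have "continuous_on (sphere 0 1) (\<lambda>s. f k s * q (of_real (X n) * s))"
            using Xball(2) by (intro continuous_intros fcont continuous_on_compose2[OF q(1)]) auto
          from continuous_circle_measurable[OF this] show ?thesis
            by (simp add: measurable_cong_sets[OF sets_arc_length refl])
        qed
        show "AE s in arc_length. (\<lambda>n. f k s * q (of_real (X n) * s)) \<longlonglongrightarrow> f k s * q s"
        proof (rule AE_I2)
          fix s assume "s \<in> space arc_length"
          then have s: "norm s = 1" by simp
          show "(\<lambda>n. f k s * q (of_real (X n) * s)) \<longlonglongrightarrow> f k s * q s"
          proof (cases "s \<in> C")
            case True
            then have "infdist s A = 0" using A(3) by (simp add: in_closed_iff_infdist_zero[OF A(1,2)] subset_iff)
            then show ?thesis by (simp add: f_def)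
          next
            case False
            have "(\<lambda>n. of_real (X n) * s) \<longlonglongrightarrow> of_real 1 * s" by (intro tendsto_intros X)
            then have "(\<lambda>n. q (of_real (X n) * s)) \<longlonglongrightarrow> q s"
              using False s Xball(2)[OF s] by (intro continuous_on_tendsto_compose[OF q(1)]) auto
            then show ?thesis by (intro tendsto_intros)
          qed
        qed
        show "AE s in arc_length. norm (f k s * q (of_real (X n) * s)) \<le> M" for n
          using Mq X(2,3)[of n] by (intro AE_I2) (simp add: less_imp_le)
      qed simp
      moreover have "(\<lambda>n. \<integral>s. f k s * q (of_real (X n) * s) \<partial>arc_length) \<longlonglongrightarrow> 2 * pi * (\<integral>\<zeta>. f k \<zeta> \<partial>\<nu>)"
      proof -
        have "(\<integral>s. f k s * q (of_real (X n) * s) \<partial>arc_length) =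
           (\<integral>s. f k s * (\<integral>\<zeta>. (1 - (X n)\<^sup>2) / (norm (\<zeta> - of_real (X n) * s))\<^sup>2 \<partial>\<nu>) \<partial>arc_length)" for n
        proof (intro Bochner_Integration.integral_cong refl arg_cong2[where f = "(*)"])
          fix s assume "s \<in> space arc_length"
          then have s: "norm s = 1" by simp
          have "(norm (of_real (X n) * s))\<^sup>2 = (X n)\<^sup>2" using s by (simp add: norm_mult)
          then show "q (of_real (X n) * s) = (\<integral>\<zeta>. (1 - (X n)\<^sup>2) / (norm (\<zeta> - of_real (X n) * s))\<^sup>2 \<partial>\<nu>)"
            using h[OF Xball(1)[OF s, of n]] by simp
        qed
        then show ?thesis using poisson_integral_weak_limit[OF N fcont X] by simp
      qed
      ultimately have eq: "(\<integral>s. f k s * q s \<partial>arc_length) = 2 * pi * (\<integral>\<zeta>. f k \<zeta> \<partial>\<nu>)"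
        by (rule LIMSEQ_unique)
      have i1: "integrable arc_length (\<lambda>s. f k s * (q s / (2 * pi)))"
        using Mq[of _ 1] fm
        by (intro integrable_finite_bounded[OF arc_length.finite_measure_axioms, where B = "M / (2 * pi)"])
           (measurable, auto simp: field_simps)
      have "integrable \<nu> (f k)"
        using fm f01 by (intro integrable_finite_bounded[OF N(1), where B = 1]) auto
      then have "(\<integral>\<^sup>+\<zeta>. ennreal (f k \<zeta>) \<partial>\<nu>) = ennreal (\<integral>\<zeta>. f k \<zeta> \<partial>\<nu>)"
        using f01 by (intro nn_integral_eq_integral) auto
      also have "(\<integral>\<zeta>. f k \<zeta> \<partial>\<nu>) = (\<integral>s. f k s * (q s / (2 * pi)) \<partial>arc_length)"
        using eq by simp
      also have "ennreal \<dots> = (\<integral>\<^sup>+s. ennreal (f k s * (q s / (2 * pi))) \<partial>arc_length)"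
        using f01 q(2) by (intro nn_integral_eq_integral[symmetric] i1) auto
      also have "\<dots> = (\<integral>\<^sup>+s. ennreal (f k s) * ennreal (q s / (2 * pi)) \<partial>arc_length)"
        using f01 q(2) by (intro nn_integral_cong ennreal_mult) auto
      finally show ?thesis .
    qed
    have inc: "incseq (\<lambda>k s. ennreal (f k s))"
    proof (rule incseq_SucI, rule le_funI, rule ennreal_leI)
      fix k s show "f k s \<le> f (Suc k) s"
        unfolding f_def by (intro max.mono min.mono diff_right_mono mult_right_mono) (auto simp: infdist_nonneg)
    qed
    have lim: "(\<lambda>k. ennreal (f k s)) \<longlonglongrightarrow> indicator (G \<inter> ball 0 2) s" for s
    proof (cases "s \<in> A")
      case True
      then have "f k s = 0" for k using A by (simp add: f_def)
      then show ?thesis using True by (simp add: A_def)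
    next
      case False
      then have "infdist s A > 0" using in_closed_iff_infdist_zero[OF A(1,2)] infdist_nonneg[of s A] by (simp add: less_le)
      then obtain m where m: "2 < real m * infdist s A" using reals_Archimedean3 by blast
      have "\<forall>k\<ge>m. f k s = 1"
      proof safe
        fix k assume "m \<le> k"
        then have "real m * infdist s A \<le> real k * infdist s A"
          by (intro mult_right_mono) (auto simp: infdist_nonneg)
        then show "f k s = 1" using m by (simp add: f_def)
      qed
      then have "eventually (\<lambda>k. ennreal (f k s) = indicator (G \<inter> ball 0 2) s) sequentially"
        using False unfolding eventually_sequentially by (auto simp: A_def intro!: exI[of _ m])
      then show ?thesis by (rule tendsto_eventually)
    qed
    have "(\<lambda>k. \<integral>\<^sup>+\<zeta>. ennreal (f k \<zeta>) \<partial>\<nu>) \<longlonglongrightarrow> (\<integral>\<^sup>+\<zeta>. indicator (G \<inter> ball 0 2) \<zeta> \<partial>\<nu>)"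
      using inc fm lim by (intro nn_integral_LIMSEQ) auto
    also have "(\<integral>\<^sup>+\<zeta>. indicator (G \<inter> ball 0 2) \<zeta> \<partial>\<nu>) = (\<integral>\<^sup>+\<zeta>. indicator (G \<inter> sphere 0 1) \<zeta> \<partial>\<nu>)"
      by (intro nn_integral_cong) (auto simp: spN indicator_def)
    also have "\<dots> = emeasure \<nu> (G \<inter> sphere 0 1)"
      using G by (intro nn_integral_indicator) (auto simp: N(2) sets_circle_borel_iff)
    finally have l1: "(\<lambda>k. \<integral>\<^sup>+\<zeta>. ennreal (f k \<zeta>) \<partial>\<nu>) \<longlonglongrightarrow> emeasure \<nu> (G \<inter> sphere 0 1)" .
    have "(\<lambda>k. \<integral>\<^sup>+s. ennreal (f k s) * ennreal (q s / (2 * pi)) \<partial>arc_length)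
        \<longlonglongrightarrow> (\<integral>\<^sup>+s. indicator (G \<inter> ball 0 2) s * ennreal (q s / (2 * pi)) \<partial>arc_length)"
    proof (rule nn_integral_LIMSEQ)
      show "incseq (\<lambda>k s. ennreal (f k s) * ennreal (q s / (2 * pi)))"
        using inc by (auto simp: incseq_def le_fun_def intro!: mult_right_mono)
      show "(\<lambda>s. ennreal (f k s) * ennreal (q s / (2 * pi))) \<in> borel_measurable arc_length" for k
        using fm by measurable
      show "(\<lambda>k. ennreal (f k s) * ennreal (q s / (2 * pi))) \<longlonglongrightarrow> indicator (G \<inter> ball 0 2) s * ennreal (q s / (2 * pi))" for s
        using ennreal_tendsto_cmult[OF _ lim[of s], of "ennreal (q s / (2 * pi))"] by (simp add: mult.commute)
    qed
    also have "(\<integral>\<^sup>+s. indicator (G \<inter> ball 0 2) s * ennreal (q s / (2 * pi)) \<partial>arc_length) =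
        (\<integral>\<^sup>+s. ennreal (q s / (2 * pi)) * indicator (G \<inter> sphere 0 1) s \<partial>arc_length)"
      by (intro nn_integral_cong) (auto simp: indicator_def)
    finally have "(\<lambda>k. \<integral>\<^sup>+\<zeta>. ennreal (f k \<zeta>) \<partial>\<nu>) \<longlonglongrightarrow>
        (\<integral>\<^sup>+s. ennreal (q s / (2 * pi)) * indicator (G \<inter> sphere 0 1) s \<partial>arc_length)"
      unfolding int .
    with l1 show ?thesis by (rule LIMSEQ_unique)
  qed
  have Cm: "C \<in> sets circle_borel" using C by (auto simp: sets_circle_borel_iff)
  define M1 where "M1 = density \<nu> (indicator (sphere 0 1 - C))"
  define M2 where "M2 = density arc_length (\<lambda>s. ennreal (q s / (2 * pi)))"
  have sM: "sets M1 = sets circle_borel" "sets M2 = sets circle_borel"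
    by (simp_all add: M1_def M2_def N(2))
  have e1: "emeasure M1 D = emeasure \<nu> (D - C)" if "D \<in> sets circle_borel" for D
  proof -
    have "emeasure M1 D = (\<integral>\<^sup>+x. indicator (sphere 0 1 - C) x * indicator D x \<partial>\<nu>)"
      unfolding M1_def using that Cm by (intro emeasure_density) (auto simp: N(2) spN[symmetric])
    also have "\<dots> = (\<integral>\<^sup>+x. indicator (D - C) x \<partial>\<nu>)"
      using that by (intro nn_integral_cong) (auto simp: indicator_def sets_circle_borel_iff)
    also have "\<dots> = emeasure \<nu> (D - C)" using that Cm by (intro nn_integral_indicator) (auto simp: N(2))
    finally show ?thesis .
  qed
  have e2: "emeasure M2 D = (\<integral>\<^sup>+s. ennreal (q s / (2 * pi)) * indicator D s \<partial>arc_length)"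
    if "D \<in> sets circle_borel" for D
    unfolding M2_def using that by (intro emeasure_density) measurable
  have "M1 = M2"
  proof (rule measure_eqI_generator_eq[where \<Omega> = "sphere 0 1" and E = "{G \<inter> sphere 0 1 | G. open G}" and A = "\<lambda>_. sphere 0 1"])
    show "Int_stable {G \<inter> sphere 0 1 :: complex set | G. open G}"
    proof (rule Int_stableI, clarify)
      fix G H :: "complex set" assume "open G" "open H"
      then show "\<exists>K. G \<inter> sphere 0 1 \<inter> (H \<inter> sphere 0 1) = K \<inter> sphere 0 1 \<and> open K"
        by (intro exI[of _ "G \<inter> H"]) auto
    qed
    show "emeasure M1 D = emeasure M2 D" if D: "D \<in> {G \<inter> sphere 0 1 | G. open G}" for D
    proof -
      obtain G where G: "open G" "D = G \<inter> sphere 0 1" using D by blast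
      have Dm: "D \<in> sets circle_borel" using G by (auto simp: sets_circle_borel_iff)
      \<comment> \<open>Removing C costs nothing on the density side, since q vanishes
        there.\<close>
      have "open (G - C)" using G C by (intro open_Diff)
      then have "emeasure \<nu> ((G - C) \<inter> sphere 0 1) = (\<integral>\<^sup>+s. ennreal (q s / (2 * pi)) * indicator ((G - C) \<inter> sphere 0 1) s \<partial>arc_length)"
        by (intro key) auto
      also have "\<dots> = (\<integral>\<^sup>+s. ennreal (q s / (2 * pi)) * indicator D s \<partial>arc_length)"
        using G q(3) by (intro nn_integral_cong) (auto simp: indicator_def)
      also have "(G - C) \<inter> sphere 0 1 = D - C" using G by auto
      finally show ?thesis using e1[OF Dm] e2[OF Dm] by simp
    qed
    show "sets M1 = sigma_sets (sphere 0 1) {G \<inter> sphere 0 1 | G. open G}"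
      "sets M2 = sigma_sets (sphere 0 1) {G \<inter> sphere 0 1 | G. open G}"
      unfolding sM by (rule sets_circle_borel_eq_sigma)+
    show "range (\<lambda>_. sphere 0 1) \<subseteq> {G \<inter> sphere 0 1 :: complex set | G. open G}" by (auto intro: exI[of _ UNIV])
    show "emeasure M1 (sphere 0 1) \<noteq> \<infinity>" using e1[of "sphere 0 1"] by (simp add: sets_circle_borel_iff)
  qed auto
  then show "emeasure \<nu> (B - C) = (\<integral>\<^sup>+s. ennreal (q s / (2 * pi)) * indicator B s \<partial>arc_length)"
    using e1[OF B] e2[OF B] by simp
qed

subsection \<open>Starlikeness of the sublevel sets\<close>

lemma one_minus_norm_power2_pos: "norm w < 1 \<Longrightarrow> 0 < 1 - (norm w)\<^sup>2"
  by (simp add: abs_square_less_1)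

locale herglotz =
  fixes u :: "complex \<Rightarrow> complex" and \<alpha>\<^sub>0 :: real and \<rho> :: "complex measure"
  assumes u_holomorphic: "u holomorphic_on ball 0 1"
    and finite_rho: "finite_measure \<rho>"
    and sets_rho: "sets \<rho> = sets circle_borel"
    and u_eq: "\<And>z. norm z < 1 \<Longrightarrow> u z = \<i> * of_real \<alpha>\<^sub>0 + (\<integral>\<zeta>. (\<zeta> + z) / (\<zeta> - z) \<partial>\<rho>)"
begin

lemma space_rho: "space \<rho> = sphere 0 1"
  using sets_eq_imp_space_eq[OF sets_rho] by simp

lemma borel_measurable_rho: "f \<in> borel_measurable borel \<Longrightarrow> f \<in> borel_measurable \<rho>"
  using borel_measurable_circle_borel by (simp add: measurable_cong_sets[OF sets_rho refl])

text \<open>The Poisson integral of \<rho> without its factor \<open>1 - (norm w)\<^sup>2\<close>.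
  This one quantity controls the real part of u, the increments of u and the derivative of
  u.\<close>

definition inv_sq_int :: "complex \<Rightarrow> real" where
  "inv_sq_int w = (\<integral>\<zeta>. 1 / (norm (\<zeta> - w))\<^sup>2 \<partial>\<rho>)"

lemma circle_dist_bound:
  fixes \<zeta> w :: complex
  assumes "norm \<zeta> = 1"
  shows "1 - norm w \<le> norm (\<zeta> - w)"
  using norm_triangle_ineq2[of \<zeta> w] assms by simp

lemma integrable_inv_sq:
  assumes "norm w < 1"
  shows "integrable \<rho> (\<lambda>\<zeta>. 1 / (norm (\<zeta> - w))\<^sup>2)"
proof (rule integrable_finite_bounded[OF finite_rho])
  show "(\<lambda>\<zeta>. 1 / (norm (\<zeta> - w))\<^sup>2) \<in> borel_measurable \<rho>" by (rule borel_measurable_rho) measurable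
  fix \<zeta> assume "\<zeta> \<in> space \<rho>"
  then have "1 - norm w \<le> norm (\<zeta> - w)" by (intro circle_dist_bound) (simp add: space_rho)
  then have "(1 - norm w)\<^sup>2 \<le> (norm (\<zeta> - w))\<^sup>2" using assms by (intro power_mono) auto
  then show "norm (1 / (norm (\<zeta> - w))\<^sup>2) \<le> 1 / (1 - norm w)\<^sup>2"
    using assms by (simp add: frac_le)
qed

lemma inv_sq_int_nonneg: "inv_sq_int w \<ge> 0"
  unfolding inv_sq_int_def by (rule integral_nonneg_AE) simp

lemma integrable_herglotz_kernel:
  assumes "norm w < 1"
  shows "integrable \<rho> (\<lambda>\<zeta>. (\<zeta> + w) / (\<zeta> - w))"
proof (rule integrable_finite_bounded[OF finite_rho])
  show "(\<lambda>\<zeta>. (\<zeta> + w) / (\<zeta> - w)) \<in> borel_measurable \<rho>" by (rule borel_measurable_rho) measurable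
  fix \<zeta> assume "\<zeta> \<in> space \<rho>"
  then have z: "norm \<zeta> = 1" by (simp add: space_rho)
  have "norm (\<zeta> + w) \<le> 2" using norm_triangle_ineq[of \<zeta> w] z assms by simp
  then show "norm ((\<zeta> + w) / (\<zeta> - w)) \<le> 2 / (1 - norm w)"
    unfolding norm_divide using circle_dist_bound[OF z, of w] assms by (intro frac_le) auto
qed

lemma Re_u:
  assumes "norm w < 1"
  shows "Re (u w) = (1 - (norm w)\<^sup>2) * inv_sq_int w"
proof -
  have "Re (u w) = (\<integral>\<zeta>. Re ((\<zeta> + w) / (\<zeta> - w)) \<partial>\<rho>)"
    using integral_Re[OF integrable_herglotz_kernel[OF assms]] assms by (simp add: u_eq)
  also have "\<dots> = (\<integral>\<zeta>. (1 - (norm w)\<^sup>2) * (1 / (norm (\<zeta> - w))\<^sup>2) \<partial>\<rho>)"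
    using assms by (intro Bochner_Integration.integral_cong refl)
      (subst Re_Herglotz_kernel, auto simp: space_rho)
  also have "\<dots> = (1 - (norm w)\<^sup>2) * inv_sq_int w"
    unfolding inv_sq_int_def by (rule integral_mult_right_zero)
  finally show ?thesis .
qed

text \<open>The two Herglotz kernels differ by
  \<open>2 * \<zeta> * (w1 - w2) / ((\<zeta> - w1) * (\<zeta> - w2))\<close>, and
  \<open>2 * a * b \<le> a\<^sup>2 + b\<^sup>2\<close> separates the two points. No segment between
  them has to lie in a good region.\<close>

lemma u_diff_bound:
  assumes "norm w1 < 1" "norm w2 < 1"
  shows "norm (u w1 - u w2) \<le> norm (w1 - w2) * (inv_sq_int w1 + inv_sq_int w2)"
proof -
  let ?k = "\<lambda>w \<zeta>. (\<zeta> + w) / (\<zeta> - w)"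
  have "u w1 - u w2 = (\<integral>\<zeta>. ?k w1 \<zeta> - ?k w2 \<zeta> \<partial>\<rho>)"
    using assms by (simp add: u_eq integrable_herglotz_kernel)
  also have "norm \<dots> \<le> (\<integral>\<zeta>. norm (w1 - w2) * (1 / (norm (\<zeta> - w1))\<^sup>2 + 1 / (norm (\<zeta> - w2))\<^sup>2) \<partial>\<rho>)"
  proof (rule Bochner_Integration.integral_norm_bound_integral)
    show "integrable \<rho> (\<lambda>\<zeta>. ?k w1 \<zeta> - ?k w2 \<zeta>)"
      using assms by (intro Bochner_Integration.integrable_diff integrable_herglotz_kernel)
    show "integrable \<rho> (\<lambda>\<zeta>. norm (w1 - w2) * (1 / (norm (\<zeta> - w1))\<^sup>2 + 1 / (norm (\<zeta> - w2))\<^sup>2))"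
      using assms by (intro integrable_mult_right Bochner_Integration.integrable_add integrable_inv_sq)
    fix \<zeta> assume "\<zeta> \<in> space \<rho>"
    then have z: "norm \<zeta> = 1" by (simp add: space_rho)
    have ne: "\<zeta> - w1 \<noteq> 0" "\<zeta> - w2 \<noteq> 0" using z assms by auto
    define a b where "a = 1 / norm (\<zeta> - w1)" and "b = 1 / norm (\<zeta> - w2)"
    have "?k w1 \<zeta> - ?k w2 \<zeta> = 2 * \<zeta> * (w1 - w2) / ((\<zeta> - w1) * (\<zeta> - w2))"
      using ne by (simp add: divide_simps) (simp add: algebra_simps)
    then have "norm (?k w1 \<zeta> - ?k w2 \<zeta>) = norm (w1 - w2) * (2 * a * b)"
      using z by (simp add: norm_mult norm_divide a_def b_def)
    also have "\<dots> \<le> norm (w1 - w2) * (a\<^sup>2 + b\<^sup>2)"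
      using sum_squares_bound[of a b] by (intro mult_left_mono) auto
    finally show "norm (?k w1 \<zeta> - ?k w2 \<zeta>) \<le> norm (w1 - w2) * (1 / (norm (\<zeta> - w1))\<^sup>2 + 1 / (norm (\<zeta> - w2))\<^sup>2)"
      by (simp add: a_def b_def power_divide)
  qed
  also have "\<dots> = norm (w1 - w2) * (inv_sq_int w1 + inv_sq_int w2)"
    unfolding inv_sq_int_def using assms integrable_inv_sq by (simp del: times_divide_eq_right)
  finally show ?thesis .
qed

text \<open>Limit of the difference quotients in \<open>u_diff_bound\<close>. The continuity of
  \<open>inv_sq_int\<close> that this needs is read off from
  \<open>Re u / (1 - (norm w)\<^sup>2)\<close>, so no differentiation under the integral
  occurs.\<close>

lemma deriv_u_bound:
  assumes "norm w < 1"
  shows "norm (deriv u w) \<le> 2 * inv_sq_int w"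
proof -
  have ev: "eventually (\<lambda>w'. norm w' < 1) (at w)"
    using eventually_at_in_open'[of "ball 0 1" w] assms by simp
  have "(u has_field_derivative deriv u w) (at w)"
    using assms by (intro holomorphic_derivI[OF u_holomorphic]) auto
  then have lim1: "((\<lambda>w'. norm ((u w' - u w) / (w' - w))) \<longlongrightarrow> norm (deriv u w)) (at w)"
    by (intro tendsto_norm) (simp add: has_field_derivative_iff)
  have "((\<lambda>w'. Re (u w') / (1 - (norm w')\<^sup>2) + Re (u w) / (1 - (norm w)\<^sup>2))
      \<longlongrightarrow> Re (u w) / (1 - (norm w)\<^sup>2) + Re (u w) / (1 - (norm w)\<^sup>2)) (at w)"
  proof (intro tendsto_intros)
    have "continuous (at w) u"
      using assms holomorphic_on_imp_continuous_on[OF u_holomorphic] by (simp add: continuous_on_eq_continuous_at)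
    then show "(u \<longlongrightarrow> u w) (at w)" by (simp add: continuous_at)
    show "1 - (norm w)\<^sup>2 \<noteq> 0" using one_minus_norm_power2_pos[OF assms] by simp
  qed
  moreover have Du: "Re (u v) / (1 - (norm v)\<^sup>2) = inv_sq_int v" if "norm v < 1" for v
    using Re_u[OF that] one_minus_norm_power2_pos[OF that] by simp
  ultimately have lim2: "((\<lambda>w'. Re (u w') / (1 - (norm w')\<^sup>2) + Re (u w) / (1 - (norm w)\<^sup>2)) \<longlongrightarrow> 2 * inv_sq_int w) (at w)"
    using assms by simp
  show ?thesis
  proof (rule tendsto_le[OF _ lim2 lim1])
    show "\<forall>\<^sub>F w' in at w. norm ((u w' - u w) / (w' - w)) \<le> Re (u w') / (1 - (norm w')\<^sup>2) + Re (u w) / (1 - (norm w)\<^sup>2)"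
      using ev eventually_neq_at_within[of w w UNIV]
    proof eventually_elim
      case (elim w')
      then have "norm (u w' - u w) \<le> (inv_sq_int w' + inv_sq_int w) * norm (w' - w)"
        using u_diff_bound[of w' w] assms by (simp add: mult.commute)
      then show ?case
        using elim assms by (simp add: Du norm_divide divide_le_eq)
    qed
  qed simp
qed

end

locale herglotz_power = herglotz +
  fixes t :: real
  assumes t: "t > 1"
begin

lemma Phi_holomorphic: "Phi u t holomorphic_on ball 0 1"
  unfolding Phi_def by (intro holomorphic_intros u_holomorphic)

lemma norm_Phi: "norm (Phi u t w) = norm w * exp ((t - 1) * Re (u w))"
  by (simp add: Phi_def norm_mult)

lemma ln_norm_Phi: "w \<noteq> 0 \<Longrightarrow> ln (norm (Phi u t w)) = ln (norm w) + (t - 1) * Re (u w)"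
  by (simp add: norm_Phi ln_mult)

lemma inv_sq_int_sublevel:
  assumes "w \<noteq> 0" "norm w < 1" "norm (Phi u t w) \<le> 1"
  shows "(t - 1) * ((1 - (norm w)\<^sup>2) * inv_sq_int w) \<le> - ln (norm w)"
proof -
  have "0 < norm (Phi u t w)" using assms by (simp add: norm_Phi)
  then have "ln (norm (Phi u t w)) \<le> 0" using assms by simp
  then show ?thesis using assms by (simp add: ln_norm_Phi Re_u)
qed

text \<open>With \<open>r = norm w\<close>, the quantity is at most
  \<open>2 * r * (t - 1) * inv_sq_int w\<close>. The sublevel condition bounds
  \<open>(t - 1) * (1 - r\<^sup>2) * inv_sq_int w\<close> by \<open>- ln r\<close>, and
  \<open>ln_less_half_diff\<close> finishes without any dependence on t.\<close>

lemma deriv_u_sublevel: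
  assumes "w \<noteq> 0" "norm w < 1" "norm (Phi u t w) \<le> 1"
  shows "(t - 1) * norm (w * deriv u w) < 1"
proof -
  let ?r = "norm w"
  have r: "0 < ?r" "?r < 1" "0 < 1 - ?r\<^sup>2" using assms by (auto simp: abs_square_less_1)
  have "(t - 1) * norm (w * deriv u w) * (1 - ?r\<^sup>2) \<le> (t - 1) * (?r * (2 * inv_sq_int w)) * (1 - ?r\<^sup>2)"
    using t r deriv_u_bound[of w] by (intro mult_right_mono mult_left_mono) (auto simp: norm_mult)
  also have "\<dots> = 2 * ?r * ((t - 1) * ((1 - ?r\<^sup>2) * inv_sq_int w))" by simp
  also have "\<dots> \<le> 2 * ?r * (- ln ?r)"
    using inv_sq_int_sublevel[OF assms] r by (intro mult_left_mono) auto
  also have "\<dots> < 1 * (1 - ?r\<^sup>2)" using ln_less_half_diff[OF r(1,2)] by simp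
  finally show ?thesis using r(3) by (simp only: mult_less_cancel_right_pos)
qed

text \<open>The derivative is an exponential times \<open>1 + (t - 1) * w * deriv u w\<close>, and
  the second summand has modulus below 1. Level 1 is included because local inverses are needed at
  boundary points of \<open>Omega\<close> inside the disc.\<close>

lemma deriv_Phi_nonzero:
  assumes "norm w < 1" "norm (Phi u t w) \<le> 1"
  shows "deriv (Phi u t) w \<noteq> 0"
proof -
  have du: "(u has_field_derivative deriv u w) (at w)"
    using assms by (intro holomorphic_derivI[OF u_holomorphic]) auto
  have "(Phi u t has_field_derivative exp (of_real (t - 1) * u w) * (1 + of_real (t - 1) * (w * deriv u w))) (at w)"
    unfolding Phi_def by (rule derivative_eq_intros refl du)+ (simp add: algebra_simps)
  then have "deriv (Phi u t) w = exp (of_real (t - 1) * u w) * (1 + of_real (t - 1) * (w * deriv u w))"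
    by (rule DERIV_imp_deriv)
  moreover have "1 + of_real (t - 1) * (w * deriv u w) \<noteq> 0"
  proof
    assume "1 + of_real (t - 1) * (w * deriv u w) = 0"
    then have "of_real (t - 1) * (w * deriv u w) = -1" by (simp add: add_eq_0_iff)
    then have 1: "norm (of_real (t - 1) * (w * deriv u w)) = 1" by simp
    then have "w \<noteq> 0" by auto
    then show False using deriv_u_sublevel[OF _ assms] 1 t by (simp only: norm_mult norm_of_real) simp
  qed
  ultimately show ?thesis by simp
qed

text \<open>Along a ray, \<open>ln \<bar>\<Phi>\<bar>\<close> has positive derivative wherever it is nonpositive, so that it cannot
  return to the nonpositive half-line once it has left it.\<close>

lemma Phi_starlike:
  assumes e: "norm e = 1" and s: "0 < s1" "s1 < s2" "s2 < 1"
    and le: "norm (Phi u t (of_real s2 * e)) \<le> 1"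
  shows "norm (Phi u t (of_real s1 * e)) < 1"
proof (rule ccontr)
  assume neg: "\<not> ?thesis"
  define f where "f s = ln s + (t - 1) * Re (u (of_real s * e))" for s
  have lnf: "f s = ln (norm (Phi u t (of_real s * e)))" if "0 < s" for s
  proof -
    have "of_real s * e \<noteq> 0" using that e by auto
    from ln_norm_Phi[OF this] show ?thesis using that e by (simp add: f_def norm_mult)
  qed
  have f': "\<exists>l>0. (f has_real_derivative l) (at s)" if s: "0 < s" "s < 1" "f s \<le> 0" for s
  proof (intro exI conjI)
    let ?w = "of_real s * e"
    have w: "?w \<noteq> 0" "norm ?w < 1" "norm (Phi u t ?w) \<le> 1"
    proof -
      show "?w \<noteq> 0" "norm ?w < 1" using s e by (auto simp: norm_mult)
      then have "0 < norm (Phi u t ?w)" by (simp add: norm_Phi)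
      then show "norm (Phi u t ?w) \<le> 1" using s lnf[of s] by simp
    qed
    have du: "(u has_field_derivative deriv u ?w) (at ?w)"
      using w by (intro holomorphic_derivI[OF u_holomorphic]) auto
    have "((\<lambda>s. complex_of_real s * e) has_vector_derivative e) (at s)"
      by (auto intro!: derivative_eq_intros simp: has_vector_derivative_def scaleR_conv_of_real has_derivative_of_real)
    from field_vector_diff_chain_at[OF this du]
    have "((\<lambda>s. u (of_real s * e)) has_vector_derivative e * deriv u ?w) (at s)" by (simp add: o_def)
    from bounded_linear.has_vector_derivative[OF bounded_linear_Re this]
    have "((\<lambda>s. Re (u (of_real s * e))) has_real_derivative Re (e * deriv u ?w)) (at s)"
      by (simp add: has_real_derivative_iff_has_vector_derivative)
    from DERIV_add[OF DERIV_ln_divide[OF s(1)] DERIV_cmult[OF this, of "t - 1"]]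
    show "(f has_real_derivative 1 / s + (t - 1) * Re (e * deriv u ?w)) (at s)"
      unfolding f_def .
    have "\<bar>Re (e * deriv u ?w)\<bar> \<le> norm (e * deriv u ?w)" by (rule abs_Re_le_cmod)
    then have "(t - 1) * (s * \<bar>Re (e * deriv u ?w)\<bar>) \<le> (t - 1) * (s * norm (e * deriv u ?w))"
      using t s by (intro mult_left_mono) auto
    also have "\<dots> < 1"
      using deriv_u_sublevel[OF w] s by (simp add: norm_mult mult.assoc)
    finally have "(t - 1) * \<bar>Re (e * deriv u ?w)\<bar> < 1 / s"
      using s by (simp add: field_simps)
    moreover have "\<bar>(t - 1) * Re (e * deriv u ?w)\<bar> = (t - 1) * \<bar>Re (e * deriv u ?w)\<bar>"
      using t by (simp add: abs_mult)
    ultimately show "0 < 1 / s + (t - 1) * Re (e * deriv u ?w)" by linarith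
  qed
  have cont: "continuous_on {s1..s2} f"
    unfolding f_def using s e
    by (intro continuous_intros continuous_on_compose2[OF holomorphic_on_imp_continuous_on[OF u_holomorphic]])
       (auto simp: norm_mult)
  have "f s2 \<le> 0"
  proof -
    have "0 < norm (Phi u t (of_real s2 * e))" using s e unfolding norm_Phi by (simp add: norm_mult)
    then show ?thesis using le s lnf[of s2] by simp
  qed
  have "f s1 \<ge> 0" using neg s lnf[of s1] by simp
  obtain x where x: "x \<in> {s1..s2}" "\<And>y. y \<in> {s1..s2} \<Longrightarrow> f x \<le> f y"
    using continuous_attains_inf[of "{s1..s2}" f] cont s by auto
  \<comment> \<open>A minimum point other than \<open>s1\<close> is wanted, so that there is room on
    its left. If the minimum is at \<open>s1\<close>, then \<open>f s2 \<le> 0 \<le> f s1\<close>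
    makes \<open>s2\<close> a minimum point too. The positive derivative there contradicts
    minimality.\<close>
  obtain x' where x': "s1 < x'" "x' \<le> s2" "\<And>y. y \<in> {s1..s2} \<Longrightarrow> f x' \<le> f y"
  proof (cases "x = s1")
    case True
    have "f s2 \<le> f y" if "y \<in> {s1..s2}" for y
      using x(2)[OF that] True \<open>f s2 \<le> 0\<close> \<open>f s1 \<ge> 0\<close> by simp
    then show ?thesis using that[of s2] s by simp
  next
    case False
    then show ?thesis using that[of x] x by simp
  qed
  have "f x' \<le> 0" using x'(3)[of s2] s \<open>f s2 \<le> 0\<close> by simp
  then obtain l where l: "l > 0" "(f has_real_derivative l) (at x')"
    using f'[of x'] x' s by auto
  from DERIV_pos_inc_left[OF l(2,1)] obtain d where d: "d > 0" "\<And>h. h > 0 \<Longrightarrow> h < d \<Longrightarrow> f (x' - h) < f x'"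
    by blast
  define h where "h = min (d / 2) (x' - s1)"
  have "h > 0" "h < d" "x' - h \<in> {s1..s2}" using d x' by (auto simp: h_def min_def)
  then show False using d(2)[of h] x'(3)[of "x' - h"] by simp
qed

text \<open>For \<open>norm w \<le> 1 / 2\<close> the integrand is at most 4. Otherwise, with
  \<open>r = norm w\<close>, \<open>- ln r \<le> 1 / r - 1 \<le> 2 * (1 - r\<^sup>2)\<close>, and
  the factor \<open>1 - r\<^sup>2\<close> cancels in the sublevel inequality, leaving
  \<open>2 / (t - 1)\<close>. So the bound does not degenerate at the circle.\<close>

lemma inv_sq_int_bounded_Omega: "\<exists>M\<ge>0. \<forall>w \<in> Omega u t. inv_sq_int w \<le> M"
proof (intro exI conjI ballI)
  interpret finite_measure \<rho> by (rule finite_rho)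
  let ?M = "4 * measure \<rho> (space \<rho>) + 2 / (t - 1)"
  show "?M \<ge> 0" using t by simp
  fix w assume "w \<in> Omega u t"
  then have w: "norm w < 1" "norm (Phi u t w) \<le> 1" by (auto simp: Omega_def)
  show "inv_sq_int w \<le> ?M"
  proof (cases "norm w \<le> 1 / 2")
    case True
    have "inv_sq_int w \<le> (\<integral>\<zeta>. 4 \<partial>\<rho>)"
      unfolding inv_sq_int_def
    proof (rule integral_mono)
      fix \<zeta> assume "\<zeta> \<in> space \<rho>"
      then have "1 / 2 \<le> norm (\<zeta> - w)" using circle_dist_bound[of \<zeta> w] True by (simp add: space_rho)
      then have "(1 / 2)\<^sup>2 \<le> (norm (\<zeta> - w))\<^sup>2" by (intro power_mono) auto
      then show "1 / (norm (\<zeta> - w))\<^sup>2 \<le> 4" using frac_le[of 1 1 "(1 / 2)\<^sup>2" "(norm (\<zeta> - w))\<^sup>2"] by (simp add: power_divide)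
    qed (use integrable_inv_sq[OF w(1)] in auto)
    also have "\<dots> = 4 * measure \<rho> (space \<rho>)" by simp
    also have "\<dots> \<le> ?M" using t by simp
    finally show ?thesis .
  next
    case False
    let ?r = "norm w"
    have r: "1 / 2 < ?r" "?r < 1" using False w by auto
    then have "w \<noteq> 0" by auto
    have "- ln ?r = ln (1 / ?r)" using r by (simp add: ln_div)
    also have "\<dots> \<le> 1 / ?r - 1" using r by (intro ln_le_minus_one) auto
    also have "\<dots> = (1 - ?r) / ?r" using \<open>w \<noteq> 0\<close> by (simp add: diff_divide_distrib)
    also have "\<dots> \<le> (1 - ?r) / (1 / 2)" using r by (intro divide_left_mono) auto
    also have "\<dots> \<le> (1 - ?r\<^sup>2) * 2" using r mult_left_le[of ?r ?r] by (simp add: power2_eq_square)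
    finally have "(1 - ?r\<^sup>2) * ((t - 1) * inv_sq_int w) \<le> (1 - ?r\<^sup>2) * 2"
      using inv_sq_int_sublevel[OF \<open>w \<noteq> 0\<close> w] by (simp add: mult_ac)
    moreover have "1 - ?r\<^sup>2 > 0" using w by (intro one_minus_norm_power2_pos)
    ultimately have "(t - 1) * inv_sq_int w \<le> 2" by (rule mult_left_le_imp_le)
    then have "inv_sq_int w \<le> 2 / (t - 1)" using t by (simp add: field_simps)
    then show ?thesis by (simp add: add_increasing)
  qed
qed

lemma u_Lipschitz: "\<exists>L\<ge>0. \<forall>w1 \<in> Omega u t. \<forall>w2 \<in> Omega u t. norm (u w1 - u w2) \<le> L * norm (w1 - w2)"
proof -
  obtain M where M: "M \<ge> 0 \<and> (\<forall>w \<in> Omega u t. inv_sq_int w \<le> M)" using inv_sq_int_bounded_Omega ..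
  show ?thesis
  proof (intro exI conjI ballI)
    show "2 * M \<ge> 0" using M by simp
    fix w1 w2 assume w: "w1 \<in> Omega u t" "w2 \<in> Omega u t"
    then have "norm (u w1 - u w2) \<le> norm (w1 - w2) * (inv_sq_int w1 + inv_sq_int w2)"
      by (intro u_diff_bound) (auto simp: Omega_def)
    also have "\<dots> \<le> norm (w1 - w2) * (M + M)"
      using M w by (intro mult_left_mono add_mono) auto
    finally show "norm (u w1 - u w2) \<le> 2 * M * norm (w1 - w2)" by (simp add: mult_ac)
  qed
qed

end

section \<open>The radial function of the sublevel set and its relation to g\<close>

context herglotz_power
begin

lemma T_kernel_circle:
  assumes "norm \<zeta> = 1"
  shows "T_kernel r (\<theta> - Arg \<zeta>) = (1 - r\<^sup>2) / (- ln r) * (1 / (norm (\<zeta> - of_real r * cis \<theta>))\<^sup>2)"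
  unfolding T_kernel_def cos_diff_Arg[OF assms]
  using norm_circle_diff_square[OF assms, of "cis \<theta>" r]
  by (metis divide_minus_right minus_diff_eq minus_divide_left norm_cis)

lemma T_integral:
  "(\<integral>\<zeta>. T_kernel r (\<theta> - Arg \<zeta>) \<partial>\<rho>) = (1 - r\<^sup>2) / (- ln r) * inv_sq_int (of_real r * cis \<theta>)"
proof -
  have "(\<integral>\<zeta>. T_kernel r (\<theta> - Arg \<zeta>) \<partial>\<rho>)
      = (\<integral>\<zeta>. (1 - r\<^sup>2) / (- ln r) * (1 / (norm (\<zeta> - of_real r * cis \<theta>))\<^sup>2) \<partial>\<rho>)"
    by (intro Bochner_Integration.integral_cong refl T_kernel_circle) (simp add: space_rho)
  then show ?thesis unfolding inv_sq_int_def by (simp only: integral_mult_right_zero)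
qed

text \<open>The integral equals \<open>Re (u w) / (- ln r)\<close> at
  \<open>w = r * cis \<theta>\<close>. Cleared of denominators, both sides say
  \<open>ln r + (t - 1) * Re (u w) < 0\<close>.\<close>

lemma T_integral_less_iff:
  assumes "0 < r" "r < 1"
  shows "(\<integral>\<zeta>. T_kernel r (\<theta> - Arg \<zeta>) \<partial>\<rho>) < 1 / (t - 1) \<longleftrightarrow> norm (Phi u t (of_real r * cis \<theta>)) < 1"
proof -
  let ?w = "of_real r * cis \<theta> :: complex"
  have w: "?w \<noteq> 0" "norm ?w = r" using assms by (auto simp: norm_mult)
  have "0 < norm (Phi u t ?w)" unfolding norm_Phi w using assms by simp
  then have "norm (Phi u t ?w) < 1 \<longleftrightarrow> ln (norm (Phi u t ?w)) < 0" by simp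
  also have "\<dots> \<longleftrightarrow> (t - 1) * ((1 - r\<^sup>2) * inv_sq_int ?w) < - ln r"
    using assms w by (auto simp: ln_norm_Phi Re_u)
  also have "\<dots> \<longleftrightarrow> (1 - r\<^sup>2) * inv_sq_int ?w / (- ln r) < 1 / (t - 1)"
  proof -
    have gen: "b * X < a \<longleftrightarrow> X / a < 1 / b" if "a > 0" "b > 0" for a b X :: real
      using that by (simp add: field_simps)
    show ?thesis by (rule gen) (use assms t in auto)
  qed
  finally show ?thesis unfolding T_integral by simp
qed

definition sub_radii :: "real \<Rightarrow> real set" where
  "sub_radii \<theta> = {r \<in> {0<..<1}. norm (Phi u t (of_real r * cis \<theta>)) < 1}"

lemma R_fun_eq: "R_fun \<rho> t \<theta> = Sup (sub_radii \<theta>)"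
  unfolding R_fun_def sub_radii_def by (rule arg_cong[where f = Sup]) (auto simp: T_integral_less_iff)

text \<open>Continuity at 0, where \<open>Phi\<close> vanishes. It guarantees that
  \<open>R_fun\<close> is a genuine supremum and positive.\<close>

lemma sub_radii_nonempty: "sub_radii \<theta> \<noteq> {}"
proof -
  have "continuous_on (ball 0 1) (Phi u t)" by (rule holomorphic_on_imp_continuous_on[OF Phi_holomorphic])
  then have "isCont (Phi u t) 0" by (simp add: continuous_on_eq_continuous_at)
  then obtain d where d: "d > 0" "\<And>w. norm w < d \<Longrightarrow> norm (Phi u t w - Phi u t 0) < 1"
    unfolding continuous_at_eps_delta dist_norm by (metis diff_zero zero_less_one)
  define r where "r = min (d / 2) (1 / 2)"
  have r: "0 < r" "r < d" "r < 1" using d by (auto simp: r_def)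
  then have "norm (Phi u t (of_real r * cis \<theta>) - Phi u t 0) < 1"
    by (intro d(2)) (simp add: norm_mult)
  then have "norm (Phi u t (of_real r * cis \<theta>)) < 1" by (simp add: Phi_def)
  then show ?thesis using r by (auto simp: sub_radii_def)
qed

lemma sub_radii_bdd: "bdd_above (sub_radii \<theta>)"
  by (rule bdd_aboveI[of _ 1]) (auto simp: sub_radii_def)

lemma R_pos: "0 < R_fun \<rho> t \<theta>"
proof -
  obtain r where r: "r \<in> sub_radii \<theta>" using sub_radii_nonempty by blast
  then have "0 < r" by (simp add: sub_radii_def)
  also have "r \<le> Sup (sub_radii \<theta>)" by (rule cSup_upper[OF r sub_radii_bdd])
  finally show ?thesis by (simp add: R_fun_eq)
qed

lemma below_R:
  assumes "0 < r" "r < R_fun \<rho> t \<theta>"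
  shows "norm (Phi u t (of_real r * cis \<theta>)) < 1"
proof -
  obtain s where s: "s \<in> sub_radii \<theta>" "r < s"
    using assms less_cSupD[OF sub_radii_nonempty] unfolding R_fun_eq by blast
  then show ?thesis using assms by (intro Phi_starlike[of "cis \<theta>" r s]) (auto simp: sub_radii_def)
qed

lemma above_R:
  assumes "R_fun \<rho> t \<theta> < r" "r < 1"
  shows "norm (Phi u t (of_real r * cis \<theta>)) > 1"
proof (rule ccontr)
  assume neg: "\<not> ?thesis"
  define s where "s = (R_fun \<rho> t \<theta> + r) / 2"
  have s: "R_fun \<rho> t \<theta> < s" "s < r" "0 < s" using assms R_pos[of \<theta>] by (auto simp: s_def)
  then have "norm (Phi u t (of_real s * cis \<theta>)) < 1"
    using neg assms by (intro Phi_starlike[of "cis \<theta>" s r]) auto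
  then have "s \<in> sub_radii \<theta>" using s assms by (auto simp: sub_radii_def)
  then show False using cSup_upper[OF _ sub_radii_bdd] s unfolding R_fun_eq by fastforce
qed

lemma R_eqI:
  assumes "0 < s" "s < 1" "norm (Phi u t (of_real s * cis \<theta>)) = 1"
  shows "R_fun \<rho> t \<theta> = s"
  using below_R[of s \<theta>] above_R[of \<theta> s] assms by (metis less_irrefl linorder_neqE)

text \<open>The radius is interior to the unit interval, so \<open>below_R\<close> and
  \<open>above_R\<close> give both inequalities as one-sided limits.\<close>

lemma norm_Phi_R:
  assumes "R_fun \<rho> t \<theta> < 1"
  shows "norm (Phi u t (of_real (R_fun \<rho> t \<theta>) * cis \<theta>)) = 1"
proof -
  let ?R = "R_fun \<rho> t \<theta>"
  let ?F = "\<lambda>r. norm (Phi u t (of_real r * cis \<theta>))"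
  have "continuous_on {-1<..<1} ?F"
    by (intro continuous_intros continuous_on_compose2[OF holomorphic_on_imp_continuous_on[OF Phi_holomorphic]])
       (auto simp: norm_mult)
  then have "isCont ?F ?R"
    using assms R_pos[of \<theta>] by (simp add: continuous_on_eq_continuous_at)
  then have lim: "(?F \<longlongrightarrow> ?F ?R) (at ?R)" by (simp add: isCont_def)
  have "eventually (\<lambda>r. r \<in> {0<..<?R}) (at_left ?R)"
    using R_pos[of \<theta>] by (rule eventually_at_left_real)
  then have "?F ?R \<le> 1"
    by (intro tendsto_upperbound[OF filterlim_mono[OF lim order_refl at_le]])
       (auto elim!: eventually_mono dest!: below_R intro: less_imp_le)
  moreover have "eventually (\<lambda>r. r \<in> {?R<..<1}) (at_right ?R)"
    using assms by (rule eventually_at_right_real)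
  then have "1 \<le> ?F ?R"
    by (intro tendsto_lowerbound[OF filterlim_mono[OF lim order_refl at_le]])
       (auto elim!: eventually_mono dest!: above_R intro: less_imp_le)
  ultimately show ?thesis by simp
qed

end

text \<open>The right side is the limit of the left one as r tends to 1. With
  \<open>c = cos x\<close>, the logarithm estimate gives
  \<open>(1 - r\<^sup>2) / (- ln r) \<le> (1 + r)\<^sup>2 / 2\<close>, and
  \<open>(1 + r)\<^sup>2 * (1 - c) / 2\<close> falls short of
  \<open>1 - 2 * r * c + r\<^sup>2\<close> by exactly
  \<open>(1 - r)\<^sup>2 * (1 + c) / 2\<close>.\<close>

lemma T_kernel_le:
  assumes "0 < r" "r < 1" "cos x \<noteq> 1"
  shows "T_kernel r x \<le> 1 / (1 - cos x)"
proof -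
  let ?c = "cos x" and ?K = "(1 - r\<^sup>2) / (- ln r)"
  have c: "-1 \<le> ?c" "?c < 1" using assms cos_le_one[of x] cos_ge_minus_one[of x] by linarith+
  have l: "- ln r > 0" using assms by simp
  have P: "0 \<le> (1 - r)\<^sup>2 * (1 + ?c)" using c(1) by (intro mult_nonneg_nonneg zero_le_power2) linarith
  have gen: "a * (1 / q) \<le> 1 / b" if "a * b \<le> q" "q > 0" "b > 0" for a b q :: real
    using that by (simp add: field_simps)
  have "?K \<le> (1 - r\<^sup>2) / (2 * (1 - r) / (1 + r))"
    using ln_le_diff_div_sum[OF assms(1,2)] assms l by (intro divide_left_mono mult_pos_pos) (auto simp: power_le_one)
  also have "\<dots> = (1 + r)\<^sup>2 / 2"
    using assms by (simp add: field_simps power2_eq_square)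
  finally have "?K * (1 - ?c) \<le> (1 + r)\<^sup>2 / 2 * (1 - ?c)" using c by (intro mult_right_mono) auto
  also have "\<dots> = 1 - 2 * r * ?c + r\<^sup>2 - (1 - r)\<^sup>2 * (1 + ?c) / 2"
    by (simp add: field_simps power2_eq_square)
  also have "\<dots> \<le> 1 - 2 * r * ?c + r\<^sup>2"
    using P by linarith
  finally have *: "?K * (1 - ?c) \<le> 1 - 2 * r * ?c + r\<^sup>2" .
  have "0 < (1 - r)\<^sup>2" using assms by simp
  also have "\<dots> \<le> 1 - 2 * r * ?c + r\<^sup>2"
    using c assms mult_left_mono[of ?c 1 "2 * r"] by (simp add: power2_diff)
  finally have "?K * (1 / (1 - 2 * r * ?c + r\<^sup>2)) \<le> 1 / (1 - ?c)"
    using * c by (intro gen) auto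
  moreover have "(r\<^sup>2 - 1) / ln r = ?K" using l by (simp add: divide_simps)
  ultimately show ?thesis by (simp only: T_kernel_def)
qed

lemma one_minus_cos_Arg:
  assumes "norm \<zeta> = 1"
  shows "1 - cos (\<theta> - Arg \<zeta>) = (norm (\<zeta> - cis \<theta>))\<^sup>2 / 2"
  using norm_circle_diff_square[OF assms, of "cis \<theta>" 1] cos_diff_Arg[OF assms] by simp

context herglotz_power
begin

lemma T_nonneg:
  assumes "0 < r" "r < 1" "norm \<zeta> = 1"
  shows "T_kernel r (\<theta> - Arg \<zeta>) \<ge> 0"
proof -
  have "1 - r\<^sup>2 \<ge> 0" using assms by (simp add: power_le_one)
  then show ?thesis unfolding T_kernel_circle[OF assms(3)] using assms
    by (intro mult_nonneg_nonneg divide_nonneg_nonneg) auto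
qed

lemma T_nn_integral:
  assumes "0 < r" "r < 1"
  shows "(\<integral>\<^sup>+\<zeta>. ennreal (T_kernel r (\<theta> - Arg \<zeta>)) \<partial>\<rho>) = ennreal (\<integral>\<zeta>. T_kernel r (\<theta> - Arg \<zeta>) \<partial>\<rho>)"
proof (rule nn_integral_eq_integral)
  have "integrable \<rho> (\<lambda>\<zeta>. (1 - r\<^sup>2) / (- ln r) * (1 / (norm (\<zeta> - of_real r * cis \<theta>))\<^sup>2))"
    using assms by (intro integrable_mult_right integrable_inv_sq) (simp add: norm_mult)
  then show "integrable \<rho> (\<lambda>\<zeta>. T_kernel r (\<theta> - Arg \<zeta>))"
    by (rule Bochner_Integration.integrable_cong[THEN iffD1, rotated 2])
       (auto simp: T_kernel_circle space_rho)
  show "AE \<zeta> in \<rho>. 0 \<le> T_kernel r (\<theta> - Arg \<zeta>)"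
    using assms by (intro AE_I2 T_nonneg) (auto simp: space_rho)
qed

text \<open>If the ray leaves the sublevel set before the circle, the \<open>T_kernel\<close>
  integral at a radius beyond the exit exceeds the threshold, and g dominates it by
  \<open>T_kernel_le\<close>. If it does not, all these integrals stay below the threshold, and
  Fatou's lemma carries the bound to g.\<close>

lemma g_fun_gt_iff: "g_fun \<rho> \<theta> > ennreal (1 / (t - 1)) \<longleftrightarrow> R_fun \<rho> t \<theta> < 1"
proof
  assume R: "R_fun \<rho> t \<theta> < 1"
  define r where "r = (R_fun \<rho> t \<theta> + 1) / 2"
  have r: "R_fun \<rho> t \<theta> < r" "r < 1" "0 < r" using R R_pos[of \<theta>] by (auto simp: r_def)
  have "\<not> (\<integral>\<zeta>. T_kernel r (\<theta> - Arg \<zeta>) \<partial>\<rho>) \<le> 1 / (t - 1)"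
  proof
    assume le: "(\<integral>\<zeta>. T_kernel r (\<theta> - Arg \<zeta>) \<partial>\<rho>) \<le> 1 / (t - 1)"
    let ?w = "of_real r * cis \<theta> :: complex"
    have "(t - 1) * ((1 - r\<^sup>2) / (- ln r) * inv_sq_int ?w) \<le> 1"
      using le t unfolding T_integral by (simp add: pos_le_divide_eq mult.commute)
    then have "(t - 1) * ((1 - r\<^sup>2) * inv_sq_int ?w) \<le> - ln r"
      using r by (simp add: field_simps)
    then have "ln (norm (Phi u t ?w)) \<le> 0"
      using r by (simp add: ln_norm_Phi Re_u norm_mult)
    moreover have "1 < norm (Phi u t ?w)" using above_R[OF r(1,2)] .
    ultimately show False using ln_gt_zero[of "norm (Phi u t ?w)"] by linarith
  qed
  then have "ennreal (1 / (t - 1)) < ennreal (\<integral>\<zeta>. T_kernel r (\<theta> - Arg \<zeta>) \<partial>\<rho>)"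
    using t by (subst ennreal_less_iff) auto
  also have "\<dots> = (\<integral>\<^sup>+\<zeta>. ennreal (T_kernel r (\<theta> - Arg \<zeta>)) \<partial>\<rho>)"
    using r by (intro T_nn_integral[symmetric])
  also have "\<dots> \<le> g_fun \<rho> \<theta>"
    unfolding g_fun_def
  proof (rule nn_integral_mono)
    fix \<zeta> assume "\<zeta> \<in> space \<rho>"
    show "ennreal (T_kernel r (\<theta> - Arg \<zeta>)) \<le> 1 / ennreal (1 - cos (\<theta> - Arg \<zeta>))"
    proof (cases "cos (\<theta> - Arg \<zeta>) = 1")
      case False
      then have "1 - cos (\<theta> - Arg \<zeta>) > 0" using cos_le_one[of "\<theta> - Arg \<zeta>"] by linarith
      then have "1 / ennreal (1 - cos (\<theta> - Arg \<zeta>)) = ennreal (1 / (1 - cos (\<theta> - Arg \<zeta>)))"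
        using divide_ennreal[of 1 "1 - cos (\<theta> - Arg \<zeta>)"] by simp
      then show ?thesis using T_kernel_le[OF r(3,2) False] by (simp add: ennreal_leI)
    qed simp
  qed
  finally show "g_fun \<rho> \<theta> > ennreal (1 / (t - 1))" .
next
  assume g: "g_fun \<rho> \<theta> > ennreal (1 / (t - 1))"
  show "R_fun \<rho> t \<theta> < 1"
  proof (rule ccontr)
    assume "\<not> R_fun \<rho> t \<theta> < 1"
    define X where "X n = 1 - 1 / (real n + 2)" for n
    have X: "X \<longlonglongrightarrow> 1" unfolding X_def by real_asymp
    have X01: "0 < X n" "X n < 1" for n unfolding X_def by (auto simp: field_simps)
    let ?e = "cis \<theta>"
    \<comment> \<open>A minorant of \<open>T_kernel\<close> free of the logarithm, obtained from
      \<open>2 * r < (1 - r\<^sup>2) / (- ln r)\<close>. It has the same limit as r tends to 1,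
      which is all that Fatou's lemma needs.\<close>
    define k where "k n \<zeta> = 2 * X n / (norm (\<zeta> - of_real (X n) * ?e))\<^sup>2" for n \<zeta>
    have km: "(\<lambda>\<zeta>. ennreal (k n \<zeta>)) \<in> borel_measurable \<rho>" for n
      unfolding k_def by (rule borel_measurable_rho) measurable
    have kT: "k n \<zeta> \<le> T_kernel (X n) (\<theta> - Arg \<zeta>)" if "norm \<zeta> = 1" for n \<zeta>
    proof -
      have "2 * X n \<le> (1 - (X n)\<^sup>2) / (- ln (X n))"
        using ln_less_half_diff[OF X01, of n] ln_less_zero[OF X01, of n] by (subst le_divide_eq) auto
      from mult_right_mono[OF this, of "1 / (norm (\<zeta> - of_real (X n) * ?e))\<^sup>2"]
      show ?thesis unfolding T_kernel_circle[OF that] k_def by simp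
    qed
    have le: "(\<integral>\<^sup>+\<zeta>. ennreal (k n \<zeta>) \<partial>\<rho>) \<le> ennreal (1 / (t - 1))" for n
    proof -
      have "(\<integral>\<^sup>+\<zeta>. ennreal (k n \<zeta>) \<partial>\<rho>) \<le> (\<integral>\<^sup>+\<zeta>. ennreal (T_kernel (X n) (\<theta> - Arg \<zeta>)) \<partial>\<rho>)"
        using kT by (intro nn_integral_mono ennreal_leI) (simp add: space_rho)
      also have "\<dots> = ennreal (\<integral>\<zeta>. T_kernel (X n) (\<theta> - Arg \<zeta>) \<partial>\<rho>)"
        by (rule T_nn_integral[OF X01])
      also have "\<dots> \<le> ennreal (1 / (t - 1))"
      proof (rule ennreal_leI)
        have "X n < R_fun \<rho> t \<theta>" using X01[of n] \<open>\<not> _\<close> by linarith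
        from below_R[OF X01(1) this] show "(\<integral>\<zeta>. T_kernel (X n) (\<theta> - Arg \<zeta>) \<partial>\<rho>) \<le> 1 / (t - 1)"
          using T_integral_less_iff[OF X01, of n \<theta>] by simp
      qed
      finally show ?thesis .
    qed
    have lim: "(\<lambda>n. ennreal (k n \<zeta>)) \<longlonglongrightarrow> 1 / ennreal (1 - cos (\<theta> - Arg \<zeta>))" if z: "norm \<zeta> = 1" for \<zeta>
    proof (cases "\<zeta> = ?e")
      \<comment> \<open>At the pole the minorant is \<open>2 * r / (1 - r)\<^sup>2\<close>, which
        tends to infinity and so agrees with the value \<open>1 / 0\<close> in the integrand of
        g.\<close>
      case True
      have "norm (\<zeta> - of_real (X n) * ?e) = 1 - X n" for n
      proof -
        have "\<zeta> - of_real (X n) * ?e = of_real (1 - X n) * ?e" using True by (simp add: algebra_simps)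
        then show ?thesis using X01[of n] by (simp only: norm_mult norm_of_real) simp
      qed
      then have "k n \<zeta> = 2 * X n / (1 - X n)\<^sup>2" for n by (simp add: k_def)
      moreover have "filterlim (\<lambda>n. 2 * X n / (1 - X n)\<^sup>2) at_top sequentially"
        unfolding X_def by real_asymp
      ultimately have "(\<lambda>n. ennreal (k n \<zeta>)) \<longlonglongrightarrow> top" by (simp add: ennreal_tendsto_top_eq_at_top)
      then show ?thesis using one_minus_cos_Arg[OF z, of \<theta>] True by simp
    next
      case False
      have pos: "1 - cos (\<theta> - Arg \<zeta>) > 0"
        unfolding one_minus_cos_Arg[OF z] using False by simp
      have "(\<lambda>n. k n \<zeta>) \<longlonglongrightarrow> 2 * 1 / (norm (\<zeta> - of_real 1 * ?e))\<^sup>2"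
        unfolding k_def using False by (intro tendsto_intros X) auto
      also have "2 * 1 / (norm (\<zeta> - of_real 1 * ?e))\<^sup>2 = 1 / (1 - cos (\<theta> - Arg \<zeta>))"
        unfolding one_minus_cos_Arg[OF z] by simp
      finally have "(\<lambda>n. ennreal (k n \<zeta>)) \<longlonglongrightarrow> ennreal (1 / (1 - cos (\<theta> - Arg \<zeta>)))" by (rule tendsto_ennrealI)
      then show ?thesis using divide_ennreal[of 1 "1 - cos (\<theta> - Arg \<zeta>)"] pos by simp
    qed
    have "g_fun \<rho> \<theta> = (\<integral>\<^sup>+\<zeta>. liminf (\<lambda>n. ennreal (k n \<zeta>)) \<partial>\<rho>)"
      unfolding g_fun_def
    proof (rule nn_integral_cong)
      fix \<zeta> assume "\<zeta> \<in> space \<rho>"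
      then have "norm \<zeta> = 1" by (simp add: space_rho)
      from lim_imp_Liminf[OF _ lim[OF this]]
      show "1 / ennreal (1 - cos (\<theta> - Arg \<zeta>)) = liminf (\<lambda>n. ennreal (k n \<zeta>))" by simp
    qed
    also have "\<dots> \<le> liminf (\<lambda>n. \<integral>\<^sup>+\<zeta>. ennreal (k n \<zeta>) \<partial>\<rho>)"
      by (rule nn_integral_liminf) (rule km)
    also have "\<dots> \<le> liminf (\<lambda>n. ennreal (1 / (t - 1)))"
      by (rule Liminf_mono) (simp add: le)
    also have "\<dots> = ennreal (1 / (t - 1))" by (simp add: Liminf_const)
    finally show False using g by simp
  qed
qed

lemma V_plus_iff: "\<theta> \<in> V_plus \<rho> t \<longleftrightarrow> \<theta> \<in> {-pi..pi} \<and> R_fun \<rho> t \<theta> < 1"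
  by (simp add: V_plus_def g_fun_gt_iff)

end

section \<open>Boundary values along the subordination function\<close>

locale herglotz_subordination = herglotz_power +
  fixes \<omega> :: "complex \<Rightarrow> complex"
  assumes subordination: "subordination u t \<omega>"
begin

lemma omega_continuous: "continuous_on (cball 0 1) \<omega>"
  and omega_cball: "norm z \<le> 1 \<Longrightarrow> norm (\<omega> z) \<le> 1"
  and omega_holomorphic: "\<omega> holomorphic_on ball 0 1"
  and omega_ball: "norm z < 1 \<Longrightarrow> norm (\<omega> z) < 1"
  and Phi_omega_ball: "norm z < 1 \<Longrightarrow> Phi u t (\<omega> z) = z"
  using subordination analytic_imp_holomorphic unfolding subordination_def
  by (auto simp: image_subset_iff)

lemma omega_Omega: "norm z < 1 \<Longrightarrow> \<omega> z \<in> Omega u t"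
  using omega_ball Phi_omega_ball by (simp add: Omega_def)

text \<open>The map \<omega> is uniformly continuous on the compact disc and sends the open disc
  into \<open>Omega\<close>, where u is Lipschitz. A uniformly continuous function extends to the
  closure.\<close>

lemma ex_u_omega_extension: "\<exists>v. continuous_on (cball 0 1) v \<and> (\<forall>z \<in> ball 0 1. v z = u (\<omega> z))"
proof -
  obtain L where L: "L \<ge> 0 \<and> (\<forall>w1 \<in> Omega u t. \<forall>w2 \<in> Omega u t. norm (u w1 - u w2) \<le> L * norm (w1 - w2))"
    using u_Lipschitz ..
  have "uniformly_continuous_on (cball 0 1) \<omega>"
    by (rule compact_uniformly_continuous[OF omega_continuous compact_cball])
  then have "uniformly_continuous_on (ball 0 1) \<omega>"
    unfolding uniformly_continuous_on_def by (meson ball_subset_cball subsetD)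
  moreover have "uniformly_continuous_on (\<omega> ` ball 0 1) u"
  proof (rule lipschitz_on_uniformly_continuous)
    show "L-lipschitz_on (\<omega> ` ball 0 1) u"
      using L omega_Omega by (intro lipschitz_onI) (auto simp: dist_norm)
  qed
  ultimately have "uniformly_continuous_on (ball 0 1) (\<lambda>z. u (\<omega> z))"
    by (rule uniformly_continuous_on_compose[unfolded o_def])
  then obtain v where "uniformly_continuous_on (closure (ball 0 1)) v" "\<And>z. z \<in> ball 0 1 \<Longrightarrow> u (\<omega> z) = v z"
    by (rule uniformly_continuous_on_extension_on_closure) (rule that)
  then show ?thesis by (intro exI[of _ v]) (auto intro: uniformly_continuous_imp_continuous)
qed

definition u_omega :: "complex \<Rightarrow> complex" where
  "u_omega = (SOME v. continuous_on (cball 0 1) v \<and> (\<forall>z \<in> ball 0 1. v z = u (\<omega> z)))"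

lemma u_omega_continuous: "continuous_on (cball 0 1) u_omega"
  and u_omega_ball: "norm z < 1 \<Longrightarrow> u_omega z = u (\<omega> z)"
  using someI_ex[OF ex_u_omega_extension, folded u_omega_def] by auto

text \<open>The equation \<open>Phi u t (\<omega> z) = z\<close> in a form that survives on the
  circle, where \<omega> may take values outside the domain of control for
  \<open>Phi\<close>.\<close>

lemma omega_exp_u_omega:
  assumes "norm z \<le> 1"
  shows "\<omega> z * exp (of_real (t - 1) * u_omega z) = z"
proof -
  have "\<omega> z * exp (of_real (t - 1) * u_omega z) - z = 0"
  proof (rule continuous_constant_on_closure[of "ball 0 1" "\<lambda>z. \<omega> z * exp (of_real (t - 1) * u_omega z) - z"])
    show "continuous_on (closure (ball 0 1)) (\<lambda>z. \<omega> z * exp (of_real (t - 1) * u_omega z) - z)"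
      by (simp, intro continuous_intros omega_continuous u_omega_continuous)
    show "\<omega> z * exp (of_real (t - 1) * u_omega z) - z = 0" if "z \<in> ball 0 1" for z
      using that Phi_omega_ball[of z] u_omega_ball[of z] by (simp add: Phi_def)
  qed (use assms in simp)
  then show ?thesis by simp
qed

lemma Re_u_omega_nonneg:
  assumes "norm z \<le> 1"
  shows "Re (u_omega z) \<ge> 0"
proof (rule continuous_ge_on_closure[of "ball 0 1" "\<lambda>z. Re (u_omega z)"])
  show "continuous_on (closure (ball 0 1)) (\<lambda>z. Re (u_omega z))"
    by (simp, intro continuous_intros u_omega_continuous)
  show "Re (u_omega z) \<ge> 0" if "z \<in> ball 0 1" for z
    using that u_omega_ball[of z] Re_u[of "\<omega> z"] inv_sq_int_nonneg[of "\<omega> z"] omega_ball[of z]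
      one_minus_norm_power2_pos[of "\<omega> z"] by simp
qed (use assms in simp)

lemma norm_omega_circle:
  assumes "norm z = 1"
  shows "norm (\<omega> z) = exp (- (t - 1) * Re (u_omega z))"
proof -
  have "norm (\<omega> z) * exp ((t - 1) * Re (u_omega z)) = 1"
    using arg_cong[OF omega_exp_u_omega[of z], of norm] assms by (simp add: norm_mult)
  then show ?thesis by (simp add: exp_minus inverse_eq_divide eq_divide_eq del: minus_diff_eq) 
qed

lemma u_omega_interior:
  assumes "norm z \<le> 1" "norm (\<omega> z) < 1"
  shows "u_omega z = u (\<omega> z)"
proof (rule LIMSEQ_unique)
  define X where "X n = complex_of_real (1 - 1 / (real n + 2)) * z" for n
  have "(\<lambda>n. 1 - 1 / (real n + 2)) \<longlonglongrightarrow> 1" by real_asymp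
  then have "X \<longlonglongrightarrow> complex_of_real 1 * z" unfolding X_def by (intro tendsto_intros)
  then have lim: "X \<longlonglongrightarrow> z" by simp
  have Xb: "norm (X n) < 1" for n
  proof -
    have "norm (X n) = (1 - 1 / (real n + 2)) * norm z" unfolding X_def norm_mult norm_of_real by (simp add: field_simps)
    also have "\<dots> \<le> (1 - 1 / (real n + 2)) * 1" using assms by (intro mult_left_mono) (auto simp: field_simps)
    also have "\<dots> < 1" by simp
    finally show ?thesis .
  qed
  then have Xc: "norm (X n) \<le> 1" for n by (simp add: less_imp_le)
  show "(\<lambda>n. u_omega (X n)) \<longlonglongrightarrow> u_omega z"
    using assms Xc by (intro continuous_on_tendsto_compose[OF u_omega_continuous lim]) auto
  have "(\<lambda>n. \<omega> (X n)) \<longlonglongrightarrow> \<omega> z"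
    using assms Xc by (intro continuous_on_tendsto_compose[OF omega_continuous lim]) auto
  then have "(\<lambda>n. u (\<omega> (X n))) \<longlonglongrightarrow> u (\<omega> z)"
    using assms Xb omega_ball
    by (intro continuous_on_tendsto_compose[OF holomorphic_on_imp_continuous_on[OF u_holomorphic]]) auto
  then show "(\<lambda>n. u_omega (X n)) \<longlonglongrightarrow> u (\<omega> z)" by (simp add: u_omega_ball Xb)
qed

lemma Phi_omega:
  assumes "norm z \<le> 1" "norm (\<omega> z) < 1"
  shows "Phi u t (\<omega> z) = z"
  using omega_exp_u_omega[OF assms(1)] u_omega_interior[OF assms] by (simp add: Phi_def)

text \<open>The Lipschitz inequality between \<open>u_omega\<close> and \<omega> passes to the
  closure of the product of two discs. Equal values of \<omega> then force equal values of
  \<open>u_omega\<close>, and \<open>omega_exp_u_omega\<close> recovers z from both.\<close>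

lemma omega_inj: "inj_on \<omega> (cball 0 1)"
proof (rule inj_onI)
  obtain L where L: "L \<ge> 0 \<and> (\<forall>w1 \<in> Omega u t. \<forall>w2 \<in> Omega u t. norm (u w1 - u w2) \<le> L * norm (w1 - w2))"
    using u_Lipschitz ..
  fix z1 z2 assume z: "z1 \<in> cball 0 1" "z2 \<in> cball 0 1" "\<omega> z1 = \<omega> z2"
  let ?F = "\<lambda>p. L * norm (\<omega> (fst p) - \<omega> (snd p)) - norm (u_omega (fst p) - u_omega (snd p))"
  have "?F (z1, z2) \<ge> 0"
  proof (rule continuous_ge_on_closure[of "ball 0 1 \<times> ball 0 1" ?F])
    show "continuous_on (closure (ball 0 1 \<times> ball 0 1)) ?F"
      unfolding closure_Times
      by (simp, intro continuous_intros continuous_on_compose2[OF omega_continuous] continuous_on_compose2[OF u_omega_continuous]) auto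
    show "(z1, z2) \<in> closure (ball 0 1 \<times> ball 0 1)" using z by (simp add: closure_Times)
    show "?F p \<ge> 0" if "p \<in> ball 0 1 \<times> ball 0 1" for p
      using that L omega_Omega by (auto simp: u_omega_ball)
  qed
  then have "u_omega z1 = u_omega z2" using z by simp
  then show "z1 = z2" using omega_exp_u_omega z by (metis mem_cball_0)
qed

end

section \<open>The direction of the subordination function as a coordinate on the circle\<close>

context herglotz_subordination
begin

lemma omega_nonzero:
  assumes "norm z \<le> 1" "z \<noteq> 0"
  shows "\<omega> z \<noteq> 0"
  using omega_exp_u_omega[OF assms(1)] assms(2) by auto

lemma omega_nonzero_circle: "norm z = 1 \<Longrightarrow> \<omega> z \<noteq> 0"
  by (rule omega_nonzero) auto

lemma Omega_scale:
  assumes "w \<in> Omega u t" "0 \<le> s" "s \<le> 1"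
  shows "of_real s * w \<in> Omega u t"
proof (cases "s = 0 \<or> s = 1 \<or> w = 0")
  case True
  then show ?thesis using assms by (auto simp: Omega_def Phi_def)
next
  case False
  have w: "norm w < 1" "norm (Phi u t w) < 1" using assms by (auto simp: Omega_def)
  have 1: "of_real (norm w) * sgn w = w" by (simp add: sgn_eq)
  have 2: "of_real (s * norm w) * sgn w = of_real s * w"
    unfolding of_real_mult mult.assoc 1 ..
  have "norm (Phi u t (of_real (s * norm w) * sgn w)) < 1"
    using False assms w 1
    by (intro Phi_starlike[of "sgn w" "s * norm w" "norm w"]) (auto simp: norm_sgn)
  moreover have "norm (of_real s * w) < 1"
    using assms w mult_left_le_one_le[of "norm w" s] by (simp add: norm_mult)
  ultimately show ?thesis unfolding 2 by (simp add: Omega_def)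
qed

lemma connected_Omega: "connected (Omega u t)"
proof (rule starlike_imp_connected)
  show "starlike (Omega u t)"
    unfolding starlike_def
  proof (intro bexI ballI subsetI)
    show "0 \<in> Omega u t" by (simp add: Omega_def Phi_def)
    fix w x assume "w \<in> Omega u t" "x \<in> closed_segment 0 w"
    then show "x \<in> Omega u t"
      using Omega_scale by (auto simp: closed_segment_def scaleR_conv_of_real)
  qed
qed

text \<open>The image of the open disc under \<omega> is open by injectivity, and it is also the
  relatively closed set of points of \<open>Omega\<close> that satisfy the claim.
  \<open>Omega\<close> is connected.\<close>

lemma omega_Phi_Omega:
  assumes "w \<in> Omega u t"
  shows "\<omega> (Phi u t w) = w"
proof -
  let ?Y = "\<omega> ` ball 0 1"
  have Y: "?Y = {w \<in> Omega u t. \<omega> (Phi u t w) - w = 0}"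
  proof safe
    fix z :: complex assume "z \<in> ball 0 1"
    then show "\<omega> z \<in> Omega u t" "\<omega> (Phi u t (\<omega> z)) - \<omega> z = 0"
      using omega_Omega Phi_omega_ball by auto
  next
    fix w assume "w \<in> Omega u t" "\<omega> (Phi u t w) - w = 0"
    then show "w \<in> ?Y" by (intro image_eqI[of _ _ "Phi u t w"]) (auto simp: Omega_def)
  qed
  have "open ?Y"
    by (intro open_mapping_thm3[OF omega_holomorphic] inj_on_subset[OF omega_inj]) auto
  then have "openin (top_of_set (Omega u t)) ?Y"
    using Y by (intro open_subset) auto
  moreover have "closedin (top_of_set (Omega u t)) ?Y"
    unfolding Y
    by (intro continuous_closedin_preimage_constant continuous_intros
        continuous_on_compose2[OF omega_continuous]
        continuous_on_subset[OF holomorphic_on_imp_continuous_on[OF Phi_holomorphic]])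
       (auto simp: Omega_def)
  ultimately have "?Y = {} \<or> ?Y = Omega u t"
    using connected_Omega unfolding connected_clopen by blast
  then have "?Y = Omega u t" by simp
  then have "w \<in> ?Y" using assms by (simp only:)
  then obtain z where z: "norm z < 1" "w = \<omega> z" by auto
  then show ?thesis by (simp add: Phi_omega_ball)
qed

text \<open>By starlikeness the points \<open>s * w\<close> with s below 1 lie in
  \<open>Omega\<close>; continuity gives the limit as s tends to 1.\<close>

lemma omega_Phi:
  assumes "norm w < 1" "norm (Phi u t w) = 1"
  shows "\<omega> (Phi u t w) = w"
proof (rule LIMSEQ_unique)
  define s :: "nat \<Rightarrow> real" where "s n = 1 - 1 / (real n + 2)" for n
  have "s \<longlonglongrightarrow> 1" unfolding s_def by real_asymp
  have s: "0 < s n" "s n < 1" for n by (auto simp: s_def field_simps)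
  have "w \<noteq> 0" using assms by (auto simp: Phi_def)
  have 1: "of_real (norm w) * sgn w = w" by (simp add: sgn_eq)
  have 2: "of_real (s n * norm w) * sgn w = of_real (s n) * w" for n
    unfolding of_real_mult mult.assoc 1 ..
  have sw: "of_real (s n) * w \<in> Omega u t" for n
  proof -
    have "norm (Phi u t (of_real (s n * norm w) * sgn w)) < 1"
      using assms s[of n] \<open>w \<noteq> 0\<close> 1
      by (intro Phi_starlike[of "sgn w" "s n * norm w" "norm w"]) (auto simp: norm_sgn)
    moreover have "norm (of_real (s n) * w) < 1"
      using assms s[of n] mult_left_le_one_le[of "norm w" "s n"] by (simp add: norm_mult)
    ultimately show ?thesis unfolding 2 by (simp add: Omega_def)
  qed
  have "(\<lambda>n. of_real (s n) * w) \<longlonglongrightarrow> of_real 1 * w" by (intro tendsto_intros \<open>s \<longlonglongrightarrow> 1\<close>)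
  then have l: "(\<lambda>n. of_real (s n) * w) \<longlonglongrightarrow> w" by simp
  then show "(\<lambda>n. \<omega> (Phi u t (of_real (s n) * w))) \<longlonglongrightarrow> w" by (simp add: omega_Phi_Omega sw)
  have "(\<lambda>n. Phi u t (of_real (s n) * w)) \<longlonglongrightarrow> Phi u t w"
    using sw assms
    by (intro continuous_on_tendsto_compose[OF holomorphic_on_imp_continuous_on[OF Phi_holomorphic] l])
       (auto simp: Omega_def)
  then show "(\<lambda>n. \<omega> (Phi u t (of_real (s n) * w))) \<longlonglongrightarrow> \<omega> (Phi u t w)"
    using sw assms by (intro continuous_on_tendsto_compose[OF omega_continuous])
      (auto simp: Omega_def less_imp_le)
qed

definition inner_circle :: "complex set" where
  "inner_circle = {z \<in> sphere 0 1. norm (\<omega> z) < 1}"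

text \<open>Inverts \<open>h_fun\<close> over \<open>V_plus\<close>. Defined through \<omega>, it is
  available on the whole circle without boundary values of \<open>Phi\<close>.\<close>

definition omega_dir :: "complex \<Rightarrow> complex" where
  "omega_dir z = sgn (\<omega> z)"

text \<open>Since \<open>Phi u t (\<omega> z) = z\<close> has modulus 1, the ray through
  \<open>\<omega> z\<close> crosses level 1 exactly at that point.\<close>

lemma R_cis_inner_circle:
  assumes "z \<in> inner_circle" "cis \<theta> = omega_dir z"
  shows "R_fun \<rho> t \<theta> = norm (\<omega> z)" "of_real (R_fun \<rho> t \<theta>) * cis \<theta> = \<omega> z"
proof -
  have z: "norm z = 1" "norm (\<omega> z) < 1" using assms by (auto simp: inner_circle_def)
  then have "\<omega> z \<noteq> 0" by (intro omega_nonzero_circle) auto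
  have 1: "of_real (norm (\<omega> z)) * cis \<theta> = \<omega> z" using assms(2) by (simp add: omega_dir_def sgn_eq)
  show R: "R_fun \<rho> t \<theta> = norm (\<omega> z)"
    using z \<open>\<omega> z \<noteq> 0\<close> Phi_omega[of z] by (intro R_eqI) (auto simp: 1)
  then show "of_real (R_fun \<rho> t \<theta>) * cis \<theta> = \<omega> z" using 1 by simp
qed

text \<open>Over \<open>V_plus\<close> the boundary point has modulus below 1, so
  \<open>ext_closure\<close> is plain evaluation of \<open>Phi\<close> and \<open>omega_Phi\<close>
  applies.\<close>

lemma h_fun_V_plus:
  assumes "\<theta> \<in> V_plus \<rho> t"
  shows "h_fun u \<rho> t \<theta> \<in> inner_circle" "\<omega> (h_fun u \<rho> t \<theta>) = of_real (R_fun \<rho> t \<theta>) * cis \<theta>"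
    "omega_dir (h_fun u \<rho> t \<theta>) = cis \<theta>"
proof -
  have R: "0 < R_fun \<rho> t \<theta>" "R_fun \<rho> t \<theta> < 1" using assms R_pos by (auto simp: V_plus_iff)
  let ?w = "of_real (R_fun \<rho> t \<theta>) * cis \<theta> :: complex"
  have w: "norm ?w < 1" using R by (simp add: norm_mult)
  have h: "h_fun u \<rho> t \<theta> = Phi u t ?w" using w by (simp add: h_fun_def ext_closure_def)
  have "norm (Phi u t ?w) = 1" using R by (intro norm_Phi_R)
  then show o: "\<omega> (h_fun u \<rho> t \<theta>) = ?w" unfolding h by (intro omega_Phi w)
  show "h_fun u \<rho> t \<theta> \<in> inner_circle"
    using \<open>norm (Phi u t ?w) = 1\<close> w o by (simp add: inner_circle_def h)
  show "omega_dir (h_fun u \<rho> t \<theta>) = cis \<theta>"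
    using R unfolding omega_dir_def o by (simp add: sgn_mult sgn_eq norm_mult)
qed

lemma inner_circle_eq: "inner_circle = h_fun u \<rho> t ` V_plus \<rho> t"
proof safe
  fix z assume z: "z \<in> inner_circle"
  then have z': "norm z = 1" "norm (\<omega> z) < 1" "\<omega> z \<noteq> 0"
    using omega_nonzero_circle[of z] by (auto simp: inner_circle_def)
  let ?\<theta> = "Arg (\<omega> z)"
  have c: "cis ?\<theta> = omega_dir z" unfolding omega_dir_def using z' by (intro cis_Arg)
  note R = R_cis_inner_circle[OF z c]
  have "?\<theta> \<in> V_plus \<rho> t"
    using Arg_bounded[of "\<omega> z"] z' R by (auto simp: V_plus_iff)
  moreover have "h_fun u \<rho> t ?\<theta> = z"
    using Phi_omega[of z] z' R(2) by (simp add: h_fun_def ext_closure_def)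
  ultimately show "z \<in> h_fun u \<rho> t ` V_plus \<rho> t" by (intro image_eqI) auto
qed (rule h_fun_V_plus)

lemma S_set_eq: "S_set u \<rho> t = cnj ` inner_circle"
  unfolding S_set_def inner_circle_eq by auto

lemma omega_dir_image: "omega_dir ` inner_circle = cis ` V_plus \<rho> t"
  unfolding inner_circle_eq using h_fun_V_plus(3) by (force simp: image_image)

lemma omega_dir_continuous: "continuous_on (sphere 0 1) omega_dir"
  unfolding omega_dir_def sgn_eq
  using omega_nonzero_circle by (intro continuous_intros continuous_on_subset[OF omega_continuous]) auto

lemma norm_omega_dir: "norm z = 1 \<Longrightarrow> norm (omega_dir z) = 1"
  using omega_nonzero_circle[of z] by (auto simp: omega_dir_def norm_sgn)

text \<open>Limit of \<open>s * \<omega> (X n)\<close> along a radius ending at z; all these points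
  lie in \<open>Omega\<close>. Only the weak inequality survives, and starlikeness restores
  strictness at smaller radii.\<close>

lemma Phi_radial_le:
  assumes z: "norm z = 1" "norm (\<omega> z) = 1" and s: "0 < s" "s < 1"
  shows "norm (Phi u t (of_real s * \<omega> z)) \<le> 1"
proof -
  define X where "X n = complex_of_real (1 - 1 / (real n + 2)) * z" for n
  have "(\<lambda>n. 1 - 1 / (real n + 2)) \<longlonglongrightarrow> 1" by real_asymp
  then have "X \<longlonglongrightarrow> complex_of_real 1 * z" unfolding X_def by (intro tendsto_intros)
  then have lim: "X \<longlonglongrightarrow> z" by simp
  have Xb: "norm (X n) < 1" for n
    unfolding X_def norm_mult norm_of_real using z by (simp add: field_simps)
  have sX: "of_real s * \<omega> (X n) \<in> Omega u t" for n
    using s Xb by (intro Omega_scale omega_Omega) auto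
  have "(\<lambda>n. \<omega> (X n)) \<longlonglongrightarrow> \<omega> z"
    using z Xb by (intro continuous_on_tendsto_compose[OF omega_continuous lim]) (auto simp: less_imp_le)
  then have "(\<lambda>n. of_real s * \<omega> (X n)) \<longlonglongrightarrow> of_real s * \<omega> z" by (intro tendsto_intros)
  then have "(\<lambda>n. Phi u t (of_real s * \<omega> (X n))) \<longlonglongrightarrow> Phi u t (of_real s * \<omega> z)"
    using sX z s
    by (intro continuous_on_tendsto_compose[OF holomorphic_on_imp_continuous_on[OF Phi_holomorphic]])
       (auto simp: Omega_def norm_mult)
  then have "(\<lambda>n. norm (Phi u t (of_real s * \<omega> (X n)))) \<longlonglongrightarrow> norm (Phi u t (of_real s * \<omega> z))"
    by (rule tendsto_norm)
  then show ?thesis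
    by (rule tendsto_upperbound) (use sX in \<open>auto simp: Omega_def less_imp_le\<close>)
qed

text \<open>Otherwise \<open>\<omega> z2\<close> would lie on a full radius along which
  \<open>Phi\<close> has modulus at most 1. Starlikeness then makes the modulus at
  \<open>\<omega> z2\<close> less than 1, although \<open>Phi u t (\<omega> z2) = z2\<close> is on
  the circle.\<close>

lemma omega_dir_separates:
  assumes z: "norm z1 = 1" "norm z2 = 1" "omega_dir z1 = omega_dir z2" "norm (\<omega> z2) < 1"
  shows "\<not> norm (\<omega> z1) = 1"
proof
  assume 1: "norm (\<omega> z1) = 1"
  define r where "r = norm (\<omega> z2)"
  have r: "0 < r" "r < 1" using z omega_nonzero_circle[of z2] by (auto simp: r_def)
  have w: "of_real r * \<omega> z1 = \<omega> z2" using z(3) 1 by (simp add: omega_dir_def sgn_eq r_def)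
  define s where "s = (r + 1) / 2"
  have s: "r < s" "s < 1" "0 < s" using r by (auto simp: s_def)
  have "norm (Phi u t (of_real r * \<omega> z1)) < 1"
    using r s 1 z by (intro Phi_starlike[of _ r s] Phi_radial_le)
  then show False unfolding w using Phi_omega[of z2] z by simp
qed

lemma omega_polar: "\<omega> z = of_real (norm (\<omega> z)) * omega_dir z"
  by (simp add: omega_dir_def sgn_eq)

lemma omega_dir_inj: "inj_on omega_dir (sphere 0 1)"
proof (rule inj_onI)
  fix z1 z2 assume "z1 \<in> sphere 0 1" "z2 \<in> sphere 0 1" and omega_dir: "omega_dir z1 = omega_dir z2"
  then have z: "norm z1 = 1" "norm z2 = 1" by auto
  have "norm (\<omega> z1) = norm (\<omega> z2)"
  proof (cases "norm (\<omega> z1) < 1 \<and> norm (\<omega> z2) < 1")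
    case True
    then have "z1 \<in> inner_circle" "z2 \<in> inner_circle" using z by (auto simp: inner_circle_def)
    moreover have c: "cis (Arg (\<omega> z1)) = omega_dir z1" unfolding omega_dir_def using z omega_nonzero_circle[of z1] by (intro cis_Arg) auto
    ultimately show ?thesis using R_cis_inner_circle(1)[of z1 "Arg (\<omega> z1)"] R_cis_inner_circle(1)[of z2 "Arg (\<omega> z1)"] omega_dir by simp
  next
    case False
    then show ?thesis
      using omega_dir_separates[of z1 z2] omega_dir_separates[of z2 z1] z omega_dir omega_cball[of z1] omega_cball[of z2] by fastforce
  qed
  then have "\<omega> z1 = \<omega> z2"
    using omega_polar[of z1] omega_polar[of z2] omega_dir by simp
  then show "z1 = z2" using inj_onD[OF omega_inj] z by simp
qed

text \<open>A direction with \<open>R_fun\<close> below 1 is reached by \<open>h_fun\<close>. On any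
  other ray the preimages of \<open>s n * e\<close> under \<omega> accumulate at some l with
  \<open>\<omega> l = e\<close>, and l lies on the circle because \<omega> maps the open disc into
  itself.\<close>

lemma omega_dir_surj: "omega_dir ` sphere 0 1 = sphere 0 1"
proof safe
  fix z :: complex assume "z \<in> sphere 0 1"
  then show "omega_dir z \<in> sphere 0 1" using norm_omega_dir by simp
next
  fix e :: complex assume "e \<in> sphere 0 1"
  then have e: "norm e = 1" by simp
  define \<theta> where "\<theta> = Arg e"
  have c: "cis \<theta> = e" unfolding \<theta>_def by (rule cis_Arg_circle[OF e])
  show "e \<in> omega_dir ` sphere 0 1"
  proof (cases "R_fun \<rho> t \<theta> < 1")
    case True
    then have "\<theta> \<in> V_plus \<rho> t" using Arg_bounded[of e] by (auto simp: V_plus_iff \<theta>_def)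
    from h_fun_V_plus[OF this] show ?thesis by (intro image_eqI[of _ _ "h_fun u \<rho> t \<theta>"]) (auto simp: c inner_circle_def)
  next
    case False
    define s :: "nat \<Rightarrow> real" where "s n = 1 - 1 / (real n + 2)" for n
    have "s \<longlonglongrightarrow> 1" unfolding s_def by real_asymp
    have s: "0 < s n" "s n < 1" for n by (auto simp: s_def field_simps)
    define z where "z n = Phi u t (of_real (s n) * e)" for n
    have sO: "of_real (s n) * e \<in> Omega u t" for n
      using below_R[of "s n" \<theta>] s[of n] False e by (simp add: Omega_def c norm_mult)
    then have zb: "norm (z n) < 1" for n by (simp add: z_def Omega_def)
    have oz: "\<omega> (z n) = of_real (s n) * e" for n unfolding z_def by (rule omega_Phi_Omega[OF sO])
    obtain l r where l: "l \<in> cball 0 1" "strict_mono r" "(z \<circ> r) \<longlonglongrightarrow> l"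
      using compact_cball[of "0::complex" 1, unfolded compact_def, rule_format, of z] zb by (auto simp: less_imp_le)
    have "(\<lambda>n. \<omega> ((z \<circ> r) n)) \<longlonglongrightarrow> \<omega> l"
      using zb l by (intro continuous_on_tendsto_compose[OF omega_continuous l(3)]) (auto simp: less_imp_le)
    moreover have "(\<lambda>n. \<omega> ((z \<circ> r) n)) \<longlonglongrightarrow> e"
    proof -
      have "(\<lambda>n. of_real ((s \<circ> r) n) * e) \<longlonglongrightarrow> of_real 1 * e"
        by (intro tendsto_intros LIMSEQ_subseq_LIMSEQ[OF \<open>s \<longlonglongrightarrow> 1\<close> l(2)])
      then show ?thesis by (simp add: oz o_def)
    qed
    ultimately have "\<omega> l = e" by (rule LIMSEQ_unique)
    then have "\<not> norm l < 1" using omega_ball[of l] e by auto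
    then have "norm l = 1" using l by simp
    moreover have "omega_dir l = e" using \<open>\<omega> l = e\<close> e by (simp add: omega_dir_def sgn_eq)
    ultimately show ?thesis by force
  qed
qed

end

subsection \<open>The density of the absolutely continuous part\<close>

text \<open>The nonnegative functions \<open>ln 2 - ln (norm (1 - F z))\<close> have the same mean
  over every circle. Fatou's lemma bounds the integral of their lower radial limit, which is
  infinite wherever \<open>F = 1\<close>.\<close>

lemma null_boundary_level_set:
  assumes hol: "F holomorphic_on ball 0 1" and cont: "continuous_on (cball 0 1) F"
    and lt1: "\<And>z. norm z < 1 \<Longrightarrow> norm (F z) < 1"
  shows "{\<zeta> \<in> sphere 0 1. F \<zeta> = 1} \<in> null_sets arc_length"
proof -
  define E where "E = {\<zeta> \<in> sphere 0 1. F \<zeta> = 1}"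
  have E: "E \<in> sets arc_length"
  proof -
    have "closed E"
      unfolding E_def using continuous_closed_preimage_constant[OF continuous_on_subset[OF cont], of "sphere 0 1" 1] by auto
    then show ?thesis by (auto simp: sets_circle_borel_iff E_def)
  qed
  define G where "G z = Ln (1 - F z)" for z
  have Fne: "1 - F z \<notin> \<real>\<^sub>\<le>\<^sub>0" if "norm z < 1" for z
  proof -
    have "Re (F z) < 1" using lt1[OF that] complex_Re_le_cmod[of "F z"] by linarith
    then show ?thesis by (simp add: complex_nonpos_Reals_iff)
  qed
  have G: "G holomorphic_on ball 0 1"
    unfolding G_def using Fne by (intro holomorphic_intros hol) auto
  have ReG: "Re (G z) = ln (norm (1 - F z))" if "norm z < 1" for z
    unfolding G_def using Fne[OF that] by (intro Re_Ln) auto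
  define X where "X n = 1 - 1 / (real n + 2)" for n
  have X: "X \<longlonglongrightarrow> 1" unfolding X_def by real_asymp
  have X01: "0 \<le> X n" "X n < 1" for n by (auto simp: X_def field_simps)
  have Xb: "norm (of_real (X n) * \<zeta>) < 1" if "norm \<zeta> = 1" for n and \<zeta> :: complex
    using that X01[of n] by (simp add: norm_mult)
  \<comment> \<open>The shift by \<open>ln 2\<close> makes the functions nonnegative, since
    \<open>norm (1 - F z) \<le> 2\<close>.\<close>
  define g where "g n \<zeta> = ln 2 - Re (G (of_real (X n) * \<zeta>))" for n \<zeta>
  have g0: "g n \<zeta> \<ge> 0" if "norm \<zeta> = 1" for n \<zeta>
  proof -
    let ?z = "of_real (X n) * \<zeta>"
    have "1 - F ?z \<noteq> 0" using Fne[OF Xb[OF that, of n]] by auto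
    moreover have "norm (1 - F ?z) \<le> 2" using norm_triangle_ineq4[of 1 "F ?z"] lt1[OF Xb[OF that, of n]] by simp
    ultimately show ?thesis unfolding g_def ReG[OF Xb[OF that]] by (simp add: ln_mono)
  qed
  have GX: "continuous_on (sphere 0 1) (\<lambda>\<zeta>. G (of_real (X n) * \<zeta>))" for n
    using Xb by (intro continuous_intros continuous_on_compose2[OF holomorphic_on_imp_continuous_on[OF G]]) auto
  have gint: "integrable arc_length (g n)" and gval: "(\<integral>\<zeta>. g n \<zeta> \<partial>arc_length) = 2 * pi * (ln 2 - Re (G 0))" for n
  proof -
    obtain B where B: "\<And>\<zeta>. \<zeta> \<in> sphere 0 1 \<Longrightarrow> norm (G (of_real (X n) * \<zeta>)) \<le> B"
      using continuous_on_compact_bound[OF compact_sphere GX] by blast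
    have m: "(\<lambda>\<zeta>. G (of_real (X n) * \<zeta>)) \<in> borel_measurable arc_length"
      unfolding arc_length_def circle_borel_def measurable_distr_eq1
      by (rule borel_measurable_continuous_on_restrict[OF GX])
    have i: "integrable arc_length (\<lambda>\<zeta>. G (of_real (X n) * \<zeta>))"
      by (rule integrable_finite_bounded[OF arc_length.finite_measure_axioms m, of B]) (use B in simp)
    then show "integrable arc_length (g n)" unfolding g_def by auto
    have "(\<integral>\<zeta>. Re (G (of_real (X n) * \<zeta>)) \<partial>arc_length) = 2 * pi * Re (G 0)"
      using integral_Re[OF i] mean_value_circle[OF G X01, of n] by simp
    then show "(\<integral>\<zeta>. g n \<zeta> \<partial>arc_length) = 2 * pi * (ln 2 - Re (G 0))"
      unfolding g_def using i by (simp add: measure_arc_length algebra_simps)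
  qed
  have gm: "(\<lambda>\<zeta>. ennreal (g n \<zeta>)) \<in> borel_measurable arc_length" for n
    using gint[of n] by measurable
  have "(\<integral>\<^sup>+\<zeta>. liminf (\<lambda>n. ennreal (g n \<zeta>)) \<partial>arc_length) \<le> liminf (\<lambda>n. \<integral>\<^sup>+\<zeta>. ennreal (g n \<zeta>) \<partial>arc_length)"
    by (rule nn_integral_liminf) (rule gm)
  also have "(\<lambda>n. \<integral>\<^sup>+\<zeta>. ennreal (g n \<zeta>) \<partial>arc_length) = (\<lambda>n. ennreal (2 * pi * (ln 2 - Re (G 0))))"
  proof
    fix n
    have "(\<integral>\<^sup>+\<zeta>. ennreal (g n \<zeta>) \<partial>arc_length) = ennreal (\<integral>\<zeta>. g n \<zeta> \<partial>arc_length)"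
      by (rule nn_integral_eq_integral[OF gint]) (use g0 in auto)
    then show "(\<integral>\<^sup>+\<zeta>. ennreal (g n \<zeta>) \<partial>arc_length) = ennreal (2 * pi * (ln 2 - Re (G 0)))" by (simp only: gval)
  qed
  also have "liminf (\<lambda>n. ennreal (2 * pi * (ln 2 - Re (G 0)))) < \<infinity>" by (simp add: Liminf_const)
  finally have "AE \<zeta> in arc_length. liminf (\<lambda>n. ennreal (g n \<zeta>)) \<noteq> \<infinity>"
    using gm by (intro nn_integral_PInf_AE borel_measurable_liminf) auto
  moreover have "liminf (\<lambda>n. ennreal (g n \<zeta>)) = \<infinity>" if "\<zeta> \<in> E" for \<zeta>
  proof -
    have z: "norm \<zeta> = 1" "F \<zeta> = 1" using that by (auto simp: E_def)
    have "(\<lambda>n. of_real (X n) * \<zeta>) \<longlonglongrightarrow> of_real 1 * \<zeta>" by (intro tendsto_intros X)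
    then have l: "(\<lambda>n. of_real (X n) * \<zeta>) \<longlonglongrightarrow> \<zeta>" by simp
    have "(\<lambda>n. F (of_real (X n) * \<zeta>)) \<longlonglongrightarrow> F \<zeta>"
      using z Xb by (intro continuous_on_tendsto_compose[OF cont l]) (auto simp: less_imp_le)
    then have "(\<lambda>n. norm (1 - F (of_real (X n) * \<zeta>))) \<longlonglongrightarrow> norm (1 - F \<zeta>)" by (intro tendsto_intros)
    then have "(\<lambda>n. norm (1 - F (of_real (X n) * \<zeta>))) \<longlonglongrightarrow> 0" using z by simp
    moreover have "0 < norm (1 - F (of_real (X n) * \<zeta>))" for n
      using Fne[OF Xb[OF z(1), of n]] by auto
    ultimately have "filterlim (\<lambda>n. norm (1 - F (of_real (X n) * \<zeta>))) (at_right 0) sequentially"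
      by (simp add: filterlim_at)
    then have "filterlim (\<lambda>n. ln (norm (1 - F (of_real (X n) * \<zeta>)))) at_bot sequentially"
      by (rule filterlim_compose[OF ln_at_0])
    then have "filterlim (\<lambda>n. - ln (norm (1 - F (of_real (X n) * \<zeta>)))) at_top sequentially"
      by (simp add: filterlim_uminus_at_bot)
    then have "filterlim (\<lambda>n. ln 2 + - ln (norm (1 - F (of_real (X n) * \<zeta>)))) at_top sequentially"
      by (rule filterlim_tendsto_add_at_top[OF tendsto_const])
    then have "filterlim (\<lambda>n. g n \<zeta>) at_top sequentially"
      unfolding g_def ReG[OF Xb[OF z(1)]] by simp
    then have "(\<lambda>n. ennreal (g n \<zeta>)) \<longlonglongrightarrow> top" by (simp add: ennreal_tendsto_top_eq_at_top)
    then show ?thesis by (simp add: lim_imp_Liminf)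
  qed
  ultimately have "AE \<zeta> in arc_length. \<zeta> \<notin> E" by (elim AE_mp) (auto intro!: AE_I2)
  then show ?thesis using E unfolding E_def[symmetric] by (simp add: AE_iff_null_sets)
qed

lemma Re_Cayley:
  assumes "x \<noteq> 1"
  shows "Re ((1 + x) / (1 - x)) = (1 - (norm x)\<^sup>2) / (norm (1 - x))\<^sup>2"
proof -
  have "Re (1 + x) * Re (1 - x) + Im (1 + x) * Im (1 - x) = 1 - (norm x)\<^sup>2"
    unfolding cmod_power2 by (simp add: power2_eq_square algebra_simps)
  then show ?thesis by (simp add: Re_divide cmod_power2)
qed

section \<open>The Poisson integral of the power measure and its Lebesgue decomposition\<close>

locale herglotz_convolution_power = herglotz_subordination +
  fixes \<nu> :: "complex measure"
  assumes prob_nu: "prob_space \<nu>"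
    and sets_nu: "sets \<nu> = sets circle_borel"
    and eta_nu: "\<And>z. norm z < 1 \<Longrightarrow> eta \<nu> z = \<omega> z * exp (- u (\<omega> z))"
begin

lemma space_nu: "space \<nu> = sphere 0 1"
  using sets_eq_imp_space_eq[OF sets_nu] by simp

lemma finite_nu: "finite_measure \<nu>"
  using prob_nu by (simp add: prob_space_def)

definition eta_bdry :: "complex \<Rightarrow> complex" where
  "eta_bdry z = \<omega> z * exp (- u_omega z)"

lemma eta_bdry_continuous: "continuous_on (cball 0 1) eta_bdry"
  unfolding eta_bdry_def by (intro continuous_intros omega_continuous u_omega_continuous)

lemma eta_bdry_ball: "norm z < 1 \<Longrightarrow> eta_bdry z = eta \<nu> z"
  by (simp add: eta_bdry_def eta_nu u_omega_ball)

lemma eta_bdry_holomorphic: "eta_bdry holomorphic_on ball 0 1"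
proof -
  have "(\<lambda>z. \<omega> z * exp (- u (\<omega> z))) holomorphic_on ball 0 1"
    using omega_ball
    by (intro holomorphic_intros omega_holomorphic holomorphic_on_compose_gen[OF omega_holomorphic u_holomorphic, unfolded o_def]) auto
  then show ?thesis
    by (rule holomorphic_transform) (simp add: eta_bdry_def u_omega_ball)
qed

lemma norm_eta_bdry_le:
  assumes "norm z \<le> 1"
  shows "norm (eta_bdry z) \<le> norm (\<omega> z)"
  using Re_u_omega_nonneg[OF assms] by (simp add: eta_bdry_def norm_mult mult_left_le)

text \<open>On the circle the moduli of \<omega> and \<open>eta_bdry\<close> are
  \<open>exp (- (t - 1) * Re (u_omega z))\<close> and \<open>exp (- t * Re (u_omega z))\<close>.
  Both are below 1 exactly when the real part is positive.\<close>

lemma norm_eta_bdry_circle: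
  assumes "norm z = 1"
  shows "norm (eta_bdry z) < 1 \<longleftrightarrow> norm (\<omega> z) < 1" "norm (eta_bdry z) \<le> 1"
proof -
  show "norm (eta_bdry z) \<le> 1" using norm_eta_bdry_le[of z] omega_cball[of z] assms by simp
  have "norm (eta_bdry z) = exp (- (t - 1) * Re (u_omega z)) * exp (- Re (u_omega z))"
    by (simp add: eta_bdry_def norm_mult norm_omega_circle[OF assms])
  then have "norm (eta_bdry z) < 1 \<longleftrightarrow> Re (u_omega z) \<noteq> 0"
    using Re_u_omega_nonneg[of z] assms t by (auto simp: exp_add[symmetric] mult_less_0_iff algebra_simps zero_less_mult_iff)
  moreover have "norm (\<omega> z) < 1 \<longleftrightarrow> Re (u_omega z) \<noteq> 0"
    using Re_u_omega_nonneg[of z] assms t by (auto simp: norm_omega_circle[OF assms] mult_less_0_iff)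
  ultimately show "norm (eta_bdry z) < 1 \<longleftrightarrow> norm (\<omega> z) < 1" by simp
qed

lemma norm_eta_bdry_ball: "norm z < 1 \<Longrightarrow> norm (eta_bdry z) < 1"
  using norm_eta_bdry_le[of z] omega_ball[of z] by simp

text \<open>Both sides are the real part of \<open>1 + 2 * psi \<nu> z\<close>, which is the Cayley
  transform of \<eta>. The conjugate appears because \<open>psi\<close> has the denominator
  \<open>1 - z * s\<close>, of modulus \<open>norm (s - cnj z)\<close> on the circle.\<close>

lemma poisson_integral_nu:
  assumes z: "norm z < 1"
  shows "(\<integral>\<zeta>. (1 - (norm z)\<^sup>2) / (norm (\<zeta> - cnj z))\<^sup>2 \<partial>\<nu>) = (1 - (norm (eta_bdry z))\<^sup>2) / (norm (1 - eta_bdry z))\<^sup>2"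
proof -
  interpret prob_space \<nu> by (rule prob_nu)
  have ne: "1 - z * s \<noteq> 0" "norm (z * s) < 1" "1 - norm z \<le> norm (1 - z * s)" if "norm s = 1" for s
  proof -
    show 1: "norm (z * s) < 1" using z that by (simp add: norm_mult)
    then show "1 - z * s \<noteq> 0" by auto
    show "1 - norm z \<le> norm (1 - z * s)" using norm_triangle_ineq2[of 1 "z * s"] that by (simp add: norm_mult)
  qed
  have i: "integrable \<nu> (\<lambda>s. z * s / (1 - z * s))"
  proof (rule integrable_finite_bounded[OF finite_nu])
    show "(\<lambda>s. z * s / (1 - z * s)) \<in> borel_measurable \<nu>"
      by (simp add: measurable_cong_sets[OF sets_nu refl] borel_measurable_circle_borel)
    fix s assume "s \<in> space \<nu>"
    then have s: "norm s = 1" by (simp add: space_nu)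
    show "norm (z * s / (1 - z * s)) \<le> 1 / (1 - norm z)"
      unfolding norm_divide using ne[OF s] z by (intro frac_le) auto
  qed
  have psi: "1 + 2 * psi \<nu> z = (\<integral>s. 1 + 2 * (z * s / (1 - z * s)) \<partial>\<nu>)"
  proof -
    have "(\<integral>s. 1 + 2 * (z * s / (1 - z * s)) \<partial>\<nu>) = (\<integral>s. 1 \<partial>\<nu>) + (\<integral>s. 2 * (z * s / (1 - z * s)) \<partial>\<nu>)"
      by (rule Bochner_Integration.integral_add[OF _ integrable_mult_right[OF i]]) simp
    also have "\<dots> = 1 + 2 * psi \<nu> z"
      unfolding psi_def integral_mult_right_zero by (simp add: prob_space)
    finally show ?thesis ..
  qed
  have Re_psi: "Re (1 + 2 * psi \<nu> z) = (\<integral>\<zeta>. (1 - (norm z)\<^sup>2) / (norm (\<zeta> - cnj z))\<^sup>2 \<partial>\<nu>)"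
  proof -
    have "Re (1 + 2 * psi \<nu> z) = (\<integral>s. Re (1 + 2 * (z * s / (1 - z * s))) \<partial>\<nu>)"
      unfolding psi
      by (rule integral_Re[symmetric, OF Bochner_Integration.integrable_add[OF _ integrable_mult_right[OF i]]]) simp
    also have "\<dots> = (\<integral>s. (1 - (norm z)\<^sup>2) / (norm (s - cnj z))\<^sup>2 \<partial>\<nu>)"
    proof (rule Bochner_Integration.integral_cong[OF refl])
      fix s assume "s \<in> space \<nu>"
      then have s: "norm s = 1" by (simp add: space_nu)
      have "1 + 2 * (z * s / (1 - z * s)) = (1 + z * s) / (1 - z * s)"
        using ne[OF s] by (simp add: divide_simps)
      moreover have "norm (1 - z * s) = norm (s - cnj z)"
      proof -
        have "1 - z * s = s * cnj (s - cnj z)"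
          using s complex_norm_square[of s] by (simp add: algebra_simps)
        then show ?thesis using s by (simp only: norm_mult complex_mod_cnj)
      qed
      moreover have "norm (z * s) = norm z" using s by (simp add: norm_mult)
      ultimately show "Re (1 + 2 * (z * s / (1 - z * s))) = (1 - (norm z)\<^sup>2) / (norm (s - cnj z))\<^sup>2"
        using Re_Cayley[of "z * s"] ne[OF s] by simp
    qed
    finally show ?thesis .
  qed
  also have "\<dots> \<ge> 0"
    using one_minus_norm_power2_pos[OF z] by (intro integral_nonneg_AE) (auto intro!: divide_nonneg_nonneg)
  \<comment> \<open>Positivity of the Poisson integral excludes \<open>psi \<nu> z = - 1\<close>, so
    the quotient defining \<open>eta\<close> is a true division.\<close>
  finally have "Re (psi \<nu> z) \<ge> - 1 / 2" by simp
  then have ne1: "1 + psi \<nu> z \<noteq> 0" by (auto simp: complex_eq_iff)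
  have e: "eta_bdry z = psi \<nu> z / (1 + psi \<nu> z)" using z by (simp add: eta_bdry_ball eta_def)
  have "1 - eta_bdry z = 1 / (1 + psi \<nu> z)" "1 + eta_bdry z = (1 + 2 * psi \<nu> z) / (1 + psi \<nu> z)"
    unfolding e using ne1 by (simp_all add: field_simps)
  then have "(1 + eta_bdry z) / (1 - eta_bdry z) = 1 + 2 * psi \<nu> z" using ne1 by simp
  moreover have "eta_bdry z \<noteq> 1" using norm_eta_bdry_ball[OF z] by auto
  ultimately show ?thesis using Re_psi Re_Cayley[of "eta_bdry z"] by simp
qed

definition poisson_density :: "complex \<Rightarrow> real" where
  "poisson_density z = (1 - (norm (eta_bdry (cnj z)))\<^sup>2) / (norm (1 - eta_bdry (cnj z)))\<^sup>2"

definition eta_one :: "complex set" where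
  "eta_one = {\<zeta> \<in> sphere 0 1. eta_bdry (cnj \<zeta>) = 1}"

lemma closed_eta_one: "closed eta_one"
proof -
  have "continuous_on (sphere 0 1) (\<lambda>\<zeta>. eta_bdry (cnj \<zeta>))"
    by (intro continuous_intros continuous_on_compose2[OF eta_bdry_continuous]) auto
  then have "closed {\<zeta> \<in> sphere 0 1. eta_bdry (cnj \<zeta>) = 1}"
    by (rule continuous_closed_preimage_constant) simp
  then show ?thesis by (simp add: eta_one_def)
qed

text \<open>Conjugating the values as well as the argument restores holomorphy, and the level 1 is
  real, so the level set is unchanged.\<close>

lemma null_eta_one: "eta_one \<in> null_sets arc_length"
proof -
  let ?F = "\<lambda>z. cnj (eta_bdry (cnj z))"
  have "(cnj \<circ> eta_bdry \<circ> cnj) holomorphic_on ball 0 1"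
  proof (rule holomorphic_on_compose_cnj_cnj)
    show "eta_bdry holomorphic_on cnj ` ball 0 1"
      by (rule holomorphic_on_subset[OF eta_bdry_holomorphic]) auto
  qed simp
  then have "?F holomorphic_on ball 0 1" by (simp add: o_def)
  moreover have "continuous_on (cball 0 1) ?F"
    by (intro continuous_intros continuous_on_compose2[OF eta_bdry_continuous]) auto
  ultimately have "{\<zeta> \<in> sphere 0 1. ?F \<zeta> = 1} \<in> null_sets arc_length"
    by (rule null_boundary_level_set) (simp add: norm_eta_bdry_ball)
  then show ?thesis by (simp add: eta_one_def)
qed

lemma poisson_density_nonneg: "norm s = 1 \<Longrightarrow> 0 \<le> poisson_density s"
  unfolding poisson_density_def using norm_eta_bdry_circle(2)[of "cnj s"] by (intro divide_nonneg_nonneg) (auto simp: power_le_one)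

text \<open>The quotient is \<open>0 / 0\<close>, whose default value 0 is the one that
  \<open>poisson_integral_recovers_measure\<close> requires on the excluded set.\<close>

lemma poisson_density_eta_one: "s \<in> eta_one \<Longrightarrow> poisson_density s = 0"
  by (simp add: poisson_density_def eta_one_def)

lemma poisson_density_continuous: "continuous_on (cball 0 1 - eta_one) poisson_density"
proof -
  have "continuous_on (cball 0 1) (\<lambda>\<zeta>. eta_bdry (cnj \<zeta>))"
    by (intro continuous_intros continuous_on_compose2[OF eta_bdry_continuous]) auto
  then have 1: "continuous_on (cball 0 1 - eta_one) (\<lambda>\<zeta>. eta_bdry (cnj \<zeta>))" by (rule continuous_on_subset) auto
  have "1 - eta_bdry (cnj z) \<noteq> 0" if "z \<in> cball 0 1 - eta_one" for z
  proof (cases "norm z = 1")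
    case True
    then show ?thesis using that by (auto simp: eta_one_def)
  next
    case False
    then have "norm (eta_bdry (cnj z)) < 1" using that by (intro norm_eta_bdry_ball) auto
    then show ?thesis by auto
  qed
  then show ?thesis unfolding poisson_density_def by (intro continuous_intros 1) auto
qed

lemma poisson_integral_eq_density:
  assumes "norm z < 1"
  shows "(\<integral>\<zeta>. (1 - (norm z)\<^sup>2) / (norm (\<zeta> - z))\<^sup>2 \<partial>\<nu>) = poisson_density z"
  using poisson_integral_nu[of "cnj z"] assms by (simp add: poisson_density_def)

lemma eta_one_subset: "eta_one \<subseteq> sphere 0 1" by (auto simp: eta_one_def)

lemmas nu_recovered = poisson_integral_recovers_measure[OF finite_nu sets_nu closed_eta_one eta_one_subset
    poisson_density_continuous poisson_density_nonneg poisson_density_eta_one poisson_integral_eq_density]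

text \<open>Set to 0 off the circle, so that nonnegativity holds on the whole plane.\<close>

definition ac_density :: "complex \<Rightarrow> real" where
  "ac_density s = (if norm s = 1 then poisson_density s / (2 * pi) else 0)"

lemma ac_density_nonneg: "ac_density s \<ge> 0"
  using poisson_density_nonneg by (simp add: ac_density_def)

lemma ac_density_measurable: "ac_density \<in> borel_measurable arc_length"
proof -
  have "(\<lambda>s. poisson_density s / (2 * pi)) \<in> borel_measurable circle_borel"
    using nu_recovered(1)[of "{}"] by simp
  then have "ac_density \<in> borel_measurable circle_borel"
    by (rule measurable_cong[THEN iffD1, rotated]) (simp add: ac_density_def)
  then show ?thesis by (simp add: measurable_cong_sets[OF sets_arc_length refl])
qed

lemma emeasure_ac_density:
  assumes "A \<in> sets circle_borel"
  shows "emeasure (density arc_length (\<lambda>s. ennreal (ac_density s))) A = emeasure \<nu> (A - eta_one)"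
proof -
  have "emeasure (density arc_length (\<lambda>s. ennreal (ac_density s))) A = (\<integral>\<^sup>+s. ennreal (ac_density s) * indicator A s \<partial>arc_length)"
    using assms ac_density_measurable by (intro emeasure_density) auto
  also have "\<dots> = (\<integral>\<^sup>+s. ennreal (poisson_density s / (2 * pi)) * indicator A s \<partial>arc_length)"
    by (intro nn_integral_cong) (simp add: ac_density_def)
  also have "\<dots> = emeasure \<nu> (A - eta_one)" using assms by (intro nu_recovered(2)[symmetric]) auto
  finally show ?thesis .
qed

text \<open>The singular part is \<nu> restricted to \<open>eta_one\<close>, a null set for arc
  length. Uniqueness of the decomposition then evaluates the description in
  \<open>ac_part\<close>.\<close>

lemma ac_part_nu: "ac_part arc_length \<nu> = density arc_length (\<lambda>s. ennreal (ac_density s))"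
proof -
  let ?K = "density arc_length (\<lambda>s. ennreal (ac_density s))" and ?S = "density \<nu> (indicator eta_one)"
  have Cm: "eta_one \<in> sets \<nu>" using null_eta_one by (auto simp: sets_nu)
  have eS: "emeasure ?S A = emeasure \<nu> (A \<inter> eta_one)" if "A \<in> sets \<nu>" for A
    using that Cm by (subst emeasure_density)
      (auto simp: indicator_inter_arith[symmetric] Int_commute)
  have "is_ac_part arc_length \<nu> ?K"
    unfolding is_ac_part_def
  proof (intro conjI exI[of _ ?S] bexI[OF _ null_eta_one] ballI)
    show "absolutely_continuous arc_length ?K"
      using ac_density_measurable by (intro absolutely_continuousI_density) auto
    have "(space \<nu> - eta_one) \<inter> eta_one = {}" by auto
    then show "emeasure ?S (space \<nu> - eta_one) = 0" using eS[of "space \<nu> - eta_one"] Cm by auto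
    fix A assume A: "A \<in> sets \<nu>"
    have "emeasure \<nu> (A - eta_one) + emeasure \<nu> (A \<inter> eta_one) = emeasure \<nu> ((A - eta_one) \<union> (A \<inter> eta_one))"
      by (rule plus_emeasure) (use A Cm in auto)
    also have "(A - eta_one) \<union> (A \<inter> eta_one) = A" by auto
    finally show "emeasure \<nu> A = emeasure ?K A + emeasure ?S A"
      using eS[OF A] emeasure_ac_density[of A] A sets_nu by simp
  qed (simp_all add: sets_nu)
  moreover have "\<exists>!K. is_ac_part arc_length \<nu> K"
    by (rule ex1_ac_part[OF finite_nu]) (simp add: sets_nu)
  ultimately show ?thesis unfolding ac_part_def by (intro the1_equality)
qed

end

section \<open>Support, explicit formula and analyticity of the density\<close>

context herglotz_convolution_power
begin

lemma S_set_iff: "s \<in> S_set u \<rho> t \<longleftrightarrow> norm s = 1 \<and> norm (\<omega> (cnj s)) < 1"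
  unfolding S_set_eq image_cnj_conv_vimage_cnj inner_circle_def by auto

lemma ac_density_eq: "norm s = 1 \<Longrightarrow> ac_density s = (1 - (norm (eta_bdry (cnj s)))\<^sup>2) / (norm (1 - eta_bdry (cnj s)))\<^sup>2 / (2 * pi)"
  by (simp add: ac_density_def poisson_density_def)

lemma ac_density_pos_iff: "0 < ac_density s \<longleftrightarrow> s \<in> S_set u \<rho> t"
proof (cases "norm s = 1")
  case True
  then have c: "norm (cnj s) = 1" by simp
  show ?thesis
  proof (cases "norm (eta_bdry (cnj s)) < 1")
    case lt: True
    then have "1 - eta_bdry (cnj s) \<noteq> 0" by auto
    then have "0 < ac_density s"
      using one_minus_norm_power2_pos[OF lt] unfolding ac_density_eq[OF True]
      by (intro divide_pos_pos) auto
    then show ?thesis using lt norm_eta_bdry_circle(1)[OF c] True by (simp add: S_set_iff)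
  next
    case False
    then have "norm (eta_bdry (cnj s)) = 1" using norm_eta_bdry_circle(2)[OF c] by simp
    then have "ac_density s = 0" unfolding ac_density_eq[OF True] by simp
    then show ?thesis using False norm_eta_bdry_circle(1)[OF c] by (simp add: S_set_iff)
  qed
qed (simp_all add: ac_density_def S_set_iff)

lemma ac_density_outside: "s \<notin> S_set u \<rho> t \<Longrightarrow> ac_density s = 0"
  using ac_density_nonneg[of s] ac_density_pos_iff[of s] by simp

lemma ac_part_concentrated:
  "emeasure (ac_part arc_length \<nu>) (sphere 0 1 - closure (S_set u \<rho> t)) = 0"
proof -
  let ?A = "sphere 0 1 - closure (S_set u \<rho> t)"
  have A: "?A \<in> sets circle_borel" by (simp add: sets_circle_borel_iff)
  have "emeasure (ac_part arc_length \<nu>) ?A = (\<integral>\<^sup>+s. ennreal (ac_density s) * indicator ?A s \<partial>arc_length)"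
    unfolding ac_part_nu using ac_density_measurable A by (intro emeasure_density) auto
  also have "\<dots> = (\<integral>\<^sup>+s. 0 \<partial>arc_length)"
  proof (rule nn_integral_cong)
    fix s show "ennreal (ac_density s) * indicator ?A s = 0"
      using ac_density_outside[of s] closure_subset[of "S_set u \<rho> t"] by (cases "s \<in> S_set u \<rho> t") auto
  qed
  finally show ?thesis by simp
qed

text \<open>The density is positive exactly on \<open>S_set\<close>, at every point and not just
  almost everywhere. \<open>S_set\<close> is open in the circle, so a neighbourhood of a point of
  its closure contains an open piece of positive length on which the density is positive.\<close>

lemma closed_support_ac_part:
  "closed_support (ac_part arc_length \<nu>) = closure (S_set u \<rho> t)"
proof (intro set_eqI iffI)
  have sp: "space (ac_part arc_length \<nu>) = sphere 0 1" by (simp add: ac_part_nu)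
  {
    fix s assume "s \<in> closed_support (ac_part arc_length \<nu>)"
    then have s: "norm s = 1" "\<And>U. open U \<Longrightarrow> s \<in> U \<Longrightarrow> emeasure (ac_part arc_length \<nu>) (U \<inter> sphere 0 1) \<noteq> 0"
      by (auto simp: closed_support_def sp)
    show "s \<in> closure (S_set u \<rho> t)"
    proof (rule ccontr)
      assume "s \<notin> closure (S_set u \<rho> t)"
      then have "emeasure (ac_part arc_length \<nu>) (- closure (S_set u \<rho> t) \<inter> sphere 0 1) \<noteq> 0"
        by (intro s) auto
      moreover have "- closure (S_set u \<rho> t) \<inter> sphere 0 1 = sphere 0 1 - closure (S_set u \<rho> t)" by auto
      ultimately show False using ac_part_concentrated by simp
    qed
  }
  fix s assume s: "s \<in> closure (S_set u \<rho> t)"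
  have "S_set u \<rho> t \<subseteq> sphere 0 1" by (auto simp: S_set_iff)
  then have "closure (S_set u \<rho> t) \<subseteq> sphere 0 1" by (rule closure_minimal) simp
  then have "s \<in> sphere 0 1" using s by auto
  moreover have "emeasure (ac_part arc_length \<nu>) (U \<inter> sphere 0 1) \<noteq> 0" if U: "open U" "s \<in> U" for U
  proof
    assume 0: "emeasure (ac_part arc_length \<nu>) (U \<inter> sphere 0 1) = 0"
    obtain z where z: "z \<in> S_set u \<rho> t" "z \<in> U"
      using s U open_Int_closure_eq_empty[OF U(1), of "S_set u \<rho> t"] by auto
    \<comment> \<open>Relative openness of \<open>S_set\<close>, as the preimage of
      \<open>{..<1}\<close> under a continuous function.\<close>
    have "continuous_on (sphere 0 1) (\<lambda>s. norm (\<omega> (cnj s)))"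
      by (intro continuous_intros continuous_on_compose2[OF omega_continuous]) auto
    then have "openin (top_of_set (sphere 0 1)) (sphere 0 1 \<inter> (\<lambda>s. norm (\<omega> (cnj s))) -` {..<1})"
      by (rule continuous_openin_preimage_gen) simp
    then obtain W where W: "open W" "sphere 0 1 \<inter> (\<lambda>s. norm (\<omega> (cnj s))) -` {..<1} = sphere 0 1 \<inter> W"
      unfolding openin_open by blast
    have "S_set u \<rho> t = sphere 0 1 \<inter> (\<lambda>s. norm (\<omega> (cnj s))) -` {..<1}" by (auto simp: S_set_iff)
    with W(2) have WS: "W \<inter> sphere 0 1 = S_set u \<rho> t" by (simp only: Int_commute)
    let ?V = "(U \<inter> W) \<inter> sphere 0 1"
    have V: "?V \<in> sets circle_borel" using U W by (auto simp: sets_circle_borel_iff)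
    have "emeasure (ac_part arc_length \<nu>) ?V \<le> emeasure (ac_part arc_length \<nu>) (U \<inter> sphere 0 1)"
      using U by (intro emeasure_mono) (auto simp: ac_part_nu sets_circle_borel_iff)
    then have "emeasure (ac_part arc_length \<nu>) ?V = 0" using 0 by simp
    then have "(\<integral>\<^sup>+s. ennreal (ac_density s) * indicator ?V s \<partial>arc_length) = 0"
      unfolding ac_part_nu using ac_density_measurable V by (subst (asm) emeasure_density) auto
    then have "AE s in arc_length. ennreal (ac_density s) * indicator ?V s = 0"
      using ac_density_measurable V by (subst (asm) nn_integral_0_iff_AE) auto
    then have "AE s in arc_length. s \<notin> ?V"
    proof eventually_elim
      case (elim s)
      show "s \<notin> ?V"
      proof
        assume V: "s \<in> ?V"
        then have "0 < ac_density s" using WS ac_density_pos_iff[of s] by blast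
        then show False using elim V by simp
      qed
    qed
    then have "?V \<in> null_sets arc_length" using V by (subst AE_iff_null_sets) auto
    then have "emeasure arc_length ?V = 0" by (rule null_setsD1)
    moreover have "emeasure arc_length ?V > 0"
    proof (rule arc_length_pos)
      show "open (U \<inter> W)" using U W by auto
      show "z \<in> U \<inter> W" "norm z = 1" using z WS by auto
    qed
    ultimately show False by simp
  qed
  ultimately show "s \<in> closed_support (ac_part arc_length \<nu>)"
    by (simp add: closed_support_def sp)
qed

text \<open>At \<open>w = R * cis \<theta>\<close> the equation \<open>norm (Phi u t w) = 1\<close>
  gives \<open>Re (u w) = - ln R / (t - 1)\<close>. Hence the modulus
  \<open>R * exp (- Re (u w))\<close> of \<eta> is R to the power \<open>1 + 1 / (t - 1)\<close>,
  and the argument of \<eta> is \<open>\<theta> - Im (u w)\<close>.\<close>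

lemma density_formula:
  assumes "\<theta> \<in> V_plus \<rho> t"
  shows "ac_density (cnj (h_fun u \<rho> t \<theta>)) = 1 / (2 * pi) * ((1 - (l_fun \<rho> t \<theta>)\<^sup>2) /
     (1 - 2 * l_fun \<rho> t \<theta> * cos (alpha_fun u \<rho> t \<theta>) + (l_fun \<rho> t \<theta>)\<^sup>2))"
proof -
  let ?R = "R_fun \<rho> t \<theta>" and ?z = "h_fun u \<rho> t \<theta>" and ?l = "l_fun \<rho> t \<theta>" and ?\<alpha> = "alpha_fun u \<rho> t \<theta>"
  let ?w = "of_real ?R * cis \<theta> :: complex"
  have R: "0 < ?R" "?R < 1" using assms R_pos by (auto simp: V_plus_iff)
  then have w: "norm ?w < 1" "norm ?w = ?R" "?w \<noteq> 0" by (auto simp: norm_mult)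
  have z: "norm ?z = 1" "\<omega> ?z = ?w" using h_fun_V_plus[OF assms] by (auto simp: inner_circle_def)
  have vz: "u_omega ?z = u ?w" using u_omega_interior[of ?z] z w by simp
  have "ln (norm (Phi u t ?w)) = 0" using norm_Phi_R R by simp
  then have lnR: "(t - 1) * Re (u ?w) = - ln ?R" using w by (simp add: ln_norm_Phi)
  have "?l = exp (t / (t - 1) * ln ?R)" using R by (simp add: l_fun_def powr_def)
  also have "t / (t - 1) * ln ?R = ln ?R - Re (u ?w)"
  proof -
    have "a = b / (t - 1)" if "(t - 1) * a = b" for a b using that t by auto
    from this[OF lnR] have "Re (u ?w) = - ln ?R / (t - 1)" .
    moreover have "t / (t - 1) = 1 + 1 / (t - 1)" using t by (simp add: divide_simps)
    ultimately show ?thesis by (simp add: algebra_simps)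
  qed
  also have "exp \<dots> = ?R * exp (- Re (u ?w))" using R by (simp add: exp_diff exp_minus divide_inverse)
  finally have l: "?l = ?R * exp (- Re (u ?w))" .
  have \<alpha>: "?\<alpha> = \<theta> - Im (u ?w)" using w by (simp add: alpha_fun_def ext_closure_def)
  have "exp (- u ?w) = of_real (exp (- Re (u ?w))) * cis (- Im (u ?w))"
    by (simp add: exp_eq_polar)
  then have e: "eta_bdry ?z = of_real ?l * cis ?\<alpha>"
    unfolding eta_bdry_def vz z(2) l \<alpha> by (simp add: cis_mult[symmetric] diff_conv_add_uminus del: add_uminus_conv_diff)
  have "?l > 0" using l R by simp
  then have "norm (eta_bdry ?z) = ?l" unfolding e by (simp add: norm_mult)
  moreover have "(norm (1 - eta_bdry ?z))\<^sup>2 = 1 - 2 * ?l * cos ?\<alpha> + ?l\<^sup>2"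
    unfolding e using norm_circle_diff_square[of 1 "cis ?\<alpha>" ?l] by simp
  ultimately show ?thesis using ac_density_eq[of "cnj ?z"] z by simp
qed

text \<open>\<eta> is continued across the circle: near \<open>w0\<close>, a point inside the disc,
  \<open>Phi\<close> has a local holomorphic inverse g, and \<open>g * exp (- u g)\<close> is
  holomorphic around \<open>z0\<close> and equals \<open>eta_bdry\<close> on the circle. The density
  is then the real part of a holomorphic function of the complexified angle.\<close>

lemma circle_analytic_ac_density: "circle_analytic_on ac_density (S_set u \<rho> t)"
  unfolding circle_analytic_on_def
proof (intro allI impI)
  fix x :: real assume "cis x \<in> S_set u \<rho> t"
  then have z0: "norm (\<omega> (cis (-x))) < 1" by (simp add: S_set_iff cis_cnj)
  define z0 w0 where "z0 = cis (-x)" and "w0 = \<omega> z0"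
  have w0: "norm w0 < 1" "Phi u t w0 = z0"
    using z0 Phi_omega[of z0] by (auto simp: w0_def z0_def)
  then have "deriv (Phi u t) w0 \<noteq> 0" by (intro deriv_Phi_nonzero) (auto simp: z0_def)
  then obtain r where r: "r > 0" "ball w0 r \<subseteq> ball 0 1" "inj_on (Phi u t) (ball w0 r)"
    using has_complex_derivative_locally_injective[OF Phi_holomorphic _ open_ball, of w0] w0 by auto
  have holB: "Phi u t holomorphic_on ball w0 r" by (rule holomorphic_on_subset[OF Phi_holomorphic r(2)])
  define N where "N = Phi u t ` ball w0 r"
  have N: "open N" unfolding N_def by (rule open_mapping_thm3[OF holB open_ball r(3)])
  obtain g where g: "g holomorphic_on N" "\<And>w. w \<in> ball w0 r \<Longrightarrow> g (Phi u t w) = w"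
    using holomorphic_has_inverse[OF holB open_ball r(3)] unfolding N_def by metis
  have gN: "g ` N \<subseteq> ball 0 1" using g(2) r(2) by (auto simp: N_def)
  define E where "E z = g z * exp (- u (g z))" for z
  have E: "E holomorphic_on N"
    unfolding E_def
    by (intro holomorphic_intros g holomorphic_on_compose_gen[OF g(1) u_holomorphic gN, unfolded o_def])
  \<comment> \<open>Restricting to values of modulus below 1 keeps the denominator
    \<open>1 - E\<close> nonzero.\<close>
  define N' where "N' = N \<inter> E -` ball 0 1"
  have N': "open N'"
    unfolding N'_def by (rule continuous_open_preimage[OF holomorphic_on_imp_continuous_on[OF E] N open_ball])
  have Eeq: "E z = eta_bdry z" if "norm z = 1" "\<omega> z \<in> ball w0 r" for z
  proof -
    have "norm (\<omega> z) < 1" using that r(2) by auto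
    then have "Phi u t (\<omega> z) = z" "u_omega z = u (\<omega> z)" using that by (auto intro!: Phi_omega u_omega_interior)
    then show ?thesis using g(2)[OF that(2)] by (simp add: E_def eta_bdry_def)
  qed
  have z0N: "z0 \<in> N'"
  proof -
    have "z0 \<in> N" unfolding N_def using w0 r by (intro image_eqI[of _ _ w0]) auto
    moreover have "E z0 = eta_bdry z0" using r by (intro Eeq) (auto simp: w0_def z0_def)
    moreover have "norm (eta_bdry z0) < 1" using norm_eta_bdry_circle(1)[of z0] w0 by (simp add: w0_def z0_def)
    ultimately show ?thesis by (simp add: N'_def)
  qed
  \<comment> \<open>For real y, \<open>exp (- \<i> * y)\<close> is the conjugate of
    \<open>cis y\<close>, the point at which the density evaluates \<open>eta_bdry\<close>. For
    complex y it continues the arc length coordinate holomorphically.\<close>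
  define H where "H y = (1 + E (exp (- \<i> * y))) / (1 - E (exp (- \<i> * y))) / of_real (2 * pi)" for y
  define M where "M = (\<lambda>y. exp (- \<i> * y)) -` N'"
  have M: "open M" unfolding M_def by (intro open_vimage N') (auto intro!: continuous_intros)
  have expcis: "exp (- \<i> * of_real y) = cis (- y)" for y :: real by (simp add: cis_conv_exp)
  have "complex_of_real x \<in> M" using z0N by (simp add: M_def z0_def expcis[simplified])
  then obtain e1 where e1: "e1 > 0" "ball (complex_of_real x) e1 \<subseteq> M" using M open_contains_ball by blast
  have "E holomorphic_on N'" by (rule holomorphic_on_subset[OF E]) (auto simp: N'_def)
  then have EM: "(\<lambda>y. E (exp (- \<i> * y))) holomorphic_on ball (of_real x) e1"
    using e1(2) by (intro holomorphic_on_compose_gen[of "\<lambda>y. exp (- \<i> * y)" _ E N', unfolded o_def])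
      (auto intro!: holomorphic_intros simp: M_def)
  have E1: "norm (E (exp (- \<i> * y))) < 1" if "y \<in> ball (of_real x) e1" for y
    using e1(2) that by (auto simp: M_def N'_def)
  have Hhol: "H holomorphic_on ball (of_real x) e1"
    unfolding H_def using E1 by (intro holomorphic_intros EM) force+
  \<comment> \<open>The second radius keeps \<open>\<omega> (cis (- y))\<close> in the ball where
    the local inverse is valid, so that \<open>E\<close> and \<open>eta_bdry\<close> agree
    there.\<close>
  have "continuous_on UNIV (\<lambda>y::real. \<omega> (cis (- y)))"
    by (intro continuous_on_compose2[OF omega_continuous] continuous_intros) auto
  then have "open ((\<lambda>y::real. \<omega> (cis (- y))) -` ball w0 r)"
    by (intro open_vimage) auto
  moreover have "x \<in> (\<lambda>y::real. \<omega> (cis (- y))) -` ball w0 r" using r by (simp add: w0_def z0_def)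
  ultimately obtain e2 where e2: "e2 > 0" "ball x e2 \<subseteq> (\<lambda>y::real. \<omega> (cis (- y))) -` ball w0 r"
    using open_contains_ball by blast
  define a where "a n = Re ((deriv ^^ n) H (of_real x) / fact n)" for n
  have "(\<lambda>n. a n * (y - x) ^ n) sums ac_density (cis y)" if y: "\<bar>y - x\<bar> < min e1 e2" for y
  proof -
    have yb: "complex_of_real y \<in> ball (of_real x) e1"
      using y by (simp add: dist_norm norm_minus_commute abs_minus_commute flip: of_real_diff)
    have "(\<lambda>n. (deriv ^^ n) H (of_real x) / fact n * (of_real y - of_real x) ^ n) sums H (of_real y)"
      by (rule holomorphic_power_series[OF Hhol yb])
    from sums_Re[OF this]
    have "(\<lambda>n. Re ((deriv ^^ n) H (of_real x) / fact n * of_real ((y - x) ^ n))) sums Re (H (of_real y))"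
      by simp
    moreover have "Re (c * of_real s) = Re c * s" for c s by simp
    ultimately have "(\<lambda>n. a n * (y - x) ^ n) sums Re (H (of_real y))"
      unfolding a_def by (simp only:)
    moreover have "Re (H (of_real y)) = ac_density (cis y)"
    proof -
      have "y \<in> ball x e2" using y by (simp add: dist_real_def abs_minus_commute)
      then have Ey: "E (cis (- y)) = eta_bdry (cis (- y))" using e2(2) by (intro Eeq) auto
      have H: "H (of_real y) = (1 + eta_bdry (cis (-y))) / (1 - eta_bdry (cis (-y))) / of_real (2 * pi)"
        unfolding H_def expcis Ey by (rule refl)
      have ne: "eta_bdry (cis (- y)) \<noteq> 1" using E1[OF yb] unfolding expcis Ey by auto
      show ?thesis
        unfolding H Re_divide_of_real Re_Cayley[OF ne] ac_density_eq[OF norm_cis] cis_cnj ..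
    qed
    ultimately show ?thesis by simp
  qed
  then show "\<exists>\<epsilon>>0. \<exists>a. \<forall>y. \<bar>y - x\<bar> < \<epsilon> \<longrightarrow> (\<lambda>n. a n * (y - x) ^ n) sums ac_density (cis y)"
    using e1 e2 by (intro exI[of _ "min e1 e2"] conjI exI[of _ a]) auto
qed

end

subsection \<open>Monotonicity of the number of components\<close>

context herglotz
begin

lemma g_fun_eq: "g_fun \<rho> \<theta> = (\<integral>\<^sup>+\<zeta>. 1 / ennreal ((norm (\<zeta> - cis \<theta>))\<^sup>2 / 2) \<partial>\<rho>)"
  unfolding g_fun_def by (intro nn_integral_cong) (simp add: one_minus_cos_Arg space_rho)

text \<open>Frees the angle from \<open>{-pi..pi}\<close>, so that arcs through -1 can be handled as
  real intervals.\<close>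

lemma mem_cis_V_plus: "cis x \<in> cis ` V_plus \<rho> t \<longleftrightarrow> g_fun \<rho> x > ennreal (1 / (t - 1))"
proof
  assume "cis x \<in> cis ` V_plus \<rho> t"
  then show "g_fun \<rho> x > ennreal (1 / (t - 1))" by (auto simp: V_plus_def g_fun_eq)
next
  assume g: "g_fun \<rho> x > ennreal (1 / (t - 1))"
  have c: "cis (Arg (cis x)) = cis x" by (rule cis_Arg_circle) simp
  moreover have "Arg (cis x) \<in> V_plus \<rho> t"
    using g Arg_bounded[of "cis x"] by (auto simp: V_plus_def g_fun_eq c)
  ultimately show "cis x \<in> cis ` V_plus \<rho> t" by (metis image_eqI)
qed

lemma cis_arc_measurable: "cis ` {a..b} \<in> sets \<rho>"
proof -
  have "compact (cis ` {a..b})" by (intro compact_continuous_image continuous_intros) auto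
  then show ?thesis by (auto simp: sets_rho sets_circle_borel_iff compact_imp_closed)
qed

text \<open>Markov's inequality: on the arc the kernel of g at its midpoint is at least
  \<open>2 / d\<^sup>2\<close>, because \<open>1 - cos y \<le> y\<^sup>2 / 2\<close>.\<close>

lemma short_arc_bound:
  assumes "0 < d" "0 \<le> c" "g_fun \<rho> m \<le> ennreal c"
  shows "measure \<rho> (cis ` {m - d..m + d}) \<le> c * d\<^sup>2 / 2"
proof -
  interpret finite_measure \<rho> by (rule finite_rho)
  let ?J = "cis ` {m - d..m + d}"
  have "ennreal (2 / d\<^sup>2) * emeasure \<rho> ?J = (\<integral>\<^sup>+\<zeta>. ennreal (2 / d\<^sup>2) * indicator ?J \<zeta> \<partial>\<rho>)"
    using cis_arc_measurable by (simp add: nn_integral_cmult_indicator)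
  also have "\<dots> \<le> g_fun \<rho> m"
    unfolding g_fun_def
  proof (rule nn_integral_mono)
    fix \<zeta> assume "\<zeta> \<in> space \<rho>"
    then have z: "norm \<zeta> = 1" by (simp add: space_rho)
    show "ennreal (2 / d\<^sup>2) * indicator ?J \<zeta> \<le> 1 / ennreal (1 - cos (m - Arg \<zeta>))"
    proof (cases "\<zeta> \<in> ?J")
      case True
      then obtain y where "y \<in> {m - d..m + d}" "\<zeta> = cis y" by blast
      then have y: "\<bar>m - y\<bar> \<le> d" "\<zeta> = cis y" by auto
      have "cos (m - Arg \<zeta>) = cos (m - y)"
        unfolding cos_diff_Arg[OF z] unfolding y(2) by (simp add: cos_diff)
      moreover have "1 - cos (m - y) \<le> d\<^sup>2 / 2"
      proof -
        have "m - y = 2 * ((m - y) / 2)" by simp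
        then have "1 - cos (m - y) = 2 * (sin ((m - y) / 2))\<^sup>2"
          using cos_double_sin[of "(m - y) / 2"] by (simp only:)
        also have "(sin ((m - y) / 2))\<^sup>2 \<le> (\<bar>(m - y) / 2\<bar>)\<^sup>2"
          using abs_sin_x_le_abs_x[of "(m - y) / 2"] power_mono[of "\<bar>sin ((m - y) / 2)\<bar>" "\<bar>(m - y) / 2\<bar>" 2] by simp
        also have "(\<bar>(m - y) / 2\<bar>)\<^sup>2 \<le> (d / 2)\<^sup>2" using y assms by (intro power_mono) auto
        finally show ?thesis by (simp add: power_divide)
      qed
      ultimately have le: "1 - cos (m - Arg \<zeta>) \<le> d\<^sup>2 / 2" by simp
      have "ennreal (2 / d\<^sup>2) \<le> 1 / ennreal (1 - cos (m - Arg \<zeta>))"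
      proof (cases "cos (m - Arg \<zeta>) = 1")
        case False
        then have pos: "0 < 1 - cos (m - Arg \<zeta>)" using cos_le_one[of "m - Arg \<zeta>"] by linarith
        have "2 / d\<^sup>2 = 1 / (d\<^sup>2 / 2)" by simp
        also have "\<dots> \<le> 1 / (1 - cos (m - Arg \<zeta>))" using le pos by (intro frac_le) auto
        finally show ?thesis
          using divide_ennreal[of 1 "1 - cos (m - Arg \<zeta>)"] pos by (simp add: ennreal_leI)
      qed simp
      then show ?thesis using True by simp
    qed simp
  qed
  also have "\<dots> \<le> ennreal c" by (rule assms)
  finally have "ennreal (2 / d\<^sup>2 * measure \<rho> ?J) \<le> ennreal c"
    by (simp add: emeasure_eq_measure ennreal_mult del: times_divide_eq_left)
  then have "2 / d\<^sup>2 * measure \<rho> ?J \<le> c" using assms by simp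
  then show ?thesis using assms by (simp add: field_simps)
qed

text \<open>Covering the arc by \<open>n\<close> arcs of length \<open>(b - a) / n\<close>, each of mass \<open>O(n\<^sup>-\<^sup>2)\<close>.\<close>

lemma null_arc:
  assumes "a < b" "0 \<le> c" "\<And>x. a < x \<Longrightarrow> x < b \<Longrightarrow> g_fun \<rho> x \<le> ennreal c"
  shows "emeasure \<rho> (cis ` {a..b}) = 0"
proof -
  interpret finite_measure \<rho> by (rule finite_rho)
  \<comment> \<open>The half-width is \<open>d = (b - a) / (2 * n)\<close>, so n arcs of mass at
    most \<open>c * d\<^sup>2 / 2\<close> add up to \<open>c * (b - a)\<^sup>2 / (8 * n)\<close>.
    Taking \<open>n = Suc N\<close> avoids a zero denominator.\<close>
  have bound: "measure \<rho> (cis ` {a..b}) \<le> c * (b - a)\<^sup>2 / 8 / real (Suc N)" for N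
  proof -
    define n where "n = Suc N"
    define d where "d = (b - a) / (2 * real n)"
    have n: "real n > 0" by (simp add: n_def)
    have d: "0 < d" "2 * d * real n = b - a" using assms n by (auto simp: d_def)
    define m where "m i = a + (2 * real i + 1) * d" for i
    have cover: "{a..b} \<subseteq> (\<Union>i<n. {m i - d..m i + d})"
    proof
      fix x assume x: "x \<in> {a..b}"
      show "x \<in> (\<Union>i<n. {m i - d..m i + d})"
      \<comment> \<open>At the right end the floor would give the index n, one past the last
        arc.\<close>
      proof (cases "x = b")
        case True
        have "m N + d = b" using d by (simp add: m_def n_def algebra_simps)
        then show ?thesis using True d by (auto simp: n_def intro!: bexI[of _ N])
      next
        case False
        define i where "i = nat \<lfloor>(x - a) / (2 * d)\<rfloor>"
        have q: "0 \<le> (x - a) / (2 * d)" "(x - a) / (2 * d) < real n"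
          using x False d by (auto simp: field_simps)
        have i: "real i \<le> (x - a) / (2 * d)" "(x - a) / (2 * d) < real i + 1"
          using q by (auto simp: i_def)
        then have "i < n" using q by linarith
        moreover have "x \<in> {m i - d..m i + d}"
          using i d by (auto simp: m_def field_simps)
        ultimately show ?thesis by blast
      qed
    qed
    \<comment> \<open>Only midpoints are tested, and they lie strictly between a and b; so the bound
      on g inside the interval also controls the mass at its end points.\<close>
    have mid: "measure \<rho> (cis ` {m i - d..m i + d}) \<le> c * d\<^sup>2 / 2" if "i < n" for i
    proof (rule short_arc_bound[OF d(1) assms(2)], rule assms(3))
      have "0 < (2 * real i + 1) * d" using d by (intro mult_pos_pos) auto
      then show "a < m i" by (simp add: m_def)
      have "(2 * real i + 1) * d < 2 * real n * d" using that d by (intro mult_strict_right_mono) auto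
      then show "m i < b" using d(2) by (simp add: m_def algebra_simps)
    qed
    have "measure \<rho> (cis ` {a..b}) \<le> measure \<rho> (\<Union>i<n. cis ` {m i - d..m i + d})"
      using image_mono[OF cover, of cis] unfolding image_UN
      by (rule finite_measure_mono) (intro sets.finite_UN cis_arc_measurable, simp)
    also have "\<dots> \<le> (\<Sum>i<n. measure \<rho> (cis ` {m i - d..m i + d}))"
      by (intro measure_UNION_le cis_arc_measurable) auto
    also have "\<dots> \<le> (\<Sum>i<n. c * d\<^sup>2 / 2)" using mid by (intro sum_mono) auto
    also have "\<dots> = c * (b - a)\<^sup>2 / 8 / real n"
      using n by (simp add: d_def power_divide power_mult_distrib power2_eq_square)
    finally show ?thesis by (simp add: n_def)
  qed
  have "(\<lambda>N. c * (b - a)\<^sup>2 / 8 / real (Suc N)) \<longlonglongrightarrow> 0" by real_asymp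
  then have "measure \<rho> (cis ` {a..b}) \<le> 0"
    by (rule LIMSEQ_le_const) (use bound in auto)
  then show ?thesis by (simp add: emeasure_eq_measure measure_le_0_iff)
qed

lemma cis_period_representative: "\<exists>\<phi>. a \<le> \<phi> \<and> \<phi> < a + 2 * pi \<and> cis \<phi> = cis y"
proof -
  define k where "k = \<lfloor>(y - a) / (2 * pi)\<rfloor>"
  have "of_int k \<le> (y - a) / (2 * pi)" "(y - a) / (2 * pi) < of_int k + 1"
    unfolding k_def by linarith+
  then have "a \<le> y - 2 * pi * of_int k" "y - 2 * pi * of_int k < a + 2 * pi"
    by (auto simp: field_simps)
  moreover have "cis (y - 2 * pi * of_int k) = cis y"
    by (simp flip: cis_divide add: cis_multiple_2pi)
  ultimately show ?thesis by blast
qed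

text \<open>Almost every \<zeta> avoids the arc and so has an argument strictly between b and
  \<open>a + 2 * pi\<close>. Its differences from the angles in \<open>{a..b}\<close> stay in one
  period, where the kernel is convex. Integrating the convexity inequality bounds g at x by its
  values at a and b.\<close>

lemma g_fun_le_on_null_arc:
  assumes "a < x" "x < b" "emeasure \<rho> (cis ` {a..b}) = 0"
    and C: "g_fun \<rho> a \<le> ennreal C" "g_fun \<rho> b \<le> ennreal C"
  shows "g_fun \<rho> x \<le> ennreal C"
proof -
  define l where "l = (x - a) / (b - a)"
  have l: "0 < l" "l < 1" using assms by (auto simp: l_def field_simps)
  have xl: "x = (1 - l) * a + l * b"
  proof -
    have "l * (b - a) = x - a" using assms by (simp add: l_def)
    then show ?thesis by (simp add: algebra_simps)
  qed
  let ?k = "\<lambda>\<theta> \<zeta>. 1 / ennreal (1 - cos (\<theta> - Arg \<zeta>))"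
  have km: "?k \<theta> \<in> borel_measurable \<rho>" for \<theta>
  proof -
    have "(\<lambda>\<zeta>. 1 / ennreal ((norm (\<zeta> - cis \<theta>))\<^sup>2 / 2)) \<in> borel_measurable \<rho>"
      by (rule borel_measurable_rho) measurable
    then show ?thesis
      by (rule measurable_cong[THEN iffD1, rotated]) (simp add: one_minus_cos_Arg space_rho)
  qed
  have "AE \<zeta> in \<rho>. \<zeta> \<notin> cis ` {a..b}"
    using assms(3) cis_arc_measurable by (subst AE_iff_null_sets[symmetric]) auto
  then have AE: "AE \<zeta> in \<rho>. ?k x \<zeta> \<le> ennreal (1 - l) * ?k a \<zeta> + ennreal l * ?k b \<zeta>"
    using AE_space
  proof eventually_elim
    case (elim \<zeta>)
    then have z: "norm \<zeta> = 1" by (simp add: space_rho)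
    obtain \<phi> where \<phi>: "a \<le> \<phi>" "\<phi> < a + 2 * pi" "cis \<phi> = \<zeta>"
      using cis_period_representative[of a "Arg \<zeta>"] cis_Arg_circle[OF z] by metis
    then have "b < \<phi>" using elim by (force simp: image_iff)
    define f where "f y = 1 / (1 - cos y)" for y :: real
    have kf: "?k \<theta> \<zeta> = ennreal (f (\<phi> - \<theta>))" "f (\<phi> - \<theta>) \<ge> 0" if "a \<le> \<theta>" "\<theta> \<le> b" for \<theta>
    proof -
      have c: "cos (\<theta> - Arg \<zeta>) = cos (\<phi> - \<theta>)"
        unfolding cos_diff_Arg[OF z] unfolding \<phi>(3)[symmetric] by (simp add: cos_diff mult.commute)
      have "\<phi> - \<theta> \<in> {0<..<2*pi}" using that \<phi> \<open>b < \<phi>\<close> assms by auto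
      then have "0 < sin ((\<phi> - \<theta>) / 2)" by (intro sin_gt_zero) auto
      moreover have "\<phi> - \<theta> = 2 * ((\<phi> - \<theta>) / 2)" by simp
      then have "cos (\<phi> - \<theta>) = 1 - 2 * (sin ((\<phi> - \<theta>) / 2))\<^sup>2"
        using cos_double_sin[of "(\<phi> - \<theta>) / 2"] by (simp only:)
      ultimately have p: "0 < 1 - cos (\<phi> - \<theta>)" by simp
      then show "?k \<theta> \<zeta> = ennreal (f (\<phi> - \<theta>))"
        using divide_ennreal[of 1 "1 - cos (\<phi> - \<theta>)"] unfolding c f_def by simp
      show "f (\<phi> - \<theta>) \<ge> 0" using p by (simp add: f_def)
    qed
    have "convex_on {0<..<2*pi} f" unfolding f_def by (rule convex_on_inverse_one_minus_cos)
    then have "f ((1 - l) *\<^sub>R (\<phi> - a) + l *\<^sub>R (\<phi> - b)) \<le> (1 - l) * f (\<phi> - a) + l * f (\<phi> - b)"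
      using l \<phi> \<open>b < \<phi>\<close> assms by (intro convex_onD) auto
    also have "(1 - l) *\<^sub>R (\<phi> - a) + l *\<^sub>R (\<phi> - b) = \<phi> - x"
      unfolding xl by (simp add: algebra_simps)
    finally have "ennreal (f (\<phi> - x)) \<le> ennreal ((1 - l) * f (\<phi> - a) + l * f (\<phi> - b))" by (rule ennreal_leI)
    also have "\<dots> = ennreal (1 - l) * ennreal (f (\<phi> - a)) + ennreal l * ennreal (f (\<phi> - b))"
      using l kf(2)[of a] kf(2)[of b] assms by (simp add: ennreal_plus ennreal_mult)
    finally show ?case using kf(1)[of a] kf(1)[of b] kf(1)[of x] assms by simp
  qed
  have "g_fun \<rho> x \<le> (\<integral>\<^sup>+\<zeta>. ennreal (1 - l) * ?k a \<zeta> + ennreal l * ?k b \<zeta> \<partial>\<rho>)"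
    unfolding g_fun_def by (rule nn_integral_mono_AE[OF AE])
  also have "\<dots> = ennreal (1 - l) * g_fun \<rho> a + ennreal l * g_fun \<rho> b"
    unfolding g_fun_def using km by (subst nn_integral_add) (auto simp: nn_integral_cmult)
  also have "\<dots> \<le> ennreal (1 - l) * ennreal C + ennreal l * ennreal C"
    by (intro add_mono mult_left_mono C) auto
  also have "\<dots> = ennreal C"
    using l by (simp flip: distrib_right ennreal_plus)
  finally show ?thesis .
qed

text \<open>K is the image of the maximal interval around \<open>x0\<close> on which g exceeds the
  threshold for t. Closedness puts its end points into the sublevel set. If it missed
  \<open>V_plus \<rho> s\<close>, then g would be bounded on it, \<open>null_arc\<close> would
  remove its mass, and convexity would contradict the choice of \<open>x0\<close>.\<close>

lemma V_plus_connected_link: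
  assumes st: "1 < s" "s < t"
    and closed: "closed {x. g_fun \<rho> x \<le> ennreal (1 / (t - 1))}"
    and w: "w \<in> cis ` V_plus \<rho> t"
  shows "\<exists>K. connected K \<and> K \<subseteq> cis ` V_plus \<rho> t \<and> w \<in> K \<and> K \<inter> cis ` V_plus \<rho> s \<noteq> {}"
proof -
  define F where "F = {x. g_fun \<rho> x \<le> ennreal (1 / (t - 1))}"
  obtain x0 where x0: "w = cis x0" "g_fun \<rho> x0 > ennreal (1 / (t - 1))"
    using w mem_cis_V_plus by blast
  have conn: "connected (cis ` I)" if "connected I" for I
    by (rule connected_continuous_image[OF _ that]) (intro continuous_intros)
  have sub: "cis ` I \<subseteq> cis ` V_plus \<rho> t" if "I \<inter> F = {}" for I
  proof
    fix e assume "e \<in> cis ` I"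
    then obtain x where x: "e = cis x" "x \<in> I" by (rule imageE)
    then have "x \<notin> F" using that by auto
    then have "ennreal (1 / (t - 1)) < g_fun \<rho> x" unfolding F_def mem_Collect_eq not_le .
    then show "e \<in> cis ` V_plus \<rho> t" unfolding x(1) mem_cis_V_plus .
  qed
  have small: "g_fun \<rho> x \<le> ennreal (1 / (s - 1))" if "cis ` I \<inter> cis ` V_plus \<rho> s = {}" "x \<in> I" for x I
  proof -
    have "cis x \<notin> cis ` V_plus \<rho> s" using that by blast
    then show ?thesis unfolding mem_cis_V_plus not_less .
  qed
  show ?thesis
  proof (cases "F = {}")
    \<comment> \<open>There are no end points to work with. Here K is the whole circle; if it missed
      \<open>V_plus \<rho> s\<close>, the measure \<rho> would vanish and g with it.\<close>
    case True
    have "cis ` UNIV \<inter> cis ` V_plus \<rho> s \<noteq> {}"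
    proof
      assume "cis ` UNIV \<inter> cis ` V_plus \<rho> s = {}"
      from small[OF this] have "emeasure \<rho> (cis ` {0..2*pi}) = 0"
        using st by (intro null_arc[of _ _ "1 / (s - 1)"]) auto
      moreover have "space \<rho> \<subseteq> cis ` {0..2*pi}"
      proof
        fix \<zeta> assume "\<zeta> \<in> space \<rho>"
        then have z: "cis (Arg \<zeta>) = \<zeta>" by (intro cis_Arg_circle) (simp add: space_rho)
        obtain \<phi> where "0 \<le> \<phi>" "\<phi> < 0 + 2 * pi" "cis \<phi> = cis (Arg \<zeta>)"
          using cis_period_representative[of 0 "Arg \<zeta>"] by blast
        then show "\<zeta> \<in> cis ` {0..2*pi}" using z by (intro image_eqI[of _ _ \<phi>]) auto
      qed
      ultimately have "emeasure \<rho> (space \<rho>) = 0"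
        using emeasure_mono[of "space \<rho>" "cis ` {0..2*pi}" \<rho>] cis_arc_measurable by simp
      then have "space \<rho> \<in> null_sets \<rho>" by (intro null_setsI) auto
      from AE_not_in[OF this] have "AE \<zeta> in \<rho>. 1 / ennreal (1 - cos (x0 - Arg \<zeta>)) = 0"
        using AE_space by eventually_elim simp
      then have "g_fun \<rho> x0 = (\<integral>\<^sup>+\<zeta>. 0 \<partial>\<rho>)"
        unfolding g_fun_def by (rule nn_integral_cong_AE)
      then show False using x0 by simp
    qed
    then show ?thesis
      using sub[of UNIV] True x0 conn[of UNIV] by (intro exI[of _ "cis ` UNIV"]) auto
  next
    case False
    then obtain y where y: "y \<in> F" by blast
    have Fcis: "x \<in> F" if "cis x = cis y" for x
      using that y by (simp add: F_def g_fun_eq)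
    \<comment> \<open>Periodicity of g provides points of \<open>F\<close> on both sides of
      \<open>x0\<close>, so both the supremum and the infimum below are over nonempty sets.\<close>
    obtain y2 where y2: "x0 \<le> y2" "cis y2 = cis y" using cis_period_representative[of x0 y] by blast
    obtain y1 where y1: "y1 < x0" "cis y1 = cis y" using cis_period_representative[of "x0 - 2 * pi" y] by auto
    define a b where "a = Sup (F \<inter> {..x0})" and "b = Inf (F \<inter> {x0..})"
    have clF: "closed F" using closed by (simp add: F_def)
    have bd: "bdd_above (F \<inter> {..x0})" "bdd_below (F \<inter> {x0..})" by auto
    have "a \<in> F \<inter> {..x0}"
    proof -
      have "y1 \<in> F \<inter> {..x0}" using y1 Fcis by simp
      then have "F \<inter> {..x0} \<noteq> {}" by blast
      then show ?thesis
        unfolding a_def by (rule closed_contains_Sup[OF _ bd(1)]) (intro closed_Int clF closed_atMost)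
    qed
    moreover have "b \<in> F \<inter> {x0..}"
    proof -
      have "y2 \<in> F \<inter> {x0..}" using y2 Fcis by simp
      then have "F \<inter> {x0..} \<noteq> {}" by blast
      then show ?thesis
        unfolding b_def by (rule closed_contains_Inf[OF _ bd(2)]) (intro closed_Int clF closed_atLeast)
    qed
    moreover have "x0 \<notin> F" using x0 by (simp add: F_def)
    ultimately have ab: "a \<in> F" "b \<in> F" "a < x0" "x0 < b" by (auto simp: less_le)
    have disj: "{a<..<b} \<inter> F = {}"
    proof (rule ccontr)
      assume "{a<..<b} \<inter> F \<noteq> {}"
      then obtain x where x: "a < x" "x < b" "x \<in> F" by auto
      show False
      proof (cases "x \<le> x0")
        case True
        then have "x \<le> a" unfolding a_def using x by (intro cSup_upper bd) auto
        then show False using x by simp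
      next
        case False
        then have "b \<le> x" unfolding b_def using x by (intro cInf_lower bd) auto
        then show False using x by simp
      qed
    qed
    have "cis ` {a<..<b} \<inter> cis ` V_plus \<rho> s \<noteq> {}"
    proof
      assume "cis ` {a<..<b} \<inter> cis ` V_plus \<rho> s = {}"
      from small[OF this] have "emeasure \<rho> (cis ` {a..b}) = 0"
        using st ab by (intro null_arc[of _ _ "1 / (s - 1)"]) auto
      then have "g_fun \<rho> x0 \<le> ennreal (1 / (t - 1))"
        using ab by (intro g_fun_le_on_null_arc[of a x0 b]) (auto simp: F_def)
      then show False using x0 by simp
    qed
    then show ?thesis
      using sub[OF disj] ab x0 conn[of "{a<..<b}"] by (intro exI[of _ "cis ` {a<..<b}"]) auto
  qed
qed

end

lemma (in herglotz_subordination) closed_g_fun_le: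
  "closed {x. g_fun \<rho> x \<le> ennreal (1 / (t - 1))}"
proof -
  have "sphere 0 1 - inner_circle = sphere 0 1 \<inter> (\<lambda>z. norm (\<omega> z)) -` {1..}"
    by (auto simp: inner_circle_def)
  moreover have "closed (sphere 0 1 \<inter> (\<lambda>z. norm (\<omega> z)) -` {1..})"
    by (intro continuous_closed_preimage continuous_intros continuous_on_subset[OF omega_continuous]) auto
  ultimately have "compact (sphere 0 1 - inner_circle)"
    using compact_Int_closed[OF compact_sphere[of "0::complex" 1], of "sphere 0 1 - inner_circle"] by (simp add: Int_absorb1)
  then have "compact (omega_dir ` (sphere 0 1 - inner_circle))"
    by (intro compact_continuous_image continuous_on_subset[OF omega_dir_continuous]) auto
  then have "closed (cis -` (omega_dir ` (sphere 0 1 - inner_circle)))"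
    by (intro closed_vimage compact_imp_closed continuous_intros)
  moreover have "inner_circle \<subseteq> sphere 0 1" by (auto simp: inner_circle_def)
  then have "omega_dir ` (sphere 0 1 - inner_circle) = sphere 0 1 - cis ` V_plus \<rho> t"
    unfolding omega_dir_image[symmetric] using inj_on_image_set_diff[OF omega_dir_inj, of "sphere 0 1" inner_circle] omega_dir_surj
    by simp
  ultimately have "closed {x. cis x \<in> sphere 0 1 - cis ` V_plus \<rho> t}" by (simp add: vimage_def)
  then show ?thesis by (simp add: mem_cis_V_plus not_less)
qed

text \<open>In the direction coordinate the sets for s and t become nested, since the threshold
  \<open>1 / (t - 1)\<close> decreases with t. Passing to directions with s and back with t gives a
  continuous map between the closures, and \<open>V_plus_connected_link\<close> supplies the
  connected sets that link each point of \<open>S_set u \<rho> t\<close> to its image.\<close>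

lemma num_components_antimono:
  assumes "herglotz_subordination u \<alpha>\<^sub>0 \<rho> s \<omega>\<^sub>s" "herglotz_subordination u \<alpha>\<^sub>0 \<rho> t \<omega>\<^sub>t" "s \<le> t"
  shows "num_components (closure (S_set u \<rho> t)) \<le> num_components (closure (S_set u \<rho> s))"
proof (cases "s = t")
  case False
  then have st: "s < t" using assms by simp
  interpret S: herglotz_subordination u \<alpha>\<^sub>0 \<rho> s \<omega>\<^sub>s by fact
  interpret T: herglotz_subordination u \<alpha>\<^sub>0 \<rho> t \<omega>\<^sub>t by fact
  \<comment> \<open>The inverse of the direction map for t; it is continuous because the circle is
    compact.\<close>
  define j where "j = the_inv_into (sphere 0 1) T.omega_dir"
  have jk: "j (T.omega_dir z) = z" if "norm z = 1" for z
    unfolding j_def using that by (intro the_inv_into_f_f T.omega_dir_inj) simp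
  have j_cont: "continuous_on (sphere 0 1) j"
    using continuous_on_inv_into[OF T.omega_dir_continuous compact_sphere T.omega_dir_inj] by (simp add: j_def T.omega_dir_surj)
  have j_U: "j ` (cis ` V_plus \<rho> t) = T.inner_circle"
    unfolding T.omega_dir_image[symmetric] image_image using jk by (force simp: T.inner_circle_def)
  have V_mono: "cis ` V_plus \<rho> s \<subseteq> cis ` V_plus \<rho> t"
  proof -
    have "1 / (t - 1) \<le> 1 / (s - 1)" using st S.t by (intro divide_left_mono) auto
    then have "ennreal (1 / (t - 1)) \<le> ennreal (1 / (s - 1))" by (rule ennreal_leI)
    then have "V_plus \<rho> s \<subseteq> V_plus \<rho> t" unfolding V_plus_def by auto
    then show ?thesis by (rule image_mono)
  qed
  have V_circle: "cis ` V_plus \<rho> t \<subseteq> sphere 0 1" by auto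
  have S_circle: "S_set u \<rho> s \<subseteq> sphere 0 1" unfolding S.S_set_eq by (auto simp: S.inner_circle_def)
  then have cl_circle: "closure (S_set u \<rho> s) \<subseteq> sphere 0 1" by (rule closure_minimal) simp
  \<comment> \<open>The conjugations pass between \<open>S_set\<close> and
    \<open>inner_circle\<close>, on which the direction maps act.\<close>
  define f where "f x = cnj (j (S.omega_dir (cnj x)))" for x
  have "continuous_on (sphere 0 1) (\<lambda>x. S.omega_dir (cnj x))"
    by (intro continuous_on_compose2[OF S.omega_dir_continuous] continuous_intros) auto
  then have f_cont: "continuous_on (sphere 0 1) f"
    unfolding f_def using S.norm_omega_dir
    by (intro continuous_on_cnj continuous_on_compose2[OF j_cont]) auto
  have f_S: "f ` S_set u \<rho> s \<subseteq> S_set u \<rho> t"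
  proof -
    have "j (S.omega_dir z) \<in> T.inner_circle" if "z \<in> S.inner_circle" for z
    proof -
      have "S.omega_dir z \<in> cis ` V_plus \<rho> t"
        using V_mono that unfolding S.omega_dir_image[symmetric] by blast
      then show ?thesis unfolding j_U[symmetric] by (rule imageI)
    qed
    then have "(\<lambda>z. cnj (j (S.omega_dir z))) ` S.inner_circle \<subseteq> cnj ` T.inner_circle" by blast
    then show ?thesis unfolding S.S_set_eq T.S_set_eq f_def by (simp add: image_image)
  qed
  show ?thesis
  proof (rule num_components_le_by_image[where f = f and W = "S_set u \<rho> t"])
    show fc: "continuous_on (closure (S_set u \<rho> s)) f" by (rule continuous_on_subset[OF f_cont cl_circle])
    show "f ` closure (S_set u \<rho> s) \<subseteq> closure (S_set u \<rho> t)"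
      by (rule image_closure_subset[OF fc closed_closure order_trans[OF f_S closure_subset]])
    fix w assume "w \<in> S_set u \<rho> t"
    then obtain z where z: "z \<in> T.inner_circle" "w = cnj z" by (auto simp: T.S_set_eq)
    then have "T.omega_dir z \<in> cis ` V_plus \<rho> t" unfolding T.omega_dir_image[symmetric] by blast
    from S.V_plus_connected_link[OF S.t st T.closed_g_fun_le this]
    obtain K where K: "connected K" "K \<subseteq> cis ` V_plus \<rho> t" "T.omega_dir z \<in> K" "K \<inter> cis ` V_plus \<rho> s \<noteq> {}" by blast
    show "\<exists>K. connected K \<and> K \<subseteq> closure (S_set u \<rho> t) \<and> w \<in> K \<and> K \<inter> f ` closure (S_set u \<rho> s) \<noteq> {}"
    proof (intro exI[of _ "(\<lambda>e. cnj (j e)) ` K"] conjI)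
      have "K \<subseteq> sphere 0 1" using K(2) V_circle by blast
      then show "connected ((\<lambda>e. cnj (j e)) ` K)"
        by (intro connected_continuous_image[OF _ K(1)] continuous_intros continuous_on_subset[OF j_cont])
      have "(\<lambda>e. cnj (j e)) ` K \<subseteq> S_set u \<rho> t" unfolding T.S_set_eq j_U[symmetric] using K(2) by auto
      then show "(\<lambda>e. cnj (j e)) ` K \<subseteq> closure (S_set u \<rho> t)" by (rule order_trans[OF _ closure_subset])
      have "j (T.omega_dir z) = z" using z by (intro jk) (simp add: T.inner_circle_def)
      then show "w \<in> (\<lambda>e. cnj (j e)) ` K" using K(3) z by (intro image_eqI[of _ _ "T.omega_dir z"]) auto
      obtain e where e: "e \<in> K" "e \<in> cis ` V_plus \<rho> s" using K(4) by blast
      obtain y where y: "y \<in> S.inner_circle" "e = S.omega_dir y" using e(2)[folded S.omega_dir_image] by (rule imageE)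
      have "cnj y \<in> S_set u \<rho> s" unfolding S.S_set_eq using y(1) by (rule imageI)
      then have "cnj y \<in> closure (S_set u \<rho> s)" using closure_subset by (rule rev_subsetD)
      moreover have "f (cnj y) = cnj (j e)" by (simp add: f_def y)
      ultimately show "(\<lambda>e. cnj (j e)) ` K \<inter> f ` closure (S_set u \<rho> s) \<noteq> {}" using e(1) by blast
    qed
  qed (simp_all add: closure_subset)
qed simp

theorem theorem4p7:
  fixes \<mu> \<rho> :: "complex measure"
    and u :: "complex \<Rightarrow> complex"
    and \<alpha>\<^sub>0 :: real
    and \<omega> :: "real \<Rightarrow> complex \<Rightarrow> complex"
    and \<nu> :: "real \<Rightarrow> complex measure"
  assumes mu: "\<mu> \<in> MT"
    and u: "herglotz_data \<mu> u \<alpha>\<^sub>0 \<rho>"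
    and omega: "\<And>t. t > 1 \<Longrightarrow> subordination u t (\<omega> t)"
    and power: "\<And>t. t > 1 \<Longrightarrow> free_mult_power \<mu> (\<omega> t) (\<nu> t)"
  shows "(\<forall>t>1.
       emeasure (ac_part arc_length (\<nu> t)) (sphere 0 1 - closure (S_set u \<rho> t)) = 0 \<and>
       (\<exists>p. p \<in> borel_measurable arc_length \<and> (\<forall>\<zeta>. p \<zeta> \<ge> 0) \<and>
          ac_part arc_length (\<nu> t) = density arc_length (\<lambda>\<zeta>. ennreal (p \<zeta>)) \<and>
          circle_analytic_on p (S_set u \<rho> t) \<and>
          (\<forall>\<theta> \<in> V_plus \<rho> t. p (cnj (h_fun u \<rho> t \<theta>)) =
             1 / (2 * pi) * ((1 - (l_fun \<rho> t \<theta>)\<^sup>2) /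
               (1 - 2 * l_fun \<rho> t \<theta> * cos (alpha_fun u \<rho> t \<theta>) + (l_fun \<rho> t \<theta>)\<^sup>2))))) \<and>
     antimono_on {1<..} (\<lambda>t. num_components (closed_support (ac_part arc_length (\<nu> t))))"
proof -
  have herglotz: "herglotz u \<alpha>\<^sub>0 \<rho>"
    using u analytic_imp_holomorphic unfolding herglotz_data_def herglotz_def by auto
  have sub: "herglotz_subordination u \<alpha>\<^sub>0 \<rho> t (\<omega> t)" if "t > 1" for t
    using herglotz omega[OF that] that
    by (simp add: herglotz_subordination_def herglotz_power_def
        herglotz_power_axioms_def herglotz_subordination_axioms_def)
  have conv: "herglotz_convolution_power u \<alpha>\<^sub>0 \<rho> t (\<omega> t) (\<nu> t)" if "t > 1" for t
  proof -
    interpret herglotz_subordination u \<alpha>\<^sub>0 \<rho> t "\<omega> t" by (rule sub[OF that])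
    have "eta (\<nu> t) z = \<omega> t z * exp (- u (\<omega> t z))" if "norm z < 1" for z
      using power[OF \<open>t > 1\<close>] u that omega_ball[OF that]
      by (simp add: free_mult_power_def herglotz_data_def)
    moreover have "prob_space (\<nu> t)" "sets (\<nu> t) = sets circle_borel"
      using power[OF that] by (simp_all add: free_mult_power_def MT_def)
    ultimately show ?thesis
      by (intro herglotz_convolution_power.intro[OF sub[OF \<open>t > 1\<close>]] herglotz_convolution_power_axioms.intro)
  qed
  show ?thesis
  proof (intro conjI allI impI monotone_onI)
    fix t :: real assume "t > 1"
    interpret herglotz_convolution_power u \<alpha>\<^sub>0 \<rho> t "\<omega> t" "\<nu> t" by (rule conv) fact
    show "emeasure (ac_part arc_length (\<nu> t)) (sphere 0 1 - closure (S_set u \<rho> t)) = 0"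
      by (rule ac_part_concentrated)
    show "\<exists>p. p \<in> borel_measurable arc_length \<and> (\<forall>\<zeta>. p \<zeta> \<ge> 0) \<and>
          ac_part arc_length (\<nu> t) = density arc_length (\<lambda>\<zeta>. ennreal (p \<zeta>)) \<and>
          circle_analytic_on p (S_set u \<rho> t) \<and>
          (\<forall>\<theta> \<in> V_plus \<rho> t. p (cnj (h_fun u \<rho> t \<theta>)) =
             1 / (2 * pi) * ((1 - (l_fun \<rho> t \<theta>)\<^sup>2) /
               (1 - 2 * l_fun \<rho> t \<theta> * cos (alpha_fun u \<rho> t \<theta>) + (l_fun \<rho> t \<theta>)\<^sup>2)))"
      using ac_density_measurable ac_density_nonneg ac_part_nu circle_analytic_ac_density density_formula by blast
  next
    fix s t :: real assume "s \<in> {1<..}" "t \<in> {1<..}" "s \<le> t"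
    then have st: "s > 1" "t > 1" "s \<le> t" by auto
    show "num_components (closed_support (ac_part arc_length (\<nu> s))) \<ge>
        num_components (closed_support (ac_part arc_length (\<nu> t)))"
      unfolding herglotz_convolution_power.closed_support_ac_part[OF conv[OF st(1)]]
        herglotz_convolution_power.closed_support_ac_part[OF conv[OF st(2)]]
      by (rule num_components_antimono[OF sub[OF st(1)] sub[OF st(2)] st(3)])
  qed
qed

end
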